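(* Let $N\ge 2$, $R>0$, $\Omega=\mathcal{B}_R(0)\subset\mathbb{R}^N$ and $p>2$. For $\lambda,\mu\in\mathbb{R}$ consider the problem $$ -\operatorname{div}\left(\frac{\nabla u}{\sqrt{1-|\nabla u|^2}}\right)=\lambda u+\mu|u|^{p-2}u\ \text{ in }\Omega,\qquad u=0\ \text{ on }\partial\Omega. \tag{P} $$ There exists a family $\{\mu_j^\star\}_{j=1}^{+\infty}$ of functions $\mu_j^\star:[0,+\infty)\to[0,+\infty)$ satisfying, for every $j\ge1$, (i) $\mu_j^\star(\lambda)=0$ if $\lambda>\lambda_j^{\mathrm{rad}}$, (ii) $\mu_j^\star(\lambda)\le\mu_{j+1}^\star(\lambda)$ for all $\lambda\ge0$, such that problem (P) has at least $2j-k$ radial solutions when $$ \lambda\in[\lambda_k^{\mathrm{rad}},\lambda_{k+1}^{\mathrm{rad}})\quad\text{and}\quad \mu>\mu_j^\star(\lambda)\qquad\text{for some } j\ge\max\{1,k\}, $$ where $k\ge 0$ is an integer. Precisely, these solutions can be labeled as $\{u_{\mu,\ell}^{(s)}\}_{\ell=k+1}^{j}$, $\{u_{\mu,\ell}^{(l)}\}_{\ell=1}^{j}$ in such a way that (a) $0<u_{\mu,k+1}^{(s)}(0)<\dots<u_{\mu,j}^{(s)}(0)<u_{\mu,j}^{(l)}(0)<\dots<u_{\mu,1}^{(l)}(0)$; (b) $u_{\mu,\ell}^{(s)}$ has exactly $\ell-1$ zeros on $(0,R)$, is strictly decreasing in the interval from $0$ to the first zero, and has exactly one local extremum between any two consecutive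 zeros, for every $\ell=k+1,\dots,j$; (c) $u_{\mu,\ell}^{(l)}$ has exactly $\ell-1$ zeros on $(0,R)$, is strictly decreasing in the interval from $0$ to the first zero, and has exactly one local extremum between any two consecutive zeros, for every $\ell=1,\dots,j$.
   Context: $\mathcal{B}_R(0)$ is the open ball of radius $R$ centered at $0$. For $k\ge1$, $\lambda_k^{\mathrm{rad}}$ denotes the $k$-th radial eigenvalue of the Dirichlet Laplacian $-\Delta$ in $\mathcal{B}_R(0)$ (i.e. the $k$-th eigenvalue, in increasing order, having a radial eigenfunction), and by convention $\lambda_0^{\mathrm{rad}}=0$. A radial solution is written $u=u(r)$, $r=|x|\in[0,R]$; it satisfies $|u'|<1$ on $[0,R]$ and $$ -\left(r^{N-1}\frac{u'}{\sqrt{1-(u')^2}}\right)'=r^{N-1}\left(\lambda u+\mu|u|^{p-2}u\right),\ r\in(0,R),\qquad u'(0)=0,\ u(R)=0. $$ Zeros and monotonicity refer to $u$ as a function of $r\in[0,R]$ (in the monotonicity statements the endpoint $r=R$ is a zero of $u$). When $j=k$ the family $\{u_{\mu,\ell}^{(s)}\}$ is empty. *)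

theory Defs
  imports "HOL-Analysis.Analysis"
begin

definition grad :: "('a::euclidean_space \<Rightarrow> real) \<Rightarrow> 'a \<Rightarrow> 'a" where
  "grad u x = (THE D. GDERIV u x :> D)"

lemma grad_eqI: "GDERIV u x :> D \<Longrightarrow> grad u x = D"
  unfolding grad_def
proof (rule the_equality)
  fix D' assume "GDERIV u x :> D" "GDERIV u x :> D'"
  hence "(\<lambda>h. h \<bullet> D) = (\<lambda>h. h \<bullet> D')"
    unfolding gderiv_def by (rule has_derivative_unique)
  thus "D' = D" using vector_eq_rdot[of D' D] by (simp add: fun_eq_iff inner_commute)
qed

definition divergence :: "('a::euclidean_space \<Rightarrow> 'a) \<Rightarrow> 'a \<Rightarrow> real" where
  "divergence F x = (\<Sum>b\<in>Basis. frechet_derivative F (at x) b \<bullet> b)"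

definition laplacian :: "('a::euclidean_space \<Rightarrow> real) \<Rightarrow> 'a \<Rightarrow> real" where
  "laplacian u x = divergence (grad u) x"

text \<open>The next two predicates are meant for open sets \<open>S\<close>.\<close>

definition C1_on :: "('a::euclidean_space \<Rightarrow> 'b::euclidean_space) \<Rightarrow> 'a set \<Rightarrow> bool" where
  "C1_on f S \<longleftrightarrow> (\<exists>f' :: 'a \<Rightarrow> ('a \<Rightarrow>\<^sub>L 'b).
     (\<forall>x\<in>S. (f has_derivative blinfun_apply (f' x)) (at x)) \<and> continuous_on S f')"

definition C2_on :: "('a::euclidean_space \<Rightarrow> real) \<Rightarrow> 'a set \<Rightarrow> bool" where
  "C2_on u S \<longleftrightarrow> C1_on u S \<and> C1_on (grad u) S"

definition dirichlet_eigenfunction ::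
  "real \<Rightarrow> real \<Rightarrow> ('a::euclidean_space \<Rightarrow> real) \<Rightarrow> bool" where
  "dirichlet_eigenfunction R lam \<phi> \<longleftrightarrow>
     C2_on \<phi> (ball 0 R) \<and> continuous_on (cball 0 R) \<phi> \<and>
     (\<exists>x\<in>ball 0 R. \<phi> x \<noteq> 0) \<and>
     (\<forall>x\<in>ball 0 R. - laplacian \<phi> x = lam * \<phi> x) \<and>
     (\<forall>x\<in>sphere 0 R. \<phi> x = 0)"

definition radial_eigenvalues :: "'a::euclidean_space itself \<Rightarrow> real \<Rightarrow> real set" where
  "radial_eigenvalues _ R =
     {lam. \<exists>v :: real \<Rightarrow> real. dirichlet_eigenfunction R lam (\<lambda>x::'a. v (norm x))}"

text \<open>The \<open>k\<close>-th radial eigenvalue is the one having exactly \<open>k - 1\<close> radial eigenvalues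
  below it; at \<open>k = 0\<close> the value is a convention.\<close>

definition lambda_rad :: "'a::euclidean_space itself \<Rightarrow> real \<Rightarrow> nat \<Rightarrow> real" where
  "lambda_rad T R k = (if k = 0 then 0 else
     (THE lam. lam \<in> radial_eigenvalues T R \<and>
        finite {\<nu> \<in> radial_eigenvalues T R. \<nu> < lam} \<and>
        card {\<nu> \<in> radial_eigenvalues T R. \<nu> < lam} = k - 1))"

definition reaction :: "real \<Rightarrow> real \<Rightarrow> real \<Rightarrow> real \<Rightarrow> real" where
  "reaction p lam \<mu> s = lam * s + \<mu> * \<bar>s\<bar> powr (p - 2) * s"

text \<open>Classical solutions: \<open>u\<close> is twice continuously differentiable in the open ball, its
  gradient extends continuously to the closed ball, and the extension \<open>g\<close> has norm less
  than 1 up to the boundary.\<close>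

definition solves_P ::
  "real \<Rightarrow> real \<Rightarrow> real \<Rightarrow> real \<Rightarrow> ('a::euclidean_space \<Rightarrow> real) \<Rightarrow> bool" where
  "solves_P R p lam \<mu> u \<longleftrightarrow>
     C2_on u (ball 0 R) \<and> continuous_on (cball 0 R) u \<and>
     (\<exists>g. continuous_on (cball 0 R) g \<and> (\<forall>x\<in>ball 0 R. g x = grad u x) \<and>
          (\<forall>x\<in>cball 0 R. norm (g x) < 1)) \<and>
     (\<forall>x\<in>ball 0 R.
        - divergence (\<lambda>y. grad u y /\<^sub>R sqrt (1 - (norm (grad u y))\<^sup>2)) x
          = reaction p lam \<mu> (u x)) \<and>
     (\<forall>x\<in>sphere 0 R. u x = 0)"

definition solves_radial_ode ::
  "nat \<Rightarrow> real \<Rightarrow> real \<Rightarrow> real \<Rightarrow> real \<Rightarrow> (real \<Rightarrow> real) \<Rightarrow> bool" where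
  "solves_radial_ode N R p lam \<mu> u \<longleftrightarrow> (\<exists>u'.
     continuous_on {0..R} u' \<and>
     (\<forall>r\<in>{0..R}. (u has_real_derivative u' r) (at r within {0..R}) \<and> \<bar>u' r\<bar> < 1) \<and>
     (\<forall>r\<in>{0<..<R}.
        ((\<lambda>s. s ^ (N - 1) * (u' s / sqrt (1 - (u' s)\<^sup>2)))
          has_real_derivative - (r ^ (N - 1) * reaction p lam \<mu> (u r))) (at r)) \<and>
     u' 0 = 0 \<and> u R = 0)"

text \<open>A radial solution is given by its profile \<open>u\<close>, a function of \<open>r = norm x\<close>; only the
  values of \<open>u\<close> on \<open>{0..R}\<close> matter. The second conjunct is the radial form of the first one.\<close>

definition radial_solution ::
  "'a::euclidean_space itself \<Rightarrow> real \<Rightarrow> real \<Rightarrow> real \<Rightarrow> real \<Rightarrow> (real \<Rightarrow> real) \<Rightarrow> bool" where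
  "radial_solution _ R p lam \<mu> u \<longleftrightarrow>
     solves_P R p lam \<mu> (\<lambda>x::'a. u (norm x)) \<and> solves_radial_ode DIM('a) R p lam \<mu> u"

definition local_extremum :: "(real \<Rightarrow> real) \<Rightarrow> real \<Rightarrow> bool" where
  "local_extremum u c \<longleftrightarrow>
     (\<forall>\<^sub>F r in nhds c. u r \<le> u c) \<or> (\<forall>\<^sub>F r in nhds c. u c \<le> u r)"

text \<open>The number of zeros counts those in the open interval, whereas the endpoint \<open>R\<close> does
  count as a zero in the two monotonicity clauses.\<close>

definition nodal_profile :: "real \<Rightarrow> nat \<Rightarrow> (real \<Rightarrow> real) \<Rightarrow> bool" where
  "nodal_profile R m u \<longleftrightarrow>
     finite {r \<in> {0<..<R}. u r = 0} \<and> card {r \<in> {0<..<R}. u r = 0} = m \<and>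
     (\<exists>z\<in>{0<..R}. u z = 0 \<and> (\<forall>r\<in>{0..<z}. u r \<noteq> 0) \<and> strict_antimono_on {0..z} u) \<and>
     (\<forall>a\<in>{0..R}. \<forall>b\<in>{0..R}.
        a < b \<and> u a = 0 \<and> u b = 0 \<and> (\<forall>r\<in>{a<..<b}. u r \<noteq> 0) \<longrightarrow>
        (\<exists>!c. c \<in> {a<..<b} \<and> local_extremum u c))"

end

theory Submission
  imports Defs
begin

text \<open>
  The proof is a shooting argument. A radial solution is determined by its value \<open>d\<close> at the origin,
  and \<open>\<bar>u'\<bar> < 1\<close> confines \<open>d\<close> to the interval from \<open>0\<close> to \<open>R\<close>. Writing \<open>u = d * v\<close> with
  \<open>v 0 = 1\<close> turns the equation into a family that is continuous in \<open>d\<close> up to \<open>d = 0\<close>, where it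
  becomes the linear equation \<open>- \<Delta> v = lam * v\<close>. So a single continuity argument covers both small
  amplitudes and the comparison with the eigenvalues (\<open>radial_ivp_family\<close>,
  \<open>shooting_family_exists\<close>, \<open>limit_profile\<close>).

  An energy that decreases, but not faster than \<open>r ^ (- 2 * (N - 1))\<close>, shows that profiles
  stay bounded and have only simple zeros (\<open>v_bounded\<close>, \<open>zero_simple\<close>). Therefore the number of
  zeros in the open interval is lower semicontinuous in \<open>d\<close>, the number of zeros in the closed
  interval is upper semicontinuous, and the two differ by at most one. Wherever the first number drops
  below \<open>l\<close>, the profile must vanish at \<open>R\<close> and have exactly \<open>l - 1\<close> zeros inside (\<open>first_drop\<close>).

  It remains to count zeros at three amplitudes. At \<open>d = R\<close> there are none, because the slope is less
  than one. At \<open>d = 0\<close> the zeros correspond to the radial eigenvalues up to \<open>lam\<close>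
  (\<open>linear_zero_counts\<close>), hence there are at most \<open>k\<close>. And there is an intermediate amplitude with
  at least \<open>j\<close> zeros: a small one if \<open>lam\<close> exceeds the \<open>j\<close>-th eigenvalue, and otherwise
  \<open>R / (6 * j)\<close>, provided that \<open>\<mu>\<close> is large, since then the profile is almost a zigzag of slope
  \<open>\<plusminus>1\<close> (\<open>large_coefficient_zero_in_window\<close>). On the way from the
  intermediate amplitude to the right, the number of zeros has to drop below each of \<open>j, \<dots>, 1\<close>, which
  gives the large solutions; on the way to the left, it has to drop below each of \<open>j, \<dots>, k + 1\<close>,
  which gives the small ones (\<open>solution_ladder\<close>).
\<close>

section \<open>Radial initial value problems: existence and dependence on parameters\<close>

text \<open>The profile equation
  \<open>(r ^ (N - 1) * y)' = - (r ^ (N - 1) * f v)\<close>, \<open>v' = G y\<close>, expanded. The singular quotient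
  \<open>y / r\<close> is treated as the unknown \<open>Y\<close>, which extends continuously to the origin with the value
  \<open>- f 1 / N\<close>.\<close>

definition radial_ivp ::
  "nat \<Rightarrow> (real \<Rightarrow> real) \<Rightarrow> (real \<Rightarrow> real) \<Rightarrow> (real \<Rightarrow> real) \<Rightarrow> (real \<Rightarrow> real) \<Rightarrow> bool" where
  "radial_ivp N G f v Y \<longleftrightarrow>
     v 0 = 1 \<and> Y 0 = - f 1 / N \<and> continuous_on {0..} Y \<and>
     (\<forall>r\<ge>0. (v has_real_derivative G (r * Y r)) (at r within {0..})) \<and>
     (\<forall>r>0. (Y has_real_derivative - (f (v r) + N * Y r) / r) (at r))"

text \<open>The average that solves the equation for \<open>Y\<close> when \<open>v\<close> is given. The integral runs over
  the unit interval for every \<open>r\<close>, which makes continuity at \<open>r = 0\<close> and in parameters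
  a matter of continuity of the integrand.\<close>

definition mean_flux :: "nat \<Rightarrow> (real \<Rightarrow> real) \<Rightarrow> (real \<Rightarrow> real) \<Rightarrow> real \<Rightarrow> real" where
  "mean_flux N f v r = - integral {0..1} (\<lambda>t. t ^ (N - 1) * f (v (r * t)))"

definition picard_step ::
  "nat \<Rightarrow> (real \<Rightarrow> real) \<Rightarrow> (real \<Rightarrow> real) \<Rightarrow> (real \<Rightarrow> real) \<Rightarrow> real \<Rightarrow> real" where
  "picard_step N G f v r = 1 + r * integral {0..1} (\<lambda>s. G (r * s * mean_flux N f v (r * s)))"

lemma continuous_on_mean_flux:
  fixes f :: "'p::topological_space \<Rightarrow> real \<Rightarrow> real"
  assumes "continuous_on (P \<times> UNIV) (\<lambda>(d, s). f d s)"
    and "continuous_on (P \<times> {0..T}) (\<lambda>(d, r). v d r)"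
  shows "continuous_on (P \<times> {0..T}) (\<lambda>(d, r). mean_flux N (f d) (v d) r)"
proof -
  have 1: "continuous_on ((P \<times> {0..T}) \<times> {0..1}) (\<lambda>z. v (fst (fst z)) (snd (fst z) * snd z))"
  proof (rule continuous_on_compose2[OF assms(2), where f = "\<lambda>z. (fst (fst z), snd (fst z) * snd z)", simplified])
    show "continuous_on ((P \<times> {0..T}) \<times> {0..1}) (\<lambda>z. (fst (fst z), snd (fst z) * snd z))"
      by (intro continuous_intros)
    show "(\<lambda>z. (fst (fst z), snd (fst z) * snd z)) ` ((P \<times> {0..T}) \<times> {0..1}) \<subseteq> P \<times> {0..T}"
      by (auto intro: order_trans[OF mult_right_le_one_le])
  qed
  have 2: "continuous_on ((P \<times> {0..T}) \<times> {0..1}) (\<lambda>z. f (fst (fst z)) (v (fst (fst z)) (snd (fst z) * snd z)))"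
  proof (rule continuous_on_compose2[OF assms(1), where f = "\<lambda>z. (fst (fst z), v (fst (fst z)) (snd (fst z) * snd z))", simplified])
    show "continuous_on ((P \<times> {0..T}) \<times> {0..1}) (\<lambda>z. (fst (fst z), v (fst (fst z)) (snd (fst z) * snd z)))"
      by (intro continuous_intros 1)
  qed auto
  have "continuous_on ((P \<times> {0..T}) \<times> cbox 0 1) (\<lambda>(z, t). t ^ (N - 1) * f (fst z) (v (fst z) (snd z * t)))"
    unfolding case_prod_beta using 2 by (auto intro!: continuous_intros)
  from integral_continuous_on_param[OF this] show ?thesis
    unfolding mean_flux_def case_prod_beta by (auto intro: continuous_intros)
qed

lemma continuous_on_picard_step:
  fixes f G :: "'p::topological_space \<Rightarrow> real \<Rightarrow> real"
  assumes "continuous_on (P \<times> UNIV) (\<lambda>(d, s). f d s)"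
    and "continuous_on (P \<times> UNIV) (\<lambda>(d, s). G d s)"
    and "continuous_on (P \<times> {0..T}) (\<lambda>(d, r). v d r)"
  shows "continuous_on (P \<times> {0..T}) (\<lambda>(d, r). picard_step N (G d) (f d) (v d) r)"
proof -
  have 1: "continuous_on ((P \<times> {0..T}) \<times> {0..1}) (\<lambda>z. mean_flux N (f (fst (fst z))) (v (fst (fst z))) (snd (fst z) * snd z))"
  proof (rule continuous_on_compose2[OF continuous_on_mean_flux[OF assms(1,3)], where f = "\<lambda>z. (fst (fst z), snd (fst z) * snd z)", simplified])
    show "continuous_on ((P \<times> {0..T}) \<times> {0..1}) (\<lambda>z. (fst (fst z), snd (fst z) * snd z))"
      by (intro continuous_intros)
    show "(\<lambda>z. (fst (fst z), snd (fst z) * snd z)) ` ((P \<times> {0..T}) \<times> {0..1}) \<subseteq> P \<times> {0..T}"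
      by (auto intro: order_trans[OF mult_right_le_one_le])
  qed
  have 2: "continuous_on ((P \<times> {0..T}) \<times> {0..1}) (\<lambda>z. G (fst (fst z)) (snd (fst z) * snd z * mean_flux N (f (fst (fst z))) (v (fst (fst z))) (snd (fst z) * snd z)))"
    by (rule continuous_on_compose2[OF assms(2), where f = "\<lambda>z. (fst (fst z), snd (fst z) * snd z * mean_flux N (f (fst (fst z))) (v (fst (fst z))) (snd (fst z) * snd z))", simplified])
       (auto intro!: continuous_intros 1)
  have "continuous_on ((P \<times> {0..T}) \<times> cbox 0 1) (\<lambda>(z, t). G (fst z) (snd z * t * mean_flux N (f (fst z)) (v (fst z)) (snd z * t)))"
    unfolding case_prod_beta using 2 by simp
  from integral_continuous_on_param[OF this] show ?thesis
    unfolding picard_step_def case_prod_beta by (auto intro!: continuous_intros)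
qed

lemma continuous_on_mean_flux1:
  assumes "continuous_on UNIV f" and "continuous_on {0..T} v"
  shows "continuous_on {0..T} (mean_flux N f v)"
proof -
  have a: "continuous_on ({0::real} \<times> UNIV) (\<lambda>(d, s). f s)"
    using assms(1) unfolding case_prod_beta
    by (auto intro!: continuous_on_compose2[of UNIV f _ snd] continuous_intros)
  have b: "continuous_on ({0::real} \<times> {0..T}) (\<lambda>(d, s). v s)"
    using assms(2) unfolding case_prod_beta
    by (auto intro!: continuous_on_compose2[of "{0..T}" v _ snd] continuous_intros)
  have "continuous_on ({0::real} \<times> {0..T}) (\<lambda>(d, r). mean_flux N f v r)"
    by (rule continuous_on_mean_flux[OF a b])
  then have "continuous_on {0..T} ((\<lambda>(d::real, r). mean_flux N f v r) \<circ> (\<lambda>r. (0::real, r)))"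
    by (intro continuous_on_compose) (auto intro!: continuous_intros elim: continuous_on_subset)
  then show ?thesis by (simp add: o_def)
qed

lemma mean_flux_diff_le:
  assumes f: "continuous_on UNIV f" "\<And>x y. \<bar>f x - f y\<bar> \<le> L * \<bar>x - y\<bar>" and L: "L \<ge> 0"
    and "continuous_on {0..T} v" "continuous_on {0..T} w" and r: "0 \<le> r" "r \<le> T"
    and B: "\<And>t. 0 \<le> t \<Longrightarrow> t \<le> r \<Longrightarrow> \<bar>v t - w t\<bar> \<le> B"
  shows "\<bar>mean_flux N f v r - mean_flux N f w r\<bar> \<le> L * B"
proof -
  let ?D = "\<lambda>t. t ^ (N - 1) * f (v (r * t)) - t ^ (N - 1) * f (w (r * t))"
  have B0: "B \<ge> 0" using B[of 0] r by auto
  have c: "continuous_on {0..1} (\<lambda>t. t ^ (N - 1) * f (u (r * t)))" if "continuous_on {0..T} u" for u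
  proof -
    have 1: "continuous_on {0..1} (\<lambda>t. u (r * t))"
      by (rule continuous_on_compose2[OF that]) (use r in \<open>auto intro!: continuous_intros intro: order_trans[OF mult_left_le_one_le] order_trans[OF mult_right_le_one_le]\<close>)
    have "continuous_on {0..1} (\<lambda>t. f (u (r * t)))"
      by (rule continuous_on_compose2[OF f(1) 1]) auto
    then show ?thesis by (intro continuous_intros)
  qed
  note cv = c[OF assms(4)] and cw = c[OF assms(5)]
  have "mean_flux N f v r - mean_flux N f w r = - integral {0..1} ?D"
    unfolding mean_flux_def
    by (simp only: Henstock_Kurzweil_Integration.integral_diff
          [OF integrable_continuous_real[OF cv] integrable_continuous_real[OF cw]])
  moreover have "norm (integral {0..1} ?D) \<le> (L * B) * (1 - 0)"
  proof (rule integral_bound)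
    fix t :: real assume t: "t \<in> {0..1}"
    have "\<bar>f (v (r * t)) - f (w (r * t))\<bar> \<le> L * \<bar>v (r * t) - w (r * t)\<bar>" by (rule f)
    also have "\<dots> \<le> L * B" using t r L by (intro mult_left_mono B) (auto intro: mult_right_le_one_le)
    finally have "\<bar>f (v (r * t)) - f (w (r * t))\<bar> \<le> L * B" .
    moreover have "\<bar>t ^ (N - 1)\<bar> \<le> 1" using t by (simp add: power_le_one)
    ultimately have "\<bar>t ^ (N - 1)\<bar> * \<bar>f (v (r * t)) - f (w (r * t))\<bar> \<le> 1 * (L * B)"
      by (intro mult_mono) auto
    then show "norm (t ^ (N - 1) * f (v (r * t)) - t ^ (N - 1) * f (w (r * t))) \<le> L * B"
      by (simp add: right_diff_distrib[symmetric] abs_mult)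
  next
    show "continuous_on {0..1} ?D"
      by (rule continuous_on_diff[OF cv cw])
  qed auto
  ultimately show ?thesis by simp
qed

text \<open>One power of the radius comes from the outer integral and one from the factor \<open>r * s\<close> in
  the argument of \<open>G\<close>. Iteration from a constant therefore gives differences of size
  \<open>(L * r\<^sup>2 / 2) ^ n / fact n\<close>.\<close>

lemma picard_step_diff_le:
  assumes f: "continuous_on UNIV f" "\<And>x y. \<bar>f x - f y\<bar> \<le> L * \<bar>x - y\<bar>" and L: "L \<ge> 0"
    and G: "continuous_on UNIV G" "\<And>x y. \<bar>G x - G y\<bar> \<le> \<bar>x - y\<bar>"
    and v: "continuous_on {0..T} v" and w: "continuous_on {0..T} w" and r: "0 \<le> r" "r \<le> T"
    and B: "\<And>t. 0 \<le> t \<Longrightarrow> t \<le> r \<Longrightarrow> \<bar>v t - w t\<bar> \<le> B * t ^ k" and B0: "B \<ge> 0"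
  shows "\<bar>picard_step N G f v r - picard_step N G f w r\<bar> \<le> B * L / (k + 2) * r ^ (k + 2)"
proof -
  let ?D = "\<lambda>s. G (r * s * mean_flux N f v (r * s)) - G (r * s * mean_flux N f w (r * s))"
  have c: "continuous_on {0..1} (\<lambda>s. G (r * s * mean_flux N f u (r * s)))" if "continuous_on {0..T} u" for u
  proof -
    have "continuous_on {0..1} (\<lambda>s. mean_flux N f u (r * s))"
      by (rule continuous_on_compose2[OF continuous_on_mean_flux1[OF f(1) that]])
         (use r in \<open>auto intro!: continuous_intros intro: order_trans[OF mult_left_le_one_le] order_trans[OF mult_right_le_one_le]\<close>)
    then show ?thesis by (intro continuous_on_compose2[OF G(1)]) (auto intro!: continuous_intros)
  qed
  note cv = c[OF v] and cw = c[OF w]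
  have "((\<lambda>s. s ^ (k + 1)) has_integral (1 ^ (k + 2) / (k + 2) - 0 ^ (k + 2) / (k + 2))) {0..1::real}"
  proof (rule fundamental_theorem_of_calculus)
    fix x :: real
    show "((\<lambda>a. a ^ (k + 2) / real (k + 2)) has_vector_derivative x ^ (k + 1)) (at x within {0..1})"
      unfolding has_real_derivative_iff_has_vector_derivative[symmetric]
      using DERIV_cdivide[OF DERIV_pow[of "k + 2" x "{0..1}"], of "real (k + 2)"] by (simp add: add_ac)
  qed auto
  from has_integral_mult_right[OF this, of "L * B * r ^ (k + 1)"]
  have I: "((\<lambda>s. L * B * r ^ (k + 1) * s ^ (k + 1)) has_integral (L * B * r ^ (k + 1) / (k + 2))) {0..1::real}"
    by simp
  have "picard_step N G f v r - picard_step N G f w r =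
     r * integral {0..1} ?D"
    unfolding picard_step_def
    by (simp only: Henstock_Kurzweil_Integration.integral_diff
          [OF integrable_continuous_real[OF cv] integrable_continuous_real[OF cw]])
       (simp add: algebra_simps)
  moreover have "norm (integral {0..1} ?D)
      \<le> integral {0..1} (\<lambda>s. L * B * r ^ (k + 1) * s ^ (k + 1))"
  proof (rule integral_norm_bound_integral)
    show "?D integrable_on {0..1}"
      by (rule integrable_continuous_real[OF continuous_on_diff[OF cv cw]])
    show "(\<lambda>s. L * B * r ^ (k + 1) * s ^ (k + 1)) integrable_on {0..1}" using I by blast
    fix s :: real assume s: "s \<in> {0..1}"
    have rs: "0 \<le> r * s" "r * s \<le> T" "r * s \<le> r"
      using s r by (auto intro: order_trans[OF mult_right_le_one_le] mult_right_le_one_le)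
    have "\<bar>mean_flux N f v (r * s) - mean_flux N f w (r * s)\<bar> \<le> L * (B * (r * s) ^ k)"
    proof (rule mean_flux_diff_le[OF f L v w rs(1,2)])
      fix t assume t: "0 \<le> t" "t \<le> r * s"
      have "\<bar>v t - w t\<bar> \<le> B * t ^ k" using t rs by (intro B) auto
      also have "\<dots> \<le> B * (r * s) ^ k" using t B0 by (intro mult_left_mono power_mono) auto
      finally show "\<bar>v t - w t\<bar> \<le> B * (r * s) ^ k" .
    qed
    then have m: "(r * s) * \<bar>mean_flux N f v (r * s) - mean_flux N f w (r * s)\<bar> \<le> (r * s) * (L * (B * (r * s) ^ k))"
      using rs by (intro mult_left_mono)
    have "\<bar>G (r * s * mean_flux N f v (r * s)) - G (r * s * mean_flux N f w (r * s))\<bar>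
      \<le> \<bar>r * s * mean_flux N f v (r * s) - r * s * mean_flux N f w (r * s)\<bar>" by (rule G)
    also have "\<dots> = (r * s) * \<bar>mean_flux N f v (r * s) - mean_flux N f w (r * s)\<bar>"
      using rs s r by (simp add: right_diff_distrib[symmetric] abs_mult)
    also note m
    also have "(r * s) * (L * (B * (r * s) ^ k)) = L * B * r ^ (k + 1) * s ^ (k + 1)"
      by (simp add: power_mult_distrib)
    finally show "norm (G (r * s * mean_flux N f v (r * s)) - G (r * s * mean_flux N f w (r * s)))
       \<le> L * B * r ^ (k + 1) * s ^ (k + 1)" by simp
  qed
  then have "\<bar>integral {0..1} ?D\<bar>
      \<le> L * B * r ^ (k + 1) / (k + 2)"
    unfolding integral_unique[OF I] real_norm_def .
  ultimately have "\<bar>picard_step N G f v r - picard_step N G f w r\<bar> \<le> r * (L * B * r ^ (k + 1) / (k + 2))"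
    using mult_left_mono[OF _ r(1)] r by (simp only: abs_mult abs_of_nonneg)
  also have "\<dots> = B * L / (k + 2) * r ^ (k + 2)" by simp
  finally show ?thesis .
qed

lemma continuous_on_halfline:
  fixes g :: "real \<Rightarrow> 'b::topological_space"
  assumes "\<And>T. continuous_on {0..T} g"
  shows "continuous_on {0..} g"
  unfolding continuous_on_eq_continuous_within
proof
  fix r :: real assume r: "r \<in> {0..}"
  have "at r within {0..r + 1} = at r within {0..}"
    by (rule at_within_nhd[of r "{..<r + 1}"]) auto
  moreover have "continuous (at r within {0..r + 1}) g"
    using assms[of "r + 1"] r by (auto simp: continuous_on_eq_continuous_within)
  ultimately show "continuous (at r within {0..}) g" by simp
qed

lemma integral_unit_rescale:
  fixes g :: "real \<Rightarrow> real"
  assumes "continuous_on {0..r} g" "0 \<le> r"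
  shows "r * integral {0..1} (\<lambda>t. g (r * t)) = integral {0..r} g"
proof (cases "r = 0")
  case False
  then have r: "r > 0" using assms by simp
  have "(g has_integral integral {0..r} g) {0..r}"
    using assms(1) by (intro integrable_integral integrable_continuous_real)
  from has_integral_stretch_real[OF this, of r] r
  have "((\<lambda>x. g (r * x)) has_integral (1 / r) * integral {0..r} g) ((\<lambda>x. x / r) ` {0..r})" by simp
  moreover have "(\<lambda>x. x / r) ` {0..r} = {0..1}" using r by simp
  ultimately have "integral {0..1} (\<lambda>t. g (r * t)) = (1 / r) * integral {0..r} g"
    by (simp add: integral_unique)
  then show ?thesis using r by simp
qed simp

text \<open>Rescaling both integrals to the interval from \<open>0\<close> to \<open>r\<close> makes the fundamental theorem of
  calculus applicable.\<close>

lemma radial_ivp_of_fixpoint: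
  assumes N: "N \<ge> 1" and f: "continuous_on UNIV f" and G: "continuous_on UNIV G"
    and v: "\<And>T. continuous_on {0..T} v"
    and fixp: "\<And>r. r \<ge> 0 \<Longrightarrow> v r = picard_step N G f v r"
  shows "radial_ivp N G f v (mean_flux N f v)"
proof -
  define Y where "Y = mean_flux N f v"
  have Ycont: "continuous_on {0..T} Y" for T
    unfolding Y_def by (rule continuous_on_mean_flux1[OF f v])
  have v0: "v 0 = 1" using fixp[of 0] by (simp add: picard_step_def)
  have "((\<lambda>s. s ^ (N - 1)) has_integral (1 ^ N / N - 0 ^ N / N)) {0..1::real}"
  proof (rule fundamental_theorem_of_calculus)
    fix x :: real
    show "((\<lambda>a. a ^ N / real N) has_vector_derivative x ^ (N - 1)) (at x within {0..1})"
      unfolding has_real_derivative_iff_has_vector_derivative[symmetric]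
      using DERIV_cdivide[OF DERIV_pow[of N x "{0..1}"], of "real N"] N by simp
  qed auto
  then have I: "((\<lambda>s. s ^ (N - 1)) has_integral (1 / N)) {0..1::real}"
    using N by (simp add: zero_power)
  have Y0: "Y 0 = - f 1 / N"
    using integral_unique[OF has_integral_mult_left[OF I, of "f 1"]] v0
    unfolding Y_def mean_flux_def by simp
  have fluxc: "continuous_on {0..T} (\<lambda>t. t ^ (N - 1) * f (v t))" for T
    by (intro continuous_intros continuous_on_compose2[OF f v]) auto
  have flux: "r ^ N * Y r = - integral {0..r} (\<lambda>t. t ^ (N - 1) * f (v t))" if "r \<ge> 0" for r
  proof -
    have "r * integral {0..1} (\<lambda>t. (r * t) ^ (N - 1) * f (v (r * t))) = integral {0..r} (\<lambda>t. t ^ (N - 1) * f (v t))"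
      by (rule integral_unit_rescale[OF fluxc that])
    also have "(\<lambda>t. (r * t) ^ (N - 1) * f (v (r * t))) = (\<lambda>t. r ^ (N - 1) * (t ^ (N - 1) * f (v (r * t))))"
      by (simp add: power_mult_distrib mult.assoc)
    also have "r * integral {0..1} (\<lambda>t. r ^ (N - 1) * (t ^ (N - 1) * f (v (r * t)))) = - (r ^ N * Y r)"
      using N by (simp add: Y_def mean_flux_def power_eq_if[of r N])
    finally show ?thesis by simp
  qed
  have slopec: "continuous_on {0..T} (\<lambda>s. G (s * Y s))" for T
    by (intro continuous_on_compose2[OF G] continuous_intros Ycont) auto
  have vint: "v r = 1 + integral {0..r} (\<lambda>s. G (s * Y s))" if "r \<ge> 0" for r
    using fixp[OF that] integral_unit_rescale[OF slopec that]
    by (simp add: picard_step_def Y_def)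
  have ev: "at r within {0..r + 1} = at r within {0..}" for r :: real
    by (rule at_within_nhd[of r "{..<r + 1}"]) auto
  have dv: "(v has_real_derivative G (r * Y r)) (at r within {0..})" if "r \<ge> 0" for r
  proof -
    have "((\<lambda>r. 1 + integral {0..r} (\<lambda>s. G (s * Y s))) has_real_derivative G (r * Y r)) (at r within {0..r + 1})"
      using that by (auto intro!: derivative_eq_intros integral_has_real_derivative slopec)
    then have "((\<lambda>r. 1 + integral {0..r} (\<lambda>s. G (s * Y s))) has_real_derivative G (r * Y r)) (at r within {0..})"
      by (simp only: ev)
    then show ?thesis
      by (rule has_field_derivative_transform_within[where d = 1]) (use that vint in auto)
  qed
  have dY: "(Y has_real_derivative - (f (v r) + N * Y r) / r) (at r)" if "r > 0" for r
  proof -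
    have "((\<lambda>r. - integral {0..r} (\<lambda>t. t ^ (N - 1) * f (v t))) has_real_derivative - (r ^ (N - 1) * f (v r))) (at r within {0..r + 1})"
      using that by (intro DERIV_minus integral_has_real_derivative fluxc) auto
    moreover have "at r within {0..r + 1} = at r"
      by (rule at_within_interior) (use that in auto)
    ultimately have d: "((\<lambda>r. - integral {0..r} (\<lambda>t. t ^ (N - 1) * f (v t))) has_real_derivative - (r ^ (N - 1) * f (v r))) (at r)"
      by simp
    have q: "- integral {0..r} (\<lambda>t. t ^ (N - 1) * f (v t)) = r ^ N * Y r" using flux[of r] that by simp
    have "((\<lambda>r. (- integral {0..r} (\<lambda>t. t ^ (N - 1) * f (v t))) / r ^ N) has_real_derivative
        (- (r ^ (N - 1) * f (v r)) * r ^ N - r ^ N * Y r * (real N * r ^ (N - 1))) / (r ^ N * r ^ N)) (at r)"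
      unfolding q[symmetric] using DERIV_divide[OF d DERIV_pow[of N r UNIV]] that by simp
    moreover have "(- (r ^ (N - 1) * f (v r)) * r ^ N - r ^ N * Y r * (real N * r ^ (N - 1))) / (r ^ N * r ^ N)
       = - (f (v r) + N * Y r) / r"
      using that N by (simp add: field_simps power_eq_if[of r N])
    ultimately have "((\<lambda>r. (- integral {0..r} (\<lambda>t. t ^ (N - 1) * f (v t))) / r ^ N) has_real_derivative
        - (f (v r) + N * Y r) / r) (at r)" by simp
    then show ?thesis
    proof (rule has_field_derivative_transform_within_open[where S = "{0<..}"])
      fix x :: real assume "x \<in> {0<..}"
      then show "(- integral {0..x} (\<lambda>t. t ^ (N - 1) * f (v t))) / x ^ N = Y x"
        using flux[of x] by (simp add: field_simps)
    qed (use that in auto)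
  qed
  show ?thesis unfolding radial_ivp_def Y_def[symmetric]
    using v0 Y0 dv dY continuous_on_halfline[OF Ycont] by auto
qed

text \<open>The Picard iterates are jointly continuous in the parameter and the radius and converge
  uniformly, being dominated by an exponential series. So the limit exists globally and depends
  continuously on the parameter at the same time.\<close>

theorem radial_ivp_family:
  fixes f G :: "'p::topological_space \<Rightarrow> real \<Rightarrow> real"
  assumes N: "N \<ge> 1" and L: "L \<ge> 0"
    and cf: "continuous_on (P \<times> UNIV) (\<lambda>(d, s). f d s)"
    and cG: "continuous_on (P \<times> UNIV) (\<lambda>(d, s). G d s)"
    and Lf: "\<And>d x y. d \<in> P \<Longrightarrow> \<bar>f d x - f d y\<bar> \<le> L * \<bar>x - y\<bar>" and f0: "\<And>d. d \<in> P \<Longrightarrow> f d 0 = 0"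
    and LG: "\<And>d x y. d \<in> P \<Longrightarrow> \<bar>G d x - G d y\<bar> \<le> \<bar>x - y\<bar>" and G0: "\<And>d. d \<in> P \<Longrightarrow> G d 0 = 0"
  obtains v Y where "\<And>T. continuous_on (P \<times> {0..T}) (\<lambda>(d, r). v d r)"
    and "\<And>T. continuous_on (P \<times> {0..T}) (\<lambda>(d, r). Y d r)"
    and "\<And>d. d \<in> P \<Longrightarrow> radial_ivp N (G d) (f d) (v d) (Y d)"
proof -
  define u where "u n d = (picard_step N (G d) (f d) ^^ n) (\<lambda>_. 1)" for n d
  have u0: "u 0 d = (\<lambda>_. 1)" and uS: "u (Suc n) d = picard_step N (G d) (f d) (u n d)" for n d
    by (simp_all add: u_def)
  have ucont: "continuous_on (P \<times> {0..T}) (\<lambda>(d, r). u n d r)" for n T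
  proof (induction n)
    case (Suc n) then show ?case unfolding uS by (rule continuous_on_picard_step[OF cf cG])
  qed (simp add: u0 case_prod_beta)
  have slice: "continuous_on A (g d)" if "continuous_on (P \<times> A) (\<lambda>(d, r). g d r)" "d \<in> P" for A :: "real set" and g :: "'p \<Rightarrow> real \<Rightarrow> real" and d
    using continuous_on_compose2[OF that(1), of A "\<lambda>r. (d, r)"] that(2)
    by (simp add: continuous_on_Pair image_subset_iff)
  note ucont1 = slice[OF ucont]
  have f1: "continuous_on UNIV (f d)" and G1: "continuous_on UNIV (G d)" if "d \<in> P" for d
    using slice[OF cf that] slice[OF cG that] .
  have step: "\<bar>u (Suc n) d r - u n d r\<bar> \<le> (L / 2) ^ Suc n / fact (Suc n) * r ^ (2 * Suc n)"
    if d: "d \<in> P" and "0 \<le> r" for n d r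
    using \<open>0 \<le> r\<close>
  proof (induction n arbitrary: r)
    case 0
    \<comment> \<open>The starting function is the Picard step of the zero function, so \<open>picard_step_diff_le\<close> applies.\<close>
    have z: "picard_step N (G d) (f d) (\<lambda>_. 0) r = 1"
      using G0[OF d] f0[OF d] by (simp add: picard_step_def mean_flux_def)
    have "\<bar>picard_step N (G d) (f d) (\<lambda>_. 1) r - picard_step N (G d) (f d) (\<lambda>_. 0) r\<bar> \<le> 1 * L / (0 + 2) * r ^ (0 + 2)"
      using picard_step_diff_le[OF f1[OF d] Lf[OF d] L G1[OF d] LG[OF d],
          of r "\<lambda>_. 1" "\<lambda>_. 0" r 1 0 N] 0 by simp
    then show ?case by (simp add: uS u0 z power2_eq_square)
  next
    case (Suc n)
    let ?B = "(L / 2) ^ Suc n / fact (Suc n)"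
    have "\<bar>u (Suc (Suc n)) d r - u (Suc n) d r\<bar> \<le> ?B * L / (real (2 * Suc n) + 2) * r ^ (2 * Suc n + 2)"
      unfolding uS[of "Suc n"] uS[of n d]
      unfolding uS[of n d, symmetric]
      using picard_step_diff_le[OF f1[OF d] Lf[OF d] L G1[OF d] LG[OF d] ucont1[OF d] ucont1[OF d] Suc.prems order_refl,
          of "Suc n" n ?B "2 * Suc n" N] Suc.IH L uS[of n d] by simp
    also have "?B * L / (real (2 * Suc n) + 2) = (L / 2) ^ Suc (Suc n) / fact (Suc (Suc n))"
      by (simp add: field_simps)
    finally show ?case by simp
  qed
  define D where "D n x = u (Suc n) (fst x) (snd x) - u n (fst x) (snd x)" for n x
  define V where "V d r = 1 + (\<Sum>n. D n (d, r))" for d r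
  have tele: "1 + (\<Sum>i<n. D i x) = u n (fst x) (snd x)" for n x
    using sum_lessThan_telescope[of "\<lambda>i. u i (fst x) (snd x)" n] by (simp add: D_def u0)
  have lim: "uniform_limit (P \<times> {0..T}) (\<lambda>n (d, r). u n d r) (\<lambda>(d, r). V d r) sequentially" for T
  proof (cases "T \<ge> 0")
    case True
    have "uniform_limit (P \<times> {0..T}) (\<lambda>n x. \<Sum>i<n. D i x) (\<lambda>x. \<Sum>i. D i x) sequentially"
    proof (rule Weierstrass_m_test)
      fix n x assume "x \<in> P \<times> {0..T}"
      then have x: "fst x \<in> P" "0 \<le> snd x" "snd x \<le> T" by auto
      have "norm (D n x) \<le> (L / 2) ^ Suc n / fact (Suc n) * snd x ^ (2 * Suc n)"
        using step[OF x(1,2)] unfolding D_def by simp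
      also have "\<dots> \<le> (L / 2) ^ Suc n / fact (Suc n) * T ^ (2 * Suc n)"
        using x L by (intro mult_left_mono power_mono) auto
      also have "\<dots> = (L / 2 * T\<^sup>2) ^ Suc n /\<^sub>R fact (Suc n)"
        unfolding power_mult_distrib power_mult[symmetric] by (simp add: field_simps)
      finally show "norm (D n x) \<le> (L / 2 * T\<^sup>2) ^ Suc n /\<^sub>R fact (Suc n)" .
    next
      show "summable (\<lambda>n. (L / 2 * T\<^sup>2) ^ Suc n /\<^sub>R fact (Suc n))"
        using summable_exp_generic[of "L / 2 * T\<^sup>2"] by (subst summable_Suc_iff)
    qed
    from uniform_limit_add[OF uniform_limit_const[where c = "\<lambda>_. 1::real"] this]
    have "uniform_limit (P \<times> {0..T}) (\<lambda>n x. 1 + (\<Sum>i<n. D i x)) (\<lambda>x. 1 + (\<Sum>i. D i x)) sequentially" .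
    then show ?thesis unfolding tele by (simp add: V_def case_prod_unfold)
  qed simp
  have Vcont: "continuous_on (P \<times> {0..T}) (\<lambda>(d, r). V d r)" for T
    by (rule uniform_limit_theorem[OF _ lim]) (auto intro!: always_eventually ucont)
  have fixp: "V d r = picard_step N (G d) (f d) (V d) r" if d: "d \<in> P" and r: "r \<ge> 0" for d r
  proof -
    have "(\<lambda>n. u (Suc n) d r) \<longlonglongrightarrow> picard_step N (G d) (f d) (V d) r"
    proof (rule LIMSEQ_I)
      fix e :: real assume e: "e > 0"
      define h where "h = e / (L * r\<^sup>2 / 2 + 1)"
      have pos: "L * r\<^sup>2 / 2 + 1 > 0" using L by (simp add: add_nonneg_pos)
      then have h: "h > 0" using e by (simp add: h_def)
      have "\<forall>\<^sub>F n in sequentially. \<forall>x\<in>P \<times> {0..r}. dist (case x of (d, r) \<Rightarrow> u n d r) (case x of (d, r) \<Rightarrow> V d r) < h"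
        using lim[of r] h by (auto simp: uniform_limit_iff)
      then obtain n0 where n0: "\<And>n x. n \<ge> n0 \<Longrightarrow> x \<in> P \<times> {0..r} \<Longrightarrow> dist (case x of (d, r) \<Rightarrow> u n d r) (case x of (d, r) \<Rightarrow> V d r) < h"
        unfolding eventually_sequentially by blast
      have "norm (u (Suc n) d r - picard_step N (G d) (f d) (V d) r) < e" if "n \<ge> n0" for n
      proof -
        have B: "\<bar>u n d t - V d t\<bar> \<le> h * t ^ 0" if "0 \<le> t" "t \<le> r" for t
          using n0[OF \<open>n \<ge> n0\<close>, of "(d, t)"] d that by (auto simp: dist_real_def)
        have "\<bar>picard_step N (G d) (f d) (u n d) r - picard_step N (G d) (f d) (V d) r\<bar> \<le> h * L / 2 * r\<^sup>2"
          using picard_step_diff_le[OF f1[OF d] Lf[OF d] L G1[OF d] LG[OF d] ucont1[OF d] slice[OF Vcont d]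
              r order_refl B, of N] h by (simp add: power2_eq_square)
        also have "\<dots> < h * (L * r\<^sup>2 / 2 + 1)" using h by (simp add: field_simps power2_eq_square)
        also have "\<dots> = e" using pos by (simp add: h_def)
        finally show ?thesis by (simp add: uS)
      qed
      then show "\<exists>n0. \<forall>n\<ge>n0. norm (u (Suc n) d r - picard_step N (G d) (f d) (V d) r) < e" by blast
    qed
    moreover have "(\<lambda>n. u (Suc n) d r) \<longlonglongrightarrow> V d r"
      using tendsto_uniform_limitI[OF lim[of r], of "(d, r)"] d r by (intro LIMSEQ_Suc) simp
    ultimately show ?thesis by (metis LIMSEQ_unique)
  qed
  show ?thesis
  proof (rule that)
    show "continuous_on (P \<times> {0..T}) (\<lambda>(d, r). V d r)" for T by (rule Vcont)
    show "continuous_on (P \<times> {0..T}) (\<lambda>(d, r). mean_flux N (f d) (V d) r)" for T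
      by (rule continuous_on_mean_flux[OF cf Vcont])
    show "radial_ivp N (G d) (f d) (V d) (mean_flux N (f d) (V d))" if d: "d \<in> P" for d
      by (rule radial_ivp_of_fixpoint[OF N f1[OF d] G1[OF d] slice[OF Vcont d] fixp[OF d]])
  qed
qed

section \<open>The relativistic slope and its kinetic energy\<close>

text \<open>The inverse of \<open>s \<mapsto> s / sqrt (1 - s\<^sup>2)\<close>, conjugated with multiplication by the
  amplitude \<open>d\<close>. At \<open>d = 0\<close> it is the identity, so the linear problem belongs to the family.\<close>

definition slope :: "real \<Rightarrow> real \<Rightarrow> real" where
  "slope d y = y / sqrt (1 + (d * y)\<^sup>2)"

text \<open>The antiderivative of \<open>slope d\<close> that vanishes at \<open>0\<close>. It equals
  \<open>(sqrt (1 + (d * y)\<^sup>2) - 1) / d\<^sup>2\<close> for \<open>d \<noteq> 0\<close>; the present form is also meaningful at \<open>d = 0\<close>.\<close>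

definition kinetic :: "real \<Rightarrow> real \<Rightarrow> real" where
  "kinetic d y = y\<^sup>2 / (1 + sqrt (1 + (d * y)\<^sup>2))"

lemma sqrt_ge_one: "1 \<le> sqrt (1 + (x::real)\<^sup>2)"
  by simp

lemma one_plus_sq_pos [simp]: "1 + (x::real)\<^sup>2 > 0" "1 + x\<^sup>2 \<noteq> 0" "\<not> 1 + x\<^sup>2 < 0"
  using zero_le_power2[of x] by linarith+

lemma sqrt_pos: "0 < sqrt (1 + (x::real)\<^sup>2)" "sqrt (1 + x\<^sup>2) \<noteq> 0" "1 + sqrt (1 + x\<^sup>2) \<noteq> 0"
  using sqrt_ge_one[of x] by (linarith+)

lemma DERIV_sqrt_relativistic:
  "((\<lambda>y. sqrt (1 + (d * y)\<^sup>2)) has_real_derivative d\<^sup>2 * y / sqrt (1 + (d * y)\<^sup>2)) (at (y::real))"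
proof -
  have "((\<lambda>y. 1 + (d * y)\<^sup>2) has_real_derivative 2 * (d * y) * d) (at y)"
    by (auto intro!: derivative_eq_intros)
  from DERIV_chain2[OF DERIV_real_sqrt[OF one_plus_sq_pos(1)] this]
  show ?thesis by (simp add: field_simps power2_eq_square)
qed

lemma DERIV_kinetic: "(kinetic d has_real_derivative slope d y) (at y)"
proof -
  define s where "s = sqrt (1 + (d * y)\<^sup>2)"
  have s: "s > 0" "s\<^sup>2 = 1 + d\<^sup>2 * y\<^sup>2" using sqrt_pos[of "d * y"] by (auto simp: s_def power_mult_distrib)
  have "((\<lambda>y. y\<^sup>2 / (1 + sqrt (1 + (d * y)\<^sup>2))) has_real_derivative
      (2 * y * (1 + s) - y\<^sup>2 * (d\<^sup>2 * y / s)) / ((1 + s) * (1 + s))) (at y)"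
    unfolding s_def
    using DERIV_divide[OF DERIV_pow[of 2 y UNIV] DERIV_add[OF DERIV_const DERIV_sqrt_relativistic] sqrt_pos(3)]
    by simp
  moreover have "(2 * y * (1 + s) - y\<^sup>2 * (d\<^sup>2 * y / s)) / ((1 + s) * (1 + s)) = slope d y"
  proof -
    have "y\<^sup>2 * (d\<^sup>2 * y / s) = y * (s\<^sup>2 - 1) / s" unfolding s(2) by (simp add: algebra_simps)
    then have "2 * y * (1 + s) - y\<^sup>2 * (d\<^sup>2 * y / s) = y / s * ((1 + s) * (1 + s))"
      using s(1) by (simp add: field_simps power2_eq_square)
    then show ?thesis using s(1) by (simp add: slope_def s_def[symmetric])
  qed
  ultimately show ?thesis unfolding kinetic_def[abs_def] by simp
qed

lemma DERIV_slope: "(slope d has_real_derivative 1 / sqrt (1 + (d * y)\<^sup>2) ^ 3) (at y)"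
proof -
  define s where "s = sqrt (1 + (d * y)\<^sup>2)"
  have s: "s > 0" "s\<^sup>2 = 1 + d\<^sup>2 * y\<^sup>2" using sqrt_pos[of "d * y"] by (auto simp: s_def power_mult_distrib)
  have "((\<lambda>y. y / sqrt (1 + (d * y)\<^sup>2)) has_real_derivative (1 * s - y * (d\<^sup>2 * y / s)) / (s * s)) (at y)"
    unfolding s_def
    using DERIV_divide[OF DERIV_ident[where F = "at y"] DERIV_sqrt_relativistic sqrt_pos(2)] by simp
  moreover have "(1 * s - y * (d\<^sup>2 * y / s)) / (s * s) = (s\<^sup>2 - d\<^sup>2 * y\<^sup>2) / s ^ 3"
    using s(1) by (simp add: field_simps power2_eq_square power3_eq_cube)
  ultimately show ?thesis using s(2) unfolding slope_def[abs_def] s_def by simp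
qed

lemma slope_diff_le: "\<bar>slope d x - slope d y\<bar> \<le> \<bar>x - y\<bar>"
proof -
  have "norm (slope d x - slope d y) \<le> 1 * norm (x - y)"
  proof (rule field_differentiable_bound[of UNIV])
    fix z show "(slope d has_field_derivative 1 / sqrt (1 + (d * z)\<^sup>2) ^ 3) (at z within UNIV)"
      using DERIV_slope by simp
    have "1 \<le> sqrt (1 + (d * z)\<^sup>2) ^ 3" using sqrt_ge_one[of "d * z"] by (rule one_le_power)
    then show "norm (1 / sqrt (1 + (d * z)\<^sup>2) ^ 3) \<le> 1" by (simp add: divide_le_eq)
  qed auto
  then show ?thesis by simp
qed

lemma continuous_slope: "continuous_on A (\<lambda>(d, y). slope d y)"
  unfolding slope_def case_prod_beta
  by (intro continuous_intros) (simp add: sqrt_pos)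

lemma slope_0 [simp]: "slope d 0 = 0" "slope 0 y = y"
  by (simp_all add: slope_def)

lemma slope_pos_iff [simp]: "slope d y > 0 \<longleftrightarrow> y > 0" "slope d y < 0 \<longleftrightarrow> y < 0" "slope d y = 0 \<longleftrightarrow> y = 0"
  using sqrt_pos[of "d * y"] by (simp_all add: slope_def zero_less_divide_iff divide_less_0_iff)

lemma slope_minus: "slope d (- y) = - slope d y"
  by (simp add: slope_def)

lemma mult_slope_nonneg: "y * slope d y \<ge> 0"
  using sqrt_pos[of "d * y"] by (simp add: slope_def)

text \<open>Up to the factor \<open>(N - 1) / r\<close> the left-hand side is the rate of dissipation, which is thereby
  controlled by the energy.\<close>

lemma mult_slope_le_kinetic: "y * slope d y \<le> 2 * kinetic d y"
proof -
  define s where "s = sqrt (1 + (d * y)\<^sup>2)"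
  have s: "s \<ge> 1" using sqrt_ge_one by (simp add: s_def)
  have "y\<^sup>2 / s \<le> y\<^sup>2 * (2 / (1 + s))"
    unfolding divide_inverse using s by (intro mult_left_mono) (auto simp: field_simps)
  then show ?thesis by (simp add: slope_def kinetic_def s_def[symmetric] power2_eq_square[of y] mult.commute)
qed

lemma kinetic_nonneg: "kinetic d y \<ge> 0"
  using sqrt_ge_one[of "d * y"] unfolding kinetic_def by (intro divide_nonneg_nonneg) auto

lemma kinetic_0 [simp]: "kinetic d 0 = 0"
  by (simp add: kinetic_def)

lemma kinetic_le: "kinetic d y \<le> y\<^sup>2"
proof -
  have "y\<^sup>2 / (1 + sqrt (1 + (d * y)\<^sup>2)) \<le> y\<^sup>2 / 1"
    using sqrt_ge_one[of "d * y"] by (intro divide_left_mono) (auto intro: add_pos_pos)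
  then show ?thesis by (simp add: kinetic_def)
qed

lemma abs_slope_less: "\<bar>d * slope d y\<bar> < 1"
proof -
  have "(d * y)\<^sup>2 < 1 + (d * y)\<^sup>2" by simp
  then have "\<bar>d * y\<bar> < sqrt (1 + (d * y)\<^sup>2)" using real_less_rsqrt by fastforce
  then show ?thesis using sqrt_pos[of "d * y"] by (simp add: slope_def abs_mult)
qed

text \<open>A flux beyond \<open>1 / d\<close> means that \<open>d * v\<close> moves at least at half of the limiting speed.\<close>

lemma slope_ge_half:
  assumes "d > 0" "y \<ge> 1 / d"
  shows "slope d y \<ge> 1 / (2 * d)"
proof -
  have y: "d * y \<ge> 1" using assms by (simp add: field_simps)
  then have "1 \<le> (d * y)\<^sup>2" using power_mono[OF y, of 2] by simp
  then have "1 + (d * y)\<^sup>2 \<le> (2 * (d * y))\<^sup>2" by (simp only: power_mult_distrib[of 2]) simp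
  then have "sqrt (1 + (d * y)\<^sup>2) \<le> 2 * (d * y)" using y by (intro real_le_lsqrt) auto
  then have "1 / (2 * d) * sqrt (1 + (d * y)\<^sup>2) \<le> y" using assms by (simp add: field_simps)
  then show ?thesis using sqrt_pos[of "d * y"] by (simp add: slope_def pos_le_divide_eq)
qed

section \<open>Energy estimates for a single profile\<close>

lemma nondecreasing_of_deriv_nonneg:
  fixes g :: "real \<Rightarrow> real"
  assumes "a \<le> b" "continuous_on {a..b} g"
    and "\<And>x. a < x \<Longrightarrow> x < b \<Longrightarrow> (g has_real_derivative g' x) (at x)"
    and "\<And>x. a < x \<Longrightarrow> x < b \<Longrightarrow> g' x \<ge> 0"
  shows "g a \<le> g b"
proof (rule DERIV_nonneg_imp_increasing_open[OF assms(1) _ assms(2)])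
  show "\<exists>y. DERIV g x :> y \<and> y \<ge> 0" if "a < x" "x < b" for x
    using assms(3,4)[OF that] by auto
qed

lemma nonincreasing_of_deriv_nonpos:
  fixes g :: "real \<Rightarrow> real"
  assumes "a \<le> b" "continuous_on {a..b} g"
    and "\<And>x. a < x \<Longrightarrow> x < b \<Longrightarrow> (g has_real_derivative g' x) (at x)"
    and "\<And>x. a < x \<Longrightarrow> x < b \<Longrightarrow> g' x \<le> 0"
  shows "g b \<le> g a"
  using nondecreasing_of_deriv_nonneg[OF assms(1) continuous_on_minus[OF assms(2)] DERIV_minus[OF assms(3)]]
    assms(4) by simp

text \<open>At an accumulation point of zeros the derivative would be zero.\<close>

lemma finite_simple_zeros:
  fixes g :: "real \<Rightarrow> real"
  assumes "continuous_on {a..b} g"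
    and "\<And>x. x \<in> {a..b} \<Longrightarrow> g x = 0 \<Longrightarrow> \<exists>D. D \<noteq> 0 \<and> (g has_real_derivative D) (at x within {a..b})"
  shows "finite {x \<in> {a..b}. g x = 0}"
proof (rule ccontr)
  let ?Z = "{x \<in> {a..b}. g x = 0}"
  assume "infinite ?Z"
  then obtain x where x: "x \<in> {a..b}" "x islimpt ?Z"
    using Heine_Borel_imp_Bolzano_Weierstrass[of "{a..b}" ?Z] by blast
  have "closed ?Z"
    using continuous_closed_preimage_constant[OF assms(1) closed_atLeastAtMost, of 0] by simp
  then have "g x = 0" using x(2) closed_limpt by blast
  then obtain D where D: "D \<noteq> 0" "((\<lambda>y. (g y - g x) / (y - x)) \<longlongrightarrow> D) (at x within {a..b})"
    using assms(2)[OF x(1)] unfolding has_field_derivative_iff by blast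
  have "\<forall>\<^sub>F y in at x within {a..b}. (g y - g x) / (y - x) \<noteq> 0"
    using D by (intro tendsto_imp_eventually_ne)
  then have "\<forall>\<^sub>F y in at x. y \<in> {a..b} \<longrightarrow> g y \<noteq> 0"
    using \<open>g x = 0\<close> unfolding eventually_at_filter by (auto elim: eventually_mono)
  then have "\<forall>\<^sub>F y in at x. y \<notin> ?Z" by (auto elim: eventually_mono)
  then show False using x(2) by (simp add: islimpt_iff_eventually)
qed

text \<open>A profile that has been divided by its value \<open>d\<close> at the origin. The nonlinearity \<open>f\<close> is the
  rescaled one and \<open>F\<close> is its potential.\<close>

locale radial_profile =
  fixes N :: nat and d :: real and f F v Y :: "real \<Rightarrow> real"
  assumes N: "N \<ge> 1" and d: "d \<ge> 0"
    and ivp: "radial_ivp N (slope d) f v Y"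
    and f_odd: "f (- s) = - f s"
    and f_pos: "s > 0 \<Longrightarrow> f s > 0"
    and F: "(F has_real_derivative f s) (at s)"
    and F0: "F 0 = 0"
begin

lemma v0: "v 0 = 1" and Y0: "Y 0 = - f 1 / N" and Y_cont: "continuous_on {0..} Y"
  and v_deriv0: "r \<ge> 0 \<Longrightarrow> (v has_real_derivative slope d (r * Y r)) (at r within {0..})"
  and Y_deriv: "r > 0 \<Longrightarrow> (Y has_real_derivative - (f (v r) + N * Y r) / r) (at r)"
  using ivp unfolding radial_ivp_def by auto

lemma v_deriv: "r > 0 \<Longrightarrow> (v has_real_derivative slope d (r * Y r)) (at r)"
  using v_deriv0[of r] at_within_interior[of r "{0..}"] by simp

lemma v_cont: "continuous_on {0..} v"
  by (rule DERIV_continuous_on[OF v_deriv0]) auto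

lemma y_deriv:
  assumes "r > 0"
  shows "((\<lambda>r. r * Y r) has_real_derivative - f (v r) - (real N - 1) * Y r) (at r)"
proof -
  have "r * (- (f (v r) + N * Y r) / r) = - (f (v r) + N * Y r)"
    using assms by simp
  then have "r * (- (f (v r) + N * Y r) / r) + 1 * Y r = - f (v r) - (real N - 1) * Y r"
    by (simp add: left_diff_distrib)
  moreover have "((\<lambda>r. r * Y r) has_real_derivative r * (- (f (v r) + N * Y r) / r) + 1 * Y r) (at r)"
    by (rule DERIV_mult'[OF DERIV_ident Y_deriv[OF assms]])
  ultimately show ?thesis by (simp only:)
qed

lemma w_deriv:
  assumes "r > 0"
  shows "((\<lambda>r. r ^ N * Y r) has_real_derivative - (r ^ (N - 1) * f (v r))) (at r)"
proof -
  have "r ^ N = r * r ^ (N - 1)" using N by (cases N) auto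
  then have "r ^ N * (- (f (v r) + N * Y r) / r) + real N * r ^ (N - 1) * Y r = - (r ^ (N - 1) * f (v r))"
    using assms by (simp add: field_simps)
  moreover have "((\<lambda>r. r ^ N * Y r) has_real_derivative
      r ^ N * (- (f (v r) + N * Y r) / r) + real N * r ^ (N - 1) * Y r) (at r)"
    using DERIV_mult'[OF DERIV_pow[of N r UNIV] Y_deriv[OF assms]] by simp
  ultimately show ?thesis by (simp only:)
qed

lemma w_cont: "continuous_on {0..} (\<lambda>r. r ^ N * Y r)"
  by (intro continuous_intros Y_cont)

lemma f_neg: "s < 0 \<Longrightarrow> f s < 0"
  using f_pos[of "- s"] f_odd[of s] by auto

lemma F_even: "F (- s) = F s"
proof -
  have "((\<lambda>s. F (- s) - F s) has_real_derivative - f (- x) - f x) (at x)" for x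
    using DERIV_diff[OF DERIV_mirror[THEN iffD1, OF F[of "- x"]] F[of x]] by simp
  then have "((\<lambda>s. F (- s) - F s) has_real_derivative 0) (at x)" for x
    by (simp add: f_odd)
  then have "F (- s) - F s = F (- 0) - F 0" by (intro DERIV_isconst_all) blast
  then show ?thesis by simp
qed

lemma F_cont: "continuous_on A F"
  by (rule DERIV_continuous_on[OF has_field_derivative_at_within[OF F]])

lemma F_strict: "0 \<le> s \<Longrightarrow> s < t \<Longrightarrow> F s < F t"
proof (rule DERIV_pos_imp_increasing_open[of s t])
  show "\<exists>y. DERIV F x :> y \<and> y > 0" if "0 \<le> s" "s < x" for x
    using F[of x] f_pos[of x] that by auto
qed (use F_cont in auto)

lemma F_abs: "F \<bar>s\<bar> = F s"
  using F_even[of s] by (simp add: abs_if)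

lemma F_nonneg: "F s \<ge> 0"
  using F_strict[of 0 "\<bar>s\<bar>"] F0 F_abs[of s] by (cases "s = 0") auto

lemma F_eq_0: "F s = 0 \<longleftrightarrow> s = 0"
  using F_strict[of 0 "\<bar>s\<bar>"] F0 F_abs[of s] by (cases "s = 0") auto

definition energy :: "real \<Rightarrow> real" where
  "energy r = kinetic d (r * Y r) + F (v r)"

lemma energy_cont: "continuous_on {0..} energy"
proof -
  have k: "continuous_on UNIV (kinetic d)"
    by (rule DERIV_continuous_on[OF has_field_derivative_at_within[OF DERIV_kinetic]])
  have "continuous_on {0..} (\<lambda>r. r * Y r)" by (intro continuous_intros Y_cont)
  then have "continuous_on {0..} (\<lambda>r. kinetic d (r * Y r))"
    by (rule continuous_on_compose2[OF k]) auto
  moreover have "continuous_on {0..} (\<lambda>r. F (v r))"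
    by (rule continuous_on_compose2[OF F_cont[of UNIV] v_cont]) auto
  ultimately show ?thesis unfolding energy_def[abs_def] by (rule continuous_on_add)
qed

lemma energy_deriv:
  assumes "r > 0"
  shows "(energy has_real_derivative - (real N - 1) * (Y r * slope d (r * Y r))) (at r)"
proof -
  have 1: "((\<lambda>r. kinetic d (r * Y r)) has_real_derivative
      slope d (r * Y r) * (- f (v r) - (real N - 1) * Y r)) (at r)"
    by (rule DERIV_chain2[OF DERIV_kinetic y_deriv[OF assms]])
  have 2: "((\<lambda>r. F (v r)) has_real_derivative f (v r) * slope d (r * Y r)) (at r)"
    by (rule DERIV_chain2[OF F v_deriv[OF assms]])
  have "slope d (r * Y r) * (- f (v r) - (real N - 1) * Y r) + f (v r) * slope d (r * Y r)
      = - (real N - 1) * (Y r * slope d (r * Y r))"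
    by algebra
  moreover have "(energy has_real_derivative
      slope d (r * Y r) * (- f (v r) - (real N - 1) * Y r) + f (v r) * slope d (r * Y r)) (at r)"
    unfolding energy_def[abs_def] by (rule DERIV_add[OF 1 2])
  ultimately show ?thesis by (simp only:)
qed

lemma Y_slope_nonneg: "r > 0 \<Longrightarrow> Y r * slope d (r * Y r) \<ge> 0"
  using mult_slope_nonneg[of "r * Y r" d] by (simp add: mult.assoc zero_le_mult_iff)

text \<open>The term \<open>(N - 1) * Y\<close> acts as friction.\<close>

lemma energy_antimono:
  assumes "0 \<le> r" "r \<le> s"
  shows "energy s \<le> energy r"
proof (rule nonincreasing_of_deriv_nonpos[OF assms(2)])
  show "continuous_on {r..s} energy"
    using assms by (intro continuous_on_subset[OF energy_cont]) auto
  fix x assume "r < x" "x < s"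
  then have x: "x > 0" using assms by simp
  show "(energy has_real_derivative - (real N - 1) * (Y x * slope d (x * Y x))) (at x)"
    by (rule energy_deriv[OF x])
  show "- (real N - 1) * (Y x * slope d (x * Y x)) \<le> 0"
    using N Y_slope_nonneg[OF x] by (intro mult_nonpos_nonneg) auto
qed

text \<open>The friction dissipates at most \<open>2 * (N - 1) / r\<close> times the energy, so the decay of the
  energy is at most polynomial.\<close>

lemma energy_growth:
  assumes "0 \<le> r" "r \<le> s"
  shows "r ^ (2 * (N - 1)) * energy r \<le> s ^ (2 * (N - 1)) * energy s"
proof (rule nondecreasing_of_deriv_nonneg[OF assms(2)])
  let ?M = "2 * (N - 1)"
  show "continuous_on {r..s} (\<lambda>r. r ^ ?M * energy r)"
    using assms by (intro continuous_intros continuous_on_subset[OF energy_cont]) auto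
  fix x assume "r < x" "x < s"
  then have x: "x > 0" using assms by simp
  show "((\<lambda>r. r ^ ?M * energy r) has_real_derivative
      x ^ ?M * (- (real N - 1) * (Y x * slope d (x * Y x))) + real ?M * x ^ (?M - 1) * energy x) (at x)"
    using DERIV_mult'[OF DERIV_pow[of ?M x UNIV] energy_deriv[OF x]] by simp
  show "x ^ ?M * (- (real N - 1) * (Y x * slope d (x * Y x))) + real ?M * x ^ (?M - 1) * energy x \<ge> 0"
  proof (cases "N = 1")
    case False
    define P n where "P = x ^ (?M - 1)" and "n = real N - 1"
    have M: "real ?M = 2 * n" using N by (simp add: n_def of_nat_diff)
    have "?M = Suc (?M - 1)" using False N by simp
    then have p: "x ^ ?M = x * P" unfolding P_def by (metis power_Suc)
    have "x * Y x * slope d (x * Y x) \<le> 2 * energy x"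
    proof -
      have "x * Y x * slope d (x * Y x) \<le> 2 * kinetic d (x * Y x) + 2 * F (v x)"
        using mult_slope_le_kinetic[of "x * Y x" d] F_nonneg[of "v x"] by linarith
      then show ?thesis by (simp only: energy_def distrib_left)
    qed
    then have "P * n * (x * Y x * slope d (x * Y x)) \<le> P * n * (2 * energy x)"
      using N x unfolding P_def n_def by (intro mult_left_mono) auto
    then show ?thesis unfolding p M P_def[symmetric] n_def[symmetric] by (simp add: mult_ac)
  qed simp
qed

text \<open>The potential energy never exceeds the initial energy \<open>F 1\<close>.\<close>

lemma v_bounded:
  assumes "r \<ge> 0" shows "\<bar>v r\<bar> \<le> 1"
proof (rule ccontr)
  assume "\<not> \<bar>v r\<bar> \<le> 1"
  then have "F 1 < F (v r)" using F_strict[of 1 "\<bar>v r\<bar>"] F_abs by simp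
  moreover have "F (v r) \<le> energy r" using kinetic_nonneg by (simp add: energy_def)
  moreover have "energy r \<le> energy 0" using energy_antimono assms by simp
  ultimately show False by (simp add: energy_def v0)
qed

text \<open>At a double zero the energy would vanish, hence by \<open>energy_growth\<close> at all smaller radii, which
  contradicts \<open>v 0 = 1\<close>.\<close>

lemma zero_simple:
  assumes r: "r > 0" and "v r = 0"
  shows "Y r \<noteq> 0"
proof
  assume "Y r = 0"
  then have Er: "energy r = 0" using assms F0 by (simp add: energy_def)
  have z: "v s = 0" if "0 < s" "s \<le> r" for s
  proof -
    have "s ^ (2 * (N - 1)) * energy s \<le> 0"
      using energy_growth[of s r] that unfolding Er by simp
    moreover have "s ^ (2 * (N - 1)) > 0" using that by simp
    ultimately have "energy s \<le> 0" by (metis mult_le_0_iff not_less)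
    then have "F (v s) = 0" using kinetic_nonneg[of d "s * Y s"] F_nonneg[of "v s"] by (simp add: energy_def)
    then show ?thesis by (simp add: F_eq_0)
  qed
  have "(v \<longlongrightarrow> v 0) (at 0 within {0..})" using v_cont by (auto simp: continuous_on_def)
  then have "(v \<longlongrightarrow> v 0) (at_right 0)" by (rule tendsto_within_subset) auto
  moreover have "(v \<longlongrightarrow> 0) (at_right 0)"
    by (rule tendsto_eventually) (use z r in \<open>auto simp: eventually_at_right intro!: exI[of _ r]\<close>)
  ultimately have "v 0 = 0" by (intro tendsto_unique[OF trivial_limit_at_right_real])
  then show False using v0 by simp
qed

lemma finite_zeros: "finite {r \<in> {0..T}. v r = 0}"
proof (rule finite_simple_zeros)
  show "continuous_on {0..T} v" by (rule continuous_on_subset[OF v_cont]) auto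
  fix x assume x: "x \<in> {0..T}" "v x = 0"
  then have "x > 0" using v0 by (cases "x = 0") auto
  then show "\<exists>D. D \<noteq> 0 \<and> (v has_real_derivative D) (at x within {0..T})"
    using zero_simple x v_deriv by (intro exI[of _ "slope d (x * Y x)"]) (auto intro: has_field_derivative_at_within)
qed

end

section \<open>Nodal shape of a profile\<close>

lemma positive_on_connected:
  fixes g :: "'a::topological_space \<Rightarrow> real"
  assumes "connected S" "continuous_on S g" "\<And>x. x \<in> S \<Longrightarrow> g x \<noteq> 0" "x \<in> S" "g x > 0" "y \<in> S"
  shows "g y > 0"
proof (rule ccontr)
  assume "\<not> g y > 0"
  then have "0 \<in> g ` S"
    using connectedD_interval[OF connected_continuous_image[OF assms(2,1)], of "g y" "g x" 0] assms by auto
  then show False using assms(3) by auto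
qed

lemma constant_sign:
  fixes g :: "real \<Rightarrow> real"
  assumes "continuous_on {a<..<b} g" "\<And>x. x \<in> {a<..<b} \<Longrightarrow> g x \<noteq> 0"
  obtains \<sigma> where "\<sigma> = 1 \<or> \<sigma> = -1" "\<And>x. x \<in> {a<..<b} \<Longrightarrow> \<sigma> * g x > (0::real)"
proof (cases "{a<..<b} = {}")
  case False
  then obtain m where m: "m \<in> {a<..<b}" by blast
  show thesis
  proof (cases "g m > 0")
    case True
    then show thesis
      using that[of 1] positive_on_connected[of "{a<..<b}" g m] assms m by simp
  next
    case False
    then have "- g m > 0" using assms(2)[OF m] by simp
    then have "- g y > 0" if "y \<in> {a<..<b}" for y
      using positive_on_connected[of "{a<..<b}" "\<lambda>x. - g x" m y] assms m that
      by (auto intro: continuous_on_minus)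
    then show thesis using that[of "-1"] by simp
  qed
qed (use that in auto)

lemma mean_value:
  fixes g :: "real \<Rightarrow> real"
  assumes "a < b" "continuous_on {a..b} g"
    and "\<And>x. a < x \<Longrightarrow> x < b \<Longrightarrow> (g has_real_derivative g' x) (at x)"
  obtains z where "a < z" "z < b" "g b - g a = (b - a) * g' z"
proof -
  obtain l z where z: "a < z" "z < b" "DERIV g z :> l" "g b - g a = (b - a) * l"
    using MVT[OF assms(1,2)] assms(3) real_differentiable_def by blast
  then show thesis using that[of z] DERIV_unique[OF z(3) assms(3)] by simp
qed

lemma local_extremum_deriv_0:
  assumes "local_extremum u c" "(u has_real_derivative D) (at c)"
  shows "D = 0"
  using assms(1) unfolding local_extremum_def
proof
  assume "\<forall>\<^sub>F r in nhds c. u r \<le> u c"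
  then obtain e where "e > 0" "\<And>r. dist r c < e \<Longrightarrow> u r \<le> u c" unfolding eventually_nhds_metric by blast
  then show ?thesis by (intro DERIV_local_max[OF assms(2)]) (auto simp: dist_real_def abs_minus_commute)
next
  assume "\<forall>\<^sub>F r in nhds c. u c \<le> u r"
  then obtain e where "e > 0" "\<And>r. dist r c < e \<Longrightarrow> u c \<le> u r" unfolding eventually_nhds_metric by blast
  then show ?thesis by (intro DERIV_local_min[OF assms(2)]) (auto simp: dist_real_def abs_minus_commute)
qed

context radial_profile
begin

text \<open>Where \<open>v\<close> has constant sign the flux \<open>r ^ N * Y r\<close> is strictly monotone, so it vanishes at
  most once; at a local extremum it does vanish.\<close>

lemma unique_extremum_between_zeros:
  assumes ab: "0 \<le> a" "a < b" and z: "v a = 0" "v b = 0" and nz: "\<And>r. r \<in> {a<..<b} \<Longrightarrow> v r \<noteq> 0"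
  shows "\<exists>!c. c \<in> {a<..<b} \<and> local_extremum v c"
proof -
  have vc: "continuous_on {a..b} v" using ab by (intro continuous_on_subset[OF v_cont]) auto
  obtain \<sigma> where \<sigma>: "\<sigma> = 1 \<or> \<sigma> = -1" "\<And>x. x \<in> {a<..<b} \<Longrightarrow> \<sigma> * v x > 0"
    using constant_sign[OF continuous_on_subset[OF vc greaterThanLessThan_subseteq_atLeastAtMost_iff[THEN iffD2]] nz] ab
    by (metis order_refl)
  have "continuous_on {a..b} (\<lambda>r. \<sigma> * v r)" by (intro continuous_intros vc)
  then obtain c where c: "c \<in> {a..b}" "\<And>r. r \<in> {a..b} \<Longrightarrow> \<sigma> * v r \<le> \<sigma> * v c"
    using continuous_attains_sup[of "{a..b}" "\<lambda>r. \<sigma> * v r"] ab by auto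
  have "\<sigma> * v c > 0" using c(2)[of "(a + b) / 2"] \<sigma>(2)[of "(a + b) / 2"] ab by auto
  then have c': "c \<in> {a<..<b}" using c(1) z by (cases "c = a"; cases "c = b") auto
  have "\<forall>\<^sub>F r in nhds c. r \<in> {a<..<b}" using c' by (intro eventually_nhds_in_open) auto
  then have "\<forall>\<^sub>F r in nhds c. \<sigma> * v r \<le> \<sigma> * v c" by (rule eventually_mono) (use c(2) in auto)
  then have ext: "local_extremum v c" using \<sigma>(1) unfolding local_extremum_def by auto
  have flux0: "r ^ N * Y r = 0" if "r \<in> {a<..<b}" "local_extremum v r" for r
    using local_extremum_deriv_0[OF that(2) v_deriv] that ab by auto
  have dec: "\<sigma> * (s ^ N * Y s) < \<sigma> * (r ^ N * Y r)" if "r \<in> {a<..<b}" "s \<in> {a<..<b}" "r < s" for r s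
  proof (rule DERIV_neg_imp_decreasing_open[OF that(3)])
    fix x assume x: "r < x" "x < s"
    then have x0: "x > 0" and xab: "x \<in> {a<..<b}" using that ab by auto
    have "\<sigma> * f (v x) > 0"
      using \<sigma>(1) \<sigma>(2)[OF xab] f_pos[of "v x"] f_neg[of "v x"] by auto
    then have "x ^ (N - 1) * (\<sigma> * f (v x)) > 0" using x0 by simp
    then have "\<sigma> * - (x ^ (N - 1) * f (v x)) < 0" by (simp add: mult_ac)
    moreover have "((\<lambda>r. \<sigma> * (r ^ N * Y r)) has_real_derivative \<sigma> * - (x ^ (N - 1) * f (v x))) (at x)"
      by (rule DERIV_cmult[OF w_deriv[OF x0]])
    ultimately show "\<exists>y. DERIV (\<lambda>r. \<sigma> * (r ^ N * Y r)) x :> y \<and> y < 0" by blast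
  next
    show "continuous_on {r..s} (\<lambda>r. \<sigma> * (r ^ N * Y r))"
      using that ab by (intro continuous_on_mult_left continuous_on_subset[OF w_cont]) auto
  qed
  show ?thesis
  proof (rule ex1I[of _ c])
    show "c \<in> {a<..<b} \<and> local_extremum v c" using c' ext by simp
    fix e assume e: "e \<in> {a<..<b} \<and> local_extremum v e"
    show "e = c"
      using dec[of e c] dec[of c e] flux0[of e] flux0[of c] e c' ext
      by (cases e c rule: linorder_cases) auto
  qed
qed

lemma positive_before_first_zero:
  assumes "\<And>r. r \<in> {0..<z} \<Longrightarrow> v r \<noteq> 0" "0 \<le> r" "r < z"
  shows "v r > 0"
  by (rule positive_on_connected[of "{0..<z}" v 0])
     (use assms v0 in \<open>auto intro: continuous_on_subset[OF v_cont]\<close>)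

lemma strictly_decreasing_to_first_zero:
  assumes nz: "\<And>r. r \<in> {0..<z} \<Longrightarrow> v r \<noteq> 0"
  shows "strict_antimono_on {0..z} v"
proof (rule monotone_onI)
  fix x y assume xy: "x \<in> {0..z}" "y \<in> {0..z}" "x < y"
  have flux: "r ^ N * Y r < 0" if r: "0 < r" "r < z" for r
  proof -
    have "r ^ N * Y r < 0 ^ N * Y 0"
    proof (rule DERIV_neg_imp_decreasing_open[OF r(1)])
      fix x assume x: "0 < x" "x < r"
      then have "v x > 0" using positive_before_first_zero[of z x] nz r by auto
      then have "- (x ^ (N - 1) * f (v x)) < 0" using f_pos x by simp
      then show "\<exists>y. DERIV (\<lambda>r. r ^ N * Y r) x :> y \<and> y < 0" using w_deriv[OF x(1)] by blast
    qed (auto intro: continuous_on_subset[OF w_cont])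
    then show ?thesis using N by (simp add: zero_power)
  qed
  show "v x > v y"
  proof (rule DERIV_neg_imp_decreasing_open[OF xy(3)])
    fix r assume r: "x < r" "r < y"
    then have r0: "0 < r" "r < z" using xy by auto
    then have "Y r < 0" using flux[OF r0] by (simp add: mult_less_0_iff)
    then have "r * Y r < 0" using r0 by (simp add: mult_pos_neg)
    then show "\<exists>D. DERIV v r :> D \<and> D < 0" using v_deriv[OF r0(1)] by auto
  qed (use xy in \<open>auto intro: continuous_on_subset[OF v_cont]\<close>)
qed

lemma finite_interior_zeros: "finite {r \<in> {0<..<T}. v r = 0}"
  by (rule finite_subset[OF _ finite_zeros[of T]]) auto

lemma nodal_profile_scaled:
  assumes c: "c > 0" and R: "R > 0" "v R = 0"
  shows "nodal_profile R (card {r \<in> {0<..<R}. v r = 0}) (\<lambda>r. c * v r)"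
proof -
  have ext: "local_extremum (\<lambda>r. c * v r) e \<longleftrightarrow> local_extremum v e" for e
    using c by (simp add: local_extremum_def)
  have eq: "c * v r = 0 \<longleftrightarrow> v r = 0" for r using c by simp
  let ?Z = "{r \<in> {0<..R}. v r = 0}"
  have fin: "finite ?Z" by (rule finite_subset[OF _ finite_zeros[of R]]) auto
  have ne: "?Z \<noteq> {}" using R by auto
  define z where "z = Min ?Z"
  have z: "z \<in> ?Z" unfolding z_def by (rule Min_in[OF fin ne])
  have nz: "v r \<noteq> 0" if "r \<in> {0..<z}" for r
  proof
    assume "v r = 0"
    moreover from this have "r \<noteq> 0" using v0 by auto
    ultimately have "r \<in> ?Z" using that z by auto
    then show False using Min_le[OF fin] that unfolding z_def by fastforce
  qed
  have "strict_antimono_on {0..z} (\<lambda>r. c * v r)"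
    using strictly_decreasing_to_first_zero[OF nz] c by (auto simp: monotone_on_def)
  then show ?thesis
    unfolding nodal_profile_def ext eq
    using finite_interior_zeros z nz unique_extremum_between_zeros
    by (intro conjI refl bexI[of _ z]) (auto simp del: mult_eq_0_iff)
qed

end

section \<open>Oscillation of profiles\<close>

text \<open>A positive bump of height at most \<open>1\<close> rises, turns and falls, in this order, because the flux
  \<open>w\<close> decreases. Rising and falling take at most \<open>2 * d\<close> each, since \<open>v\<close> then moves with speed at
  least \<open>1 / (2 * d)\<close> within a band of height \<open>1\<close>. The turn takes less than \<open>d\<close>, since there \<open>w\<close>
  has to cross a band of height \<open>2 * \<kappa>\<close> with speed at least \<open>B\<close>.\<close>

lemma no_long_bump:
  fixes v w :: "real \<Rightarrow> real"
  assumes d: "d > 0" and B: "B * d > 2 * \<kappa>"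
    and v: "continuous_on {a..a + 5 * d} v" "\<And>x. a < x \<Longrightarrow> x < a + 5 * d \<Longrightarrow> (v has_real_derivative v' x) (at x)"
    and w: "continuous_on {a..a + 5 * d} w" "\<And>x. a < x \<Longrightarrow> x < a + 5 * d \<Longrightarrow> (w has_real_derivative w' x) (at x)"
    and range: "\<And>x. x \<in> {a..a + 5 * d} \<Longrightarrow> 0 < v x \<and> v x \<le> 1"
    and w': "\<And>x. a < x \<Longrightarrow> x < a + 5 * d \<Longrightarrow> w' x \<le> 0"
    and up: "\<And>x. a < x \<Longrightarrow> x < a + 5 * d \<Longrightarrow> w x \<ge> \<kappa> \<Longrightarrow> v' x \<ge> 1 / (2 * d)"
    and down: "\<And>x. a < x \<Longrightarrow> x < a + 5 * d \<Longrightarrow> w x \<le> - \<kappa> \<Longrightarrow> v' x \<le> - 1 / (2 * d)"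
    and turn: "\<And>x. a < x \<Longrightarrow> x < a + 5 * d \<Longrightarrow> \<bar>w x\<bar> < \<kappa> \<Longrightarrow> w' x \<le> - B"
  shows False
proof -
  have w_anti: "w y \<le> w x" if "a \<le> x" "x \<le> y" "y \<le> a + 5 * d" for x y
    by (rule nonincreasing_of_deriv_nonpos[OF that(2) _ w(2) w'])
       (use that in \<open>auto intro: continuous_on_subset[OF w(1)]\<close>)
  have 1: "w (a + 2 * d) < \<kappa>"
  proof (rule ccontr)
    assume c: "\<not> w (a + 2 * d) < \<kappa>"
    obtain z where z: "a < z" "z < a + 2 * d" "v (a + 2 * d) - v a = (a + 2 * d - a) * v' z"
      using mean_value[of a "a + 2 * d" v v'] d v(2) continuous_on_subset[OF v(1), of "{a..a + 2 * d}"] by auto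
    have "w z \<ge> \<kappa>" using w_anti[of z "a + 2 * d"] c z d by auto
    then have "v' z \<ge> 1 / (2 * d)" using up z d by auto
    then have "2 * d * v' z \<ge> 1" using d by (simp add: field_simps)
    then show False using z range[of a] range[of "a + 2 * d"] d by auto
  qed
  have 2: "w (a + 3 * d) \<le> - \<kappa>"
  proof (rule ccontr)
    assume c: "\<not> w (a + 3 * d) \<le> - \<kappa>"
    obtain z where z: "a + 2 * d < z" "z < a + 3 * d" "w (a + 3 * d) - w (a + 2 * d) = (a + 3 * d - (a + 2 * d)) * w' z"
      using mean_value[of "a + 2 * d" "a + 3 * d" w w'] d w(2) continuous_on_subset[OF w(1), of "{a + 2 * d..a + 3 * d}"] by auto
    have "\<bar>w z\<bar> < \<kappa>" using w_anti[of z "a + 3 * d"] w_anti[of "a + 2 * d" z] c 1 z d by auto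
    then have "w' z \<le> - B" using turn z d by auto
    then have "d * w' z \<le> - (B * d)" using d mult_left_mono[of "w' z" "- B" d] by (simp add: mult.commute)
    then show False using z(3) c 1 B by simp
  qed
  obtain z where z: "a + 3 * d < z" "z < a + 5 * d" "v (a + 5 * d) - v (a + 3 * d) = (a + 5 * d - (a + 3 * d)) * v' z"
    using mean_value[of "a + 3 * d" "a + 5 * d" v v'] d v(2) continuous_on_subset[OF v(1), of "{a + 3 * d..a + 5 * d}"] by auto
  have "w z \<le> - \<kappa>" using w_anti[of "a + 3 * d" z] 2 z d by auto
  then have "v' z \<le> - 1 / (2 * d)" using down z d by auto
  then have "2 * d * v' z \<le> - 1" using d by (simp add: field_simps)
  then show False using z range[of "a + 5 * d"] range[of "a + 3 * d"] d by auto
qed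

text \<open>For \<open>r \<ge> N - 1\<close> the Riccati variable \<open>h = - v' / v\<close> satisfies \<open>h' \<ge> (1 + h\<^sup>2) / 2\<close>. So
  \<open>arctan h\<close> would grow by at least \<open>pi\<close> over a window of length \<open>2 * pi\<close> without zeros, but its
  values lie in an open interval of length \<open>pi\<close>.\<close>

lemma linear_profile_zero_in_window:
  assumes "radial_profile N 0 (\<lambda>s. s) F v Y" and a: "a > 0" "a \<ge> real N - 1"
  shows "\<exists>z\<in>{a..a + 2 * pi}. v z = 0"
proof (rule ccontr)
  interpret radial_profile N 0 "\<lambda>s. s" F v Y by fact
  assume "\<not> ?thesis"
  then have nz: "v r \<noteq> 0" if "r \<in> {a..a + 2 * pi}" for r using that by blast
  define h where "h r = - (r * Y r) / v r" for r
  define h' where "h' r = 1 + (real N - 1) * Y r / v r + (h r)\<^sup>2" for r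
  have hd: "(h has_real_derivative h' r) (at r)" if r: "a < r" "r < a + 2 * pi" for r
  proof -
    have "r > 0" "v r \<noteq> 0" using r a nz by auto
    note D = DERIV_divide[OF DERIV_minus[OF y_deriv[OF \<open>r > 0\<close>]] v_deriv[OF \<open>r > 0\<close>] \<open>v r \<noteq> 0\<close>]
    have "(- (- v r - (real N - 1) * Y r) * v r - - (r * Y r) * slope 0 (r * Y r)) / (v r * v r) = h' r"
      using \<open>v r \<noteq> 0\<close> unfolding h'_def h_def by (simp add: field_simps power2_eq_square)
    then show ?thesis using D unfolding h_def[abs_def] by (simp only:)
  qed
  have ge: "h' r \<ge> (1 + (h r)\<^sup>2) / 2" if r: "a < r" "r < a + 2 * pi" for r
  proof -
    have pos: "r > 0" "v r \<noteq> 0" using r a nz by auto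
    define t where "t = (real N - 1) * Y r / v r"
    have "\<bar>t\<bar> = (real N - 1) / r * \<bar>h r\<bar>"
      using pos N by (simp add: h_def t_def abs_mult)
    also have "\<dots> \<le> 1 * \<bar>h r\<bar>" using a r pos by (intro mult_right_mono) auto
    also have "\<dots> \<le> (1 + (h r)\<^sup>2) / 2"
      using zero_le_power2[of "\<bar>h r\<bar> - 1"] by (simp add: power2_diff)
    finally have "- t \<le> (1 + (h r)\<^sup>2) / 2" by (rule abs_le_D2)
    then show ?thesis unfolding h'_def t_def[symmetric] by (simp add: field_simps)
  qed
  have cont: "continuous_on {a..a + 2 * pi} h"
    unfolding h_def using nz a
    by (intro continuous_intros continuous_on_subset[OF Y_cont] continuous_on_subset[OF v_cont]) auto
  obtain z where z: "a < z" "z < a + 2 * pi"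
    "arctan (h (a + 2 * pi)) - arctan (h a) = (a + 2 * pi - a) * (inverse (1 + (h z)\<^sup>2) * h' z)"
  proof (rule mean_value[of a "a + 2 * pi" "\<lambda>r. arctan (h r)" "\<lambda>z. inverse (1 + (h z)\<^sup>2) * h' z"])
    show "continuous_on {a..a + 2 * pi} (\<lambda>r. arctan (h r))" by (intro continuous_intros cont)
    show "((\<lambda>r. arctan (h r)) has_real_derivative inverse (1 + (h x)\<^sup>2) * h' x) (at x)"
      if "a < x" "x < a + 2 * pi" for x
      by (rule DERIV_chain2[OF DERIV_arctan hd[OF that]])
  qed auto
  have "inverse (1 + (h z)\<^sup>2) * h' z \<ge> inverse (1 + (h z)\<^sup>2) * ((1 + (h z)\<^sup>2) / 2)"
    by (intro mult_left_mono ge z) (simp add: less_imp_le)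
  then have "inverse (1 + (h z)\<^sup>2) * h' z \<ge> 1 / 2" by simp
  then have "2 * pi * (inverse (1 + (h z)\<^sup>2) * h' z) \<ge> 2 * pi * (1 / 2)"
    by (intro mult_left_mono) auto
  then have "arctan (h (a + 2 * pi)) - arctan (h a) \<ge> pi" using z(3) by simp
  then show False using arctan_bounded[of "h (a + 2 * pi)"] arctan_bounded[of "h a"] by auto
qed


definition potential :: "real \<Rightarrow> real \<Rightarrow> real \<Rightarrow> real \<Rightarrow> real" where
  "potential p lam c s = lam / 2 * s\<^sup>2 + c / p * \<bar>s\<bar> powr p"

lemma DERIV_signed_powr:
  assumes q: "q > (0::real)"
  shows "((\<lambda>s. \<bar>s\<bar> powr q * s) has_real_derivative (q + 1) * \<bar>s\<bar> powr q) (at s)"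
proof (cases s "0::real" rule: linorder_cases)
  case less
  have "((\<lambda>s. (- s) powr q * s) has_real_derivative (q * (- s) powr (q - 1) * (- 1)) * s + (- s) powr q * 1) (at s)"
    using less by (auto intro!: derivative_eq_intros)
  moreover have "(q * (- s) powr (q - 1) * (- 1)) * s + (- s) powr q * 1 = (q + 1) * \<bar>s\<bar> powr q"
    using less by (simp add: powr_diff field_simps)
  ultimately have "((\<lambda>s. (- s) powr q * s) has_real_derivative (q + 1) * \<bar>s\<bar> powr q) (at s)" by simp
  then show ?thesis
    by (rule has_field_derivative_transform_within_open[where S = "{..<0}"]) (use less in auto)
next
  case equal
  have "((\<lambda>h. \<bar>h\<bar> powr q) \<longlongrightarrow> \<bar>0\<bar> powr q) (at (0::real))"
    using q by (intro tendsto_powr' tendsto_intros) auto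
  then have "((\<lambda>h. (\<bar>h\<bar> powr q * h) / h) \<longlongrightarrow> 0) (at (0::real))"
    by (subst tendsto_cong[where g = "\<lambda>h. \<bar>h\<bar> powr q"]) (auto simp: eventually_at_filter)
  then show ?thesis using equal by (simp add: has_field_derivative_iff)
next
  case greater
  have "((\<lambda>s. s powr q * s) has_real_derivative (q * s powr (q - 1)) * s + s powr q * 1) (at s)"
    using greater by (auto intro!: derivative_eq_intros)
  moreover have "(q * s powr (q - 1)) * s + s powr q * 1 = (q + 1) * \<bar>s\<bar> powr q"
    using greater by (simp add: powr_diff field_simps)
  ultimately have "((\<lambda>s. s powr q * s) has_real_derivative (q + 1) * \<bar>s\<bar> powr q) (at s)" by simp
  then show ?thesis
    by (rule has_field_derivative_transform_within_open[where S = "{0<..}"]) (use greater in auto)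
qed

lemma DERIV_abs_powr:
  assumes "p > (2::real)"
  shows "((\<lambda>s. \<bar>s\<bar> powr p) has_real_derivative p * (\<bar>s\<bar> powr (p - 2) * s)) (at s)"
proof -
  have "\<bar>s\<bar> powr (p - 2) * s * s = \<bar>s\<bar> powr p" for s :: real
    using powr_add[of "\<bar>s\<bar>" "p - 2" 2] by (simp add: power2_eq_square mult.assoc)
  then have "(\<lambda>s. \<bar>s\<bar> powr p) = (\<lambda>s. \<bar>s\<bar> powr (p - 2) * s * s)" by simp
  moreover have "p - 2 > 0" using assms by simp
  note DERIV_mult'[OF DERIV_signed_powr[OF this] DERIV_ident, of s]
  ultimately show ?thesis by (simp add: algebra_simps)
qed

lemma DERIV_potential:
  assumes "p > 2"
  shows "(potential p lam c has_real_derivative reaction p lam c s) (at s)"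
proof -
  have "((\<lambda>s. lam / 2 * s\<^sup>2 + c / p * \<bar>s\<bar> powr p) has_real_derivative
      lam / 2 * (2 * s) + c / p * (p * (\<bar>s\<bar> powr (p - 2) * s))) (at s)"
    by (intro DERIV_add DERIV_cmult DERIV_abs_powr assms) (auto intro!: derivative_eq_intros)
  moreover have "lam / 2 * (2 * s) + c / p * (p * (\<bar>s\<bar> powr (p - 2) * s)) = reaction p lam c s"
    using assms by (simp add: reaction_def)
  ultimately show ?thesis unfolding potential_def[abs_def] by simp
qed

text \<open>By \<open>energy_growth\<close> the energy beyond \<open>d / 2\<close> is at least a fixed multiple of \<open>c\<close>. When the
  flux is small, this energy is potential energy, so \<open>v\<close> stays away from \<open>0\<close> and the restoring force
  is of order \<open>c\<close>. For large \<open>c\<close> the flux hence reverses quickly and \<open>no_long_bump\<close> applies to \<open>v\<close> or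
  \<open>- v\<close>.\<close>

lemma large_coefficient_zero_in_window:
  fixes d R p lam :: real
  assumes dR: "0 < d" "d < R" and p: "p > 2" and lam: "lam \<ge> 0"
  obtains C where "\<And>c v Y a. \<lbrakk>c \<ge> C; radial_profile N d (reaction p lam c) (potential p lam c) v Y;
      d / 2 \<le> a; a + 5 * d \<le> R\<rbrakk> \<Longrightarrow> \<exists>z\<in>{a..a + 5 * d}. v z = 0"
proof -
  define r0 where "r0 = d / 2"
  define M where "M = 2 * (N - 1)"
  \<comment> \<open>The energy at \<open>r0\<close> is at least \<open>c * ((1 / 2) powr p / p)\<close>, hence at least \<open>\<rho> * c\<close> up to \<open>R\<close>.\<close>
  define \<rho> where "\<rho> = (r0 / R) ^ M * ((1 / 2) powr p / p)"
  \<comment> \<open>A weighted flux of size \<open>\<kappa>\<close> forces \<open>\<bar>y\<bar> \<ge> 1 / d\<close>; below \<open>\<kappa>\<close>, \<open>\<bar>y\<bar>\<close> is at most \<open>K\<close>.\<close>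
  define K where "K = R ^ (N - 1) / (d * r0 ^ (N - 1))"
  define \<kappa> where "\<kappa> = R ^ (N - 1) / d"
  \<comment> \<open>While the flux turns, \<open>\<bar>v\<bar> \<ge> s0\<close> and the flux changes at a rate of at least \<open>c * b\<close>.\<close>
  define s0 where "s0 = \<rho> / 4"
  define b where "b = r0 ^ (N - 1) * s0 powr (p - 1)"
  define C where "C = Max {1, lam, 2 * K\<^sup>2 / \<rho>, (2 * \<kappa> + 1) / (b * d)}"
  have r0: "0 < r0" "r0 < R" using dR by (auto simp: r0_def)
  have \<rho>: "\<rho> > 0" unfolding \<rho>_def using r0 dR p by (intro mult_pos_pos divide_pos_pos zero_less_power) auto
  have \<kappa>: "\<kappa> > 0" using dR by (simp add: \<kappa>_def)
  have s0: "s0 > 0" using \<rho> by (simp add: s0_def)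
  have b: "b > 0" using r0 s0 by (simp add: b_def)
  show thesis
  proof (rule that)
    fix c v Y a
    assume C: "c \<ge> C" and prof: "radial_profile N d (reaction p lam c) (potential p lam c) v Y"
      and a: "d / 2 \<le> a" "a + 5 * d \<le> R"
    interpret radial_profile N d "reaction p lam c" "potential p lam c" v Y by fact
    have C': "1 \<le> c" "lam \<le> c" "2 * K\<^sup>2 / \<rho> \<le> c" "(2 * \<kappa> + 1) / (b * d) \<le> c"
      using C unfolding C_def by auto
    have energy_nonneg: "energy r \<ge> 0" for r
      unfolding energy_def by (intro add_nonneg_nonneg kinetic_nonneg F_nonneg)
    have half: "v r0 \<ge> 1 / 2"
    proof -
      obtain z where z: "0 < z" "v r0 - v 0 = (r0 - 0) * slope d (z * Y z)"
        using mean_value[of 0 r0 v "\<lambda>r. slope d (r * Y r)"] r0 v_deriv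
          continuous_on_subset[OF v_cont, of "{0..r0}"] by auto
      have "d * slope d (z * Y z) \<ge> - 1" using abs_slope_less[of d "z * Y z"] by linarith
      then show ?thesis using z(2) v0 by (simp add: r0_def)
    qed
    have E0: "c * ((1 / 2) powr p / p) \<le> energy r0"
    proof -
      have "(1 / 2) powr p \<le> \<bar>v r0\<bar> powr p" using half p by (intro powr_mono2) auto
      then have "c / p * (1 / 2) powr p \<le> c / p * \<bar>v r0\<bar> powr p"
        using C'(1) p by (intro mult_left_mono) auto
      also have "\<dots> \<le> potential p lam c (v r0)" using lam by (simp add: potential_def)
      also have "\<dots> \<le> energy r0" using kinetic_nonneg by (simp add: energy_def)
      finally show ?thesis by simp
    qed
    have E: "\<rho> * c \<le> energy r" if r: "r0 \<le> r" "r \<le> R" for r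
    proof -
      have "r0 ^ M * (c * ((1 / 2) powr p / p)) \<le> r0 ^ M * energy r0"
        using r0 by (intro mult_left_mono E0) auto
      also have "\<dots> \<le> r ^ M * energy r" using energy_growth[of r0 r] r r0 by (simp add: M_def)
      also have "\<dots> \<le> R ^ M * energy r" using r r0 by (intro mult_right_mono power_mono energy_nonneg) auto
      finally have "r0 ^ M * (c * ((1 / 2) powr p / p)) / R ^ M \<le> energy r"
        using dR by (subst pos_divide_le_eq) (simp, simp only: mult.commute)
      then show ?thesis by (simp add: \<rho>_def power_divide mult_ac)
    qed
    have W: "r ^ N * Y r = r ^ (N - 1) * (r * Y r)" for r using N by (cases N) auto
    have turn: "\<bar>reaction p lam c (v r)\<bar> \<ge> c * s0 powr (p - 1)"
      if r: "r0 \<le> r" "r \<le> R" and w: "\<bar>r ^ N * Y r\<bar> < \<kappa>" for r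
    proof -
      have rp: "r > 0" "r ^ (N - 1) > 0" using r r0 by auto
      have "r0 ^ (N - 1) * \<bar>r * Y r\<bar> \<le> r ^ (N - 1) * \<bar>r * Y r\<bar>"
        using r r0 by (intro mult_right_mono power_mono) auto
      also have "\<dots> < \<kappa>" using w rp unfolding W by (simp add: abs_mult)
      finally have "\<bar>r * Y r\<bar> < K" using r0 dR unfolding K_def \<kappa>_def by (simp add: field_simps)
      then have "(r * Y r)\<^sup>2 \<le> K\<^sup>2" by (metis abs_ge_zero less_imp_le power2_abs power_mono)
      then have "kinetic d (r * Y r) \<le> K\<^sup>2" using kinetic_le[of d "r * Y r"] by linarith
      moreover have "2 * K\<^sup>2 \<le> \<rho> * c" using C'(3) \<rho> by (simp add: divide_le_eq mult.commute)
      ultimately have pot: "potential p lam c (v r) \<ge> \<rho> * c / 2"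
        using E[OF r] unfolding energy_def by linarith
      have v1: "\<bar>v r\<bar> \<le> 1" using v_bounded rp by simp
      have vp: "\<bar>v r\<bar> powr p \<le> \<bar>v r\<bar>"
        using powr_mono'[of 1 p "\<bar>v r\<bar>"] v1 p by (simp split: if_splits)
      have "(v r)\<^sup>2 \<le> \<bar>v r\<bar>" using v1 power_decreasing[of 1 2 "\<bar>v r\<bar>"] by simp
      then have "lam / 2 * (v r)\<^sup>2 + c / p * \<bar>v r\<bar> powr p \<le> c * \<bar>v r\<bar> + c * \<bar>v r\<bar>"
        using C' lam p vp by (intro add_mono mult_mono) (auto simp: divide_le_eq)
      then have "\<rho> * c / 2 \<le> 2 * c * \<bar>v r\<bar>" using pot unfolding potential_def by linarith
      then have s: "s0 \<le> \<bar>v r\<bar>" using C'(1) unfolding s0_def by (simp add: field_simps)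
      then have "\<bar>v r\<bar> > 0" using s0 by linarith
      have "s0 powr (p - 1) \<le> \<bar>v r\<bar> powr (p - 1)" using s s0 p by (intro powr_mono2) auto
      also have "\<dots> = \<bar>v r\<bar> powr (p - 2) * \<bar>v r\<bar>"
        using powr_add[of "\<bar>v r\<bar>" "p - 2" 1] \<open>\<bar>v r\<bar> > 0\<close> by simp
      finally have "c * s0 powr (p - 1) \<le> c * (\<bar>v r\<bar> powr (p - 2) * \<bar>v r\<bar>)"
        using C'(1) by (intro mult_left_mono) auto
      also have "\<dots> \<le> (lam + c * \<bar>v r\<bar> powr (p - 2)) * \<bar>v r\<bar>" using lam by (simp add: algebra_simps)
      also have "\<dots> = \<bar>(lam + c * \<bar>v r\<bar> powr (p - 2)) * v r\<bar>"
        using lam C'(1) by (simp add: abs_mult)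
      also have "(lam + c * \<bar>v r\<bar> powr (p - 2)) * v r = reaction p lam c (v r)"
        by (simp add: reaction_def algebra_simps)
      finally show ?thesis .
    qed
    show "\<exists>z\<in>{a..a + 5 * d}. v z = 0"
    proof (rule ccontr)
      assume "\<not> ?thesis"
      then have nz: "v r \<noteq> 0" if "r \<in> {a..a + 5 * d}" for r using that by blast
      have sub: "{a..a + 5 * d} \<subseteq> {0..}" using a dR by auto
      define \<sigma> where "\<sigma> = sgn (v a)"
      have \<sigma>: "\<sigma> = 1 \<or> \<sigma> = -1" using nz[of a] dR by (auto simp: \<sigma>_def sgn_if)
      have pos: "\<sigma> * v r > 0" if "r \<in> {a..a + 5 * d}" for r
      proof (rule positive_on_connected[of "{a..a + 5 * d}" "\<lambda>r. \<sigma> * v r" a])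
        show "continuous_on {a..a + 5 * d} (\<lambda>r. \<sigma> * v r)"
          by (intro continuous_on_mult_left continuous_on_subset[OF v_cont sub])
        show "\<sigma> * v a > 0" using nz[of a] dR unfolding \<sigma>_def by (auto simp: sgn_if)
      qed (use nz \<sigma> dR that in auto)
      have sf: "\<sigma> * reaction p lam c (v r) = \<bar>reaction p lam c (v r)\<bar>" if "r \<in> {a..a + 5 * d}" for r
        using pos[OF that] \<sigma> f_pos[of "v r"] f_neg[of "v r"] by auto
      show False
      proof (rule no_long_bump[where v = "\<lambda>r. \<sigma> * v r" and w = "\<lambda>r. \<sigma> * (r ^ N * Y r)" and d = d
            and \<kappa> = \<kappa> and B = "c * b" and a = a
            and v' = "\<lambda>r. \<sigma> * slope d (r * Y r)" and w' = "\<lambda>r. \<sigma> * - (r ^ (N - 1) * reaction p lam c (v r))"])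
        show "d > 0" by (rule dR)
        have "2 * \<kappa> + 1 \<le> c * (b * d)" using C'(4) b dR by (simp add: divide_le_eq)
        then show "c * b * d > 2 * \<kappa>" by (simp add: mult.assoc)
        show "continuous_on {a..a + 5 * d} (\<lambda>r. \<sigma> * v r)"
          by (intro continuous_on_mult_left continuous_on_subset[OF v_cont sub])
        show "continuous_on {a..a + 5 * d} (\<lambda>r. \<sigma> * (r ^ N * Y r))"
          by (intro continuous_on_mult_left continuous_on_subset[OF w_cont sub])
        fix r
        { assume "r \<in> {a..a + 5 * d}"
          then have "\<bar>v r\<bar> \<le> 1" using v_bounded sub by auto
          then show "0 < \<sigma> * v r \<and> \<sigma> * v r \<le> 1"
            using pos[OF \<open>r \<in> _\<close>] \<sigma> by (auto simp: abs_le_iff) }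
        assume r: "a < r" "r < a + 5 * d"
        then have r': "r > 0" "r0 \<le> r" "r \<le> R" "r \<in> {a..a + 5 * d}" using a dR by (auto simp: r0_def)
        show "((\<lambda>r. \<sigma> * v r) has_real_derivative \<sigma> * slope d (r * Y r)) (at r)"
          by (rule DERIV_cmult[OF v_deriv[OF r'(1)]])
        show "((\<lambda>r. \<sigma> * (r ^ N * Y r)) has_real_derivative \<sigma> * - (r ^ (N - 1) * reaction p lam c (v r))) (at r)"
          by (rule DERIV_cmult[OF w_deriv[OF r'(1)]])
        have eq: "\<sigma> * - (r ^ (N - 1) * reaction p lam c (v r)) = - (r ^ (N - 1) * \<bar>reaction p lam c (v r)\<bar>)"
          unfolding sf[OF r'(4), symmetric] by simp
        show "\<sigma> * - (r ^ (N - 1) * reaction p lam c (v r)) \<le> 0"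
          unfolding eq using r'(1) by simp
        have big: "slope d y \<ge> 1 / (2 * d)" if "\<kappa> \<le> r ^ (N - 1) * y" for y
        proof (rule slope_ge_half[OF dR(1)])
          have "r ^ (N - 1) * (1 / d) \<le> \<kappa>" unfolding \<kappa>_def using r' dR by (simp add: divide_le_cancel power_mono)
          then have "r ^ (N - 1) * (1 / d) \<le> r ^ (N - 1) * y" using that by linarith
          then show "1 / d \<le> y" using r'(1) by (simp add: mult_le_cancel_left_pos del: times_divide_eq_right)
        qed
        have sl: "slope d (\<sigma> * (r * Y r)) = \<sigma> * slope d (r * Y r)" using \<sigma> slope_minus[of d "r * Y r"] by auto
        show "\<sigma> * slope d (r * Y r) \<ge> 1 / (2 * d)" if "\<sigma> * (r ^ N * Y r) \<ge> \<kappa>"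
          using big[of "\<sigma> * (r * Y r)"] that unfolding W sl by (simp add: mult_ac)
        show "\<sigma> * slope d (r * Y r) \<le> - 1 / (2 * d)" if "\<sigma> * (r ^ N * Y r) \<le> - \<kappa>"
          using big[of "- (\<sigma> * (r * Y r))"] that unfolding W slope_minus sl by (simp add: mult_ac)
        show "\<sigma> * - (r ^ (N - 1) * reaction p lam c (v r)) \<le> - (c * b)" if w: "\<bar>\<sigma> * (r ^ N * Y r)\<bar> < \<kappa>"
        proof -
          have "\<bar>r ^ N * Y r\<bar> < \<kappa>" using w \<sigma> by auto
          then have "c * s0 powr (p - 1) \<le> \<bar>reaction p lam c (v r)\<bar>" by (rule turn[OF r'(2,3)])
          then have "r0 ^ (N - 1) * (c * s0 powr (p - 1)) \<le> r ^ (N - 1) * \<bar>reaction p lam c (v r)\<bar>"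
            using r' r0 C'(1) by (intro mult_mono power_mono) auto
          then show ?thesis unfolding eq b_def by (simp add: mult_ac)
        qed
      qed
    qed
  qed
qed

section \<open>Semicontinuity of the number of zeros\<close>

text \<open>Under a perturbation of \<open>d\<close>, simple zeros neither split nor disappear, except that a zero may
  cross the endpoint \<open>R\<close>. So the number of zeros in the open interval can only jump down at a limit,
  and the number in the closed interval can only jump up.\<close>

locale zero_family =
  fixes P :: "real set" and R :: real and v v' :: "real \<Rightarrow> real \<Rightarrow> real"
  assumes P: "compact P"
    and R: "R > 0"
    and v_cont2: "continuous_on (P \<times> {0..R}) (\<lambda>(d, r). v d r)"
    and v'_cont2: "continuous_on (P \<times> {0..R}) (\<lambda>(d, r). v' d r)"
    and v_der: "\<And>d r. d \<in> P \<Longrightarrow> 0 < r \<Longrightarrow> r \<le> R \<Longrightarrow> (v d has_real_derivative v' d r) (at r)"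
    and v_start: "\<And>d. d \<in> P \<Longrightarrow> v d 0 \<noteq> 0"
    and v_simple: "\<And>d r. d \<in> P \<Longrightarrow> 0 < r \<Longrightarrow> r \<le> R \<Longrightarrow> v d r = 0 \<Longrightarrow> v' d r \<noteq> 0"
    and v_finite: "\<And>d. d \<in> P \<Longrightarrow> finite {r \<in> {0..R}. v d r = 0}"
begin

definition inner_zeros :: "real \<Rightarrow> real set" where
  "inner_zeros d = {r \<in> {0<..<R}. v d r = 0}"

definition all_zeros :: "real \<Rightarrow> real set" where
  "all_zeros d = {r \<in> {0..R}. v d r = 0}"

definition isolates :: "real \<Rightarrow> real \<Rightarrow> real \<Rightarrow> bool" where
  "isolates z h e \<longleftrightarrow>
     (\<forall>x\<in>all_zeros e. \<forall>y\<in>all_zeros e. \<bar>x - z\<bar> < h \<and> \<bar>y - z\<bar> < h \<longrightarrow> x = y)"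

lemma cont_in_d: "r \<in> {0..R} \<Longrightarrow> continuous_on P (\<lambda>d. v d r)"
  using continuous_on_compose2[OF v_cont2, of P "\<lambda>d. (d, r)"]
  by (simp add: continuous_on_Pair image_subset_iff)

lemma cont_in_r: "d \<in> P \<Longrightarrow> continuous_on {0..R} (v d)"
  using continuous_on_compose2[OF v_cont2, of "{0..R}" "\<lambda>r. (d, r)"]
  by (simp add: continuous_on_Pair image_subset_iff)

text \<open>The sign change at a simple zero survives small perturbations.\<close>

lemma zero_persists:
  assumes d: "d \<in> P" and z: "z \<in> inner_zeros d" and \<epsilon>: "\<epsilon> > 0"
  shows "\<forall>\<^sub>F e in at d within P. \<exists>y\<in>inner_zeros e. \<bar>y - z\<bar> < \<epsilon>"
proof -
  have z': "0 < z" "z < R" "v d z = 0" using z by (auto simp: inner_zeros_def)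
  define h where "h = min \<epsilon> (min z (R - z))"
  have h: "h > 0" using \<epsilon> z' by (simp add: h_def)
  have D: "(v d has_real_derivative v' d z) (at z)" "v' d z \<noteq> 0"
    using v_der[OF d] v_simple[OF d] z' by auto
  obtain a b where ab: "z - h < a" "a < z" "z < b" "b < z + h" "v d a * v d b < 0"
  proof -
    define \<sigma> where "\<sigma> = sgn (v' d z)"
    have \<sigma>: "\<sigma> * v' d z > 0" "\<sigma> * \<sigma> = 1" using D(2) by (auto simp: \<sigma>_def sgn_if)
    note D\<sigma> = DERIV_cmult[OF D(1), of \<sigma>]
    obtain \<delta>1 where 1: "\<delta>1 > 0" "\<And>x. 0 < x \<Longrightarrow> x < \<delta>1 \<Longrightarrow> \<sigma> * v d (z - x) < \<sigma> * v d z"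
      using DERIV_pos_inc_left[OF D\<sigma> \<sigma>(1)] by blast
    obtain \<delta>2 where 2: "\<delta>2 > 0" "\<And>x. 0 < x \<Longrightarrow> x < \<delta>2 \<Longrightarrow> \<sigma> * v d z < \<sigma> * v d (z + x)"
      using DERIV_pos_inc_right[OF D\<sigma> \<sigma>(1)] by blast
    define x where "x = min h (min \<delta>1 \<delta>2) / 2"
    have x: "0 < x" "x < h" "x < \<delta>1" "x < \<delta>2" using h 1(1) 2(1) by (auto simp: x_def)
    have "\<sigma> * v d (z - x) < 0" "\<sigma> * v d (z + x) > 0"
      using 1(2)[OF x(1,3)] 2(2)[OF x(1,4)] z'(3) by auto
    then have "(\<sigma> * v d (z - x)) * (\<sigma> * v d (z + x)) < 0" by (rule mult_neg_pos)
    then have "v d (z - x) * v d (z + x) < 0" using \<sigma>(2) by (simp add: mult.left_commute mult.assoc[symmetric])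
    then show thesis using that[of "z - x" "z + x"] x by simp
  qed
  have in_R: "0 < a" "b < R" "a \<in> {0..R}" "b \<in> {0..R}" using ab h by (auto simp: h_def)
  have "continuous_on P (\<lambda>e. v e a * v e b)"
    using cont_in_d in_R by (intro continuous_intros) auto
  then have "((\<lambda>e. v e a * v e b) \<longlongrightarrow> v d a * v d b) (at d within P)" using d by (auto simp: continuous_on_def)
  then have "\<forall>\<^sub>F e in at d within P. v e a * v e b < 0" using ab(5) by (rule order_tendstoD)
  moreover have "\<forall>\<^sub>F e in at d within P. e \<in> P" by (simp add: eventually_at_filter)
  ultimately show ?thesis
  proof eventually_elim
    case (elim e)
    have c: "continuous_on {a..b} (v e)"
      using in_R by (intro continuous_on_subset[OF cont_in_r[OF elim(2)]]) auto
    have "\<exists>y. a \<le> y \<and> y \<le> b \<and> v e y = 0"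
    proof (cases "v e a < 0")
      case True
      then have "v e b > 0" using elim(1) by (simp add: mult_less_0_iff)
      then show ?thesis using IVT'[of "v e" a 0 b] True ab c by auto
    next
      case False
      then have "v e b < 0" "v e a > 0" using elim(1) by (auto simp: mult_less_0_iff)
      then show ?thesis using IVT2'[of "v e" b 0 a] ab c by auto
    qed
    then obtain y where "a \<le> y" "y \<le> b" "v e y = 0" by blast
    then show ?case using ab in_R by (intro bexI[of _ y]) (auto simp: inner_zeros_def h_def abs_less_iff)
  qed
qed

lemma finite_inner_zeros: "d \<in> P \<Longrightarrow> finite (inner_zeros d)"
  by (rule finite_subset[OF _ v_finite]) (auto simp: inner_zeros_def)

lemma finite_all_zeros: "d \<in> P \<Longrightarrow> finite (all_zeros d)"
  using v_finite by (simp add: all_zeros_def)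

text \<open>Disjoint windows around the zeros keep the persisting zeros apart.\<close>

lemma inner_zeros_count_lower:
  assumes d: "d \<in> P"
  shows "\<forall>\<^sub>F e in at d within P. card (inner_zeros d) \<le> card (inner_zeros e)"
proof -
  let ?Z = "inner_zeros d"
  have fin: "finite ?Z" by (rule finite_inner_zeros[OF d])
  define S where "S = insert 1 ((\<lambda>(x, y). \<bar>x - y\<bar>) ` {(x, y) \<in> ?Z \<times> ?Z. x \<noteq> y})"
  have S: "finite S" "S \<noteq> {}" "\<And>s. s \<in> S \<Longrightarrow> s > 0"
    unfolding S_def using fin by (auto intro: finite_subset[of _ "?Z \<times> ?Z"])
  define \<epsilon> where "\<epsilon> = Min S / 2"
  have \<epsilon>: "\<epsilon> > 0" using Min_in[OF S(1,2)] S(3) by (simp add: \<epsilon>_def)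
  have sep: "x = y" if "x \<in> ?Z" "y \<in> ?Z" "\<bar>x - y\<bar> < 2 * \<epsilon>" for x y
  proof (rule ccontr)
    assume "x \<noteq> y"
    then have "\<bar>x - y\<bar> \<in> S" using that by (auto simp: S_def)
    then have "Min S \<le> \<bar>x - y\<bar>" using S(1) by simp
    then show False using that(3) by (simp add: \<epsilon>_def)
  qed
  have "\<forall>\<^sub>F e in at d within P. \<forall>z\<in>?Z. \<exists>y\<in>inner_zeros e. \<bar>y - z\<bar> < \<epsilon>"
    using zero_persists[OF d _ \<epsilon>] by (intro eventually_ball_finite fin) auto
  moreover have "\<forall>\<^sub>F e in at d within P. e \<in> P" by (simp add: eventually_at_filter)
  ultimately show ?thesis
  proof eventually_elim
    case (elim e)
    then obtain g where g: "\<And>z. z \<in> ?Z \<Longrightarrow> g z \<in> inner_zeros e \<and> \<bar>g z - z\<bar> < \<epsilon>" by metis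
    have "inj_on g ?Z"
    proof (rule inj_onI)
      fix x y assume xy: "x \<in> ?Z" "y \<in> ?Z" "g x = g y"
      then show "x = y" using g[of x] g[of y] by (intro sep) auto
    qed
    then show ?case using g by (intro card_inj_on_le[OF _ _ finite_inner_zeros[OF elim(2)]]) auto
  qed
qed

text \<open>By Rolle, two zeros close to \<open>z\<close> would produce a zero of the derivative close to a simple zero.\<close>

lemma zero_unique_nearby:
  assumes d: "d \<in> P" and z: "z \<in> all_zeros d"
  obtains h where "h > 0"
    "\<forall>\<^sub>F e in at d within P. isolates z h e"
proof -
  have z': "0 < z" "z \<le> R" "v d z = 0" using z v_start[OF d] by (cases "z = 0"; auto simp: all_zeros_def)+
  have "v' d z \<noteq> 0" using v_simple[OF d] z' by auto
  have "((\<lambda>(e, r). v' e r) \<longlongrightarrow> v' d z) (at (d, z) within P \<times> {0..R})"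
    using v'_cont2 d z' by (auto simp: continuous_on_def)
  then have "\<forall>\<^sub>F q in at (d, z) within P \<times> {0..R}. (\<lambda>(e, r). v' e r) q \<noteq> 0"
    using \<open>v' d z \<noteq> 0\<close> by (rule tendsto_imp_eventually_ne)
  then obtain \<delta> where \<delta>: "\<delta> > 0"
    "\<And>q. q \<in> P \<times> {0..R} \<Longrightarrow> q \<noteq> (d, z) \<Longrightarrow> dist q (d, z) < \<delta> \<Longrightarrow> (\<lambda>(e, r). v' e r) q \<noteq> 0"
    unfolding eventually_at by blast
  have nz: "v' e r \<noteq> 0" if "e \<in> P" "r \<in> {0..R}" "\<bar>e - d\<bar> < \<delta> / 2" "\<bar>r - z\<bar> < \<delta> / 2" for e r
  proof (cases "(e, r) = (d, z)")
    case False
    have "dist (e, r) (d, z) \<le> \<bar>e - d\<bar> + \<bar>r - z\<bar>"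
      by (simp add: dist_Pair_Pair dist_real_def sqrt_sum_squares_le_sum_abs[of "e - d" "r - z", simplified])
    then show ?thesis using \<delta>(2)[of "(e, r)"] that False by auto
  qed (use \<open>v' d z \<noteq> 0\<close> in auto)
  show thesis
  proof (rule that[of "\<delta> / 2"])
    show "\<delta> / 2 > 0" using \<delta> by simp
    have "\<forall>\<^sub>F e in at d within P. e \<in> P \<and> \<bar>e - d\<bar> < \<delta> / 2"
      unfolding eventually_at using \<delta>(1) by (intro exI[of _ "\<delta> / 2"]) (auto simp: dist_real_def)
    then show "\<forall>\<^sub>F e in at d within P. isolates z (\<delta> / 2) e"
    proof eventually_elim
      case (elim e)
      have False if x: "x \<in> all_zeros e" "\<bar>x - z\<bar> < \<delta> / 2" and y: "y \<in> all_zeros e" "\<bar>y - z\<bar> < \<delta> / 2"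
        and "x < y" for x y
      proof -
        have eP: "e \<in> P" using elim by blast
        have R': "0 \<le> x" "y \<le> R" "v e x = 0" "v e y = 0" using x y by (auto simp: all_zeros_def)
        have "continuous_on {x..y} (v e)" using R' by (intro continuous_on_subset[OF cont_in_r[OF eP]]) auto
        moreover have "v e differentiable (at t)" if "x < t" "t < y" for t
          using v_der[OF eP, of t] that R' real_differentiable_def by fastforce
        ultimately obtain t where t: "x < t" "t < y" "DERIV (v e) t :> 0"
          using Rolle[of x y "v e"] \<open>x < y\<close> R' by auto
        then have "v' e t = 0" using DERIV_unique[OF v_der[OF eP, of t] t(3)] R' by auto
        moreover have "\<bar>t - z\<bar> < \<delta> / 2" using x(2) y(2) t(1,2) by (simp only: abs_less_iff) linarith
        ultimately show False using nz[OF eP, of t] elim t R' by auto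
      qed
      then show ?case unfolding isolates_def by (metis linorder_neqE)
    qed
  qed
qed

text \<open>Every zero of a nearby function lies in one of the windows provided by \<open>zero_unique_nearby\<close>,
  because the absolute value of \<open>v d\<close> has a positive minimum on the compact rest of the interval.\<close>

lemma all_zeros_count_upper:
  assumes d: "d \<in> P"
  shows "\<forall>\<^sub>F e in at d within P. card (all_zeros e) \<le> card (all_zeros d)"
proof -
  let ?Z = "all_zeros d"
  have fin: "finite ?Z" by (rule finite_all_zeros[OF d])
  have "\<exists>h>0. \<forall>\<^sub>F e in at d within P. isolates z h e" if "z \<in> ?Z" for z
    by (rule zero_unique_nearby[OF d that]) blast
  then have "\<forall>z\<in>?Z. \<exists>h. h > 0 \<and> (\<forall>\<^sub>F e in at d within P. isolates z h e)" by blast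
  from bchoice[OF this] obtain h where h: "\<And>z. z \<in> ?Z \<Longrightarrow> h z > 0"
    "\<And>z. z \<in> ?Z \<Longrightarrow> \<forall>\<^sub>F e in at d within P. isolates z (h z) e"
    by blast
  have near: "\<forall>\<^sub>F e in at d within P. \<forall>z\<in>?Z. isolates z (h z) e"
    using h(2) by (intro eventually_ball_finite fin) auto
  define K where "K = {0..R} - (\<Union>z\<in>?Z. ball z (h z))"
  have "compact K" unfolding K_def by (intro compact_diff) auto
  have far: "\<forall>\<^sub>F e in at d within P. \<forall>y\<in>K. v e y \<noteq> 0"
  proof (cases "K = {}")
    case False
    have nzK: "v d y \<noteq> 0" if "y \<in> K" for y
    proof
      assume "v d y = 0"
      then have "y \<in> ?Z" using that by (auto simp: K_def all_zeros_def)
      then show False using that h(1)[of y] unfolding K_def by force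
    qed
    have "continuous_on K (\<lambda>y. \<bar>v d y\<bar>)"
      by (intro continuous_intros continuous_on_subset[OF cont_in_r[OF d]]) (auto simp: K_def)
    then obtain y0 where y0: "y0 \<in> K" "\<And>y. y \<in> K \<Longrightarrow> \<bar>v d y0\<bar> \<le> \<bar>v d y\<bar>"
      using continuous_attains_inf[OF \<open>compact K\<close> False] by blast
    have pos: "\<bar>v d y0\<bar> > 0" using nzK[OF y0(1)] by simp
    have "uniformly_continuous_on (P \<times> {0..R}) (\<lambda>(e, r). v e r)"
      by (intro compact_uniformly_continuous v_cont2 compact_Times P) auto
    then obtain \<delta> where \<delta>: "\<delta> > 0" "\<And>q q'. q \<in> P \<times> {0..R} \<Longrightarrow> q' \<in> P \<times> {0..R} \<Longrightarrow> dist q' q < \<delta> \<Longrightarrow>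
        dist ((\<lambda>(e, r). v e r) q') ((\<lambda>(e, r). v e r) q) < \<bar>v d y0\<bar>"
      using pos unfolding uniformly_continuous_on_def by meson
    have "\<forall>\<^sub>F e in at d within P. e \<in> P \<and> dist e d < \<delta>"
      unfolding eventually_at using \<delta>(1) by (intro exI[of _ \<delta>]) auto
    then show ?thesis
    proof eventually_elim
      case (elim e)
      show ?case
      proof
        fix y assume y: "y \<in> K"
        then have "dist (v e y) (v d y) < \<bar>v d y0\<bar>"
          using \<delta>(2)[of "(d, y)" "(e, y)"] elim d by (auto simp: K_def dist_Pair_Pair)
        then show "v e y \<noteq> 0" using y0(2)[OF y] by (auto simp: dist_real_def)
      qed
    qed
  qed simp
  have "\<forall>\<^sub>F e in at d within P. e \<in> P" by (simp add: eventually_at_filter)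
  with near far show ?thesis
  proof eventually_elim
    case (elim e)
    have "\<exists>z\<in>?Z. \<bar>y - z\<bar> < h z" if "y \<in> all_zeros e" for y
    proof (rule ccontr)
      assume "\<not> ?thesis"
      then have "y \<in> K" using that by (auto simp: K_def all_zeros_def dist_real_def abs_minus_commute)
      then show False using elim(2) that by (auto simp: all_zeros_def)
    qed
    then have "\<forall>y\<in>all_zeros e. \<exists>z. z \<in> ?Z \<and> \<bar>y - z\<bar> < h z" by blast
    from bchoice[OF this] obtain g where g: "\<And>y. y \<in> all_zeros e \<Longrightarrow> g y \<in> ?Z \<and> \<bar>y - g y\<bar> < h (g y)" by blast
    have "inj_on g (all_zeros e)"
    proof (rule inj_onI)
      fix x y assume xy: "x \<in> all_zeros e" "y \<in> all_zeros e" "g x = g y"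
      then show "x = y" using g[of x] g[of y] elim(1) by (auto simp: isolates_def)
    qed
    then show ?case using g fin by (intro card_inj_on_le[of g]) auto
  qed
qed

lemma all_zeros_eq: "d \<in> P \<Longrightarrow> all_zeros d = inner_zeros d \<union> (if v d R = 0 then {R} else {})"
  using v_start[of d] R unfolding all_zeros_def inner_zeros_def
  by (auto simp: order.strict_iff_order)

lemma card_all_zeros:
  assumes "d \<in> P"
  shows "card (all_zeros d) = card (inner_zeros d) + (if v d R = 0 then 1 else 0)"
proof -
  have "R \<notin> inner_zeros d" by (simp add: inner_zeros_def)
  then show ?thesis unfolding all_zeros_eq[OF assms] using finite_inner_zeros[OF assms] by simp
qed

end

section \<open>Selecting amplitudes by the number of zeros\<close>

text \<open>At the infimum \<open>D\<close> of the amplitudes with \<open>m d < l\<close>, lower semicontinuity of \<open>m\<close> gives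
  \<open>m D < l\<close>, and upper semicontinuity of \<open>n\<close>, applied from the left, gives \<open>l \<le> n D\<close>. As
  \<open>n D \<le> m D + 1\<close>, both values are determined.\<close>

lemma first_drop:
  fixes m n :: "real \<Rightarrow> nat"
  assumes ab: "a \<le> b" and ma: "l \<le> m a" and mb: "m b < l"
    and lower: "\<And>d. d \<in> {a..b} \<Longrightarrow> \<exists>\<delta>>0. \<forall>e\<in>{a..b}. \<bar>e - d\<bar> < \<delta> \<longrightarrow> m d \<le> m e"
    and upper: "\<And>d. d \<in> {a..b} \<Longrightarrow> \<exists>\<delta>>0. \<forall>e\<in>{a..b}. \<bar>e - d\<bar> < \<delta> \<longrightarrow> n e \<le> n d"
    and mn: "\<And>d. d \<in> {a..b} \<Longrightarrow> m d \<le> n d \<and> n d \<le> m d + 1"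
  obtains D where "a < D" "D \<le> b" "m D = l - 1" "n D = l" "\<And>d. a \<le> d \<Longrightarrow> d < D \<Longrightarrow> l \<le> m d"
proof -
  define B where "B = {d \<in> {a..b}. m d < l}"
  define D where "D = Inf B"
  have B: "b \<in> B" "bdd_below B" using ab mb by (auto simp: B_def intro: bdd_belowI[of _ a])
  then have aD: "a \<le> D" "D \<le> b" unfolding D_def by (auto intro!: cInf_greatest cInf_lower simp: B_def)
  have before: "l \<le> m d" if "a \<le> d" "d < D" for d
  proof (rule ccontr)
    assume "\<not> l \<le> m d"
    then have "d \<in> B" using that aD by (simp add: B_def)
    then show False using cInf_lower[OF _ B(2)] that(2) unfolding D_def by fastforce
  qed
  have D: "m D < l"
  proof (rule ccontr)
    assume c: "\<not> m D < l"
    obtain \<delta> where \<delta>: "\<delta> > 0" "\<And>e. e \<in> {a..b} \<Longrightarrow> \<bar>e - D\<bar> < \<delta> \<Longrightarrow> m D \<le> m e"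
      using lower[of D] aD by auto
    have "D + \<delta> \<le> Inf B"
    proof (rule cInf_greatest)
      fix x assume x: "x \<in> B"
      then have "D \<le> x" using cInf_lower[OF x B(2)] by (simp add: D_def)
      then show "D + \<delta> \<le> x" using \<delta>(2)[of x] x c by (force simp: B_def)
    qed (use B in auto)
    then show False using \<delta>(1) by (simp add: D_def)
  qed
  have "a \<noteq> D" using D ma by auto
  then have "a < D" using aD by simp
  obtain \<delta> where \<delta>: "\<delta> > 0" "\<And>e. e \<in> {a..b} \<Longrightarrow> \<bar>e - D\<bar> < \<delta> \<Longrightarrow> n e \<le> n D"
    using upper[of D] aD by auto
  define e where "e = max a (D - \<delta> / 2)"
  have e: "e \<in> {a..b}" "\<bar>e - D\<bar> < \<delta>" "e < D" using \<open>a < D\<close> aD \<delta>(1) by (auto simp: e_def max_def)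
  have "l \<le> n D" using before[of e] \<delta>(2)[OF e(1,2)] mn[OF e(1)] e by auto
  then show thesis using that[of D] \<open>a < D\<close> aD D mn[of D] before by auto
qed

text \<open>The mirror image of \<open>first_drop\<close> under \<open>d \<mapsto> - d\<close>.\<close>

lemma last_rise:
  fixes m n :: "real \<Rightarrow> nat"
  assumes ab: "a \<le> b" and ma: "m a < l" and mb: "l \<le> m b"
    and lower: "\<And>d. d \<in> {a..b} \<Longrightarrow> \<exists>\<delta>>0. \<forall>e\<in>{a..b}. \<bar>e - d\<bar> < \<delta> \<longrightarrow> m d \<le> m e"
    and upper: "\<And>d. d \<in> {a..b} \<Longrightarrow> \<exists>\<delta>>0. \<forall>e\<in>{a..b}. \<bar>e - d\<bar> < \<delta> \<longrightarrow> n e \<le> n d"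
    and mn: "\<And>d. d \<in> {a..b} \<Longrightarrow> m d \<le> n d \<and> n d \<le> m d + 1"
  obtains D where "a \<le> D" "D < b" "m D = l - 1" "n D = l" "\<And>d. D < d \<Longrightarrow> d \<le> b \<Longrightarrow> l \<le> m d"
proof -
  have mirror: "\<exists>\<delta>>0. \<forall>e\<in>{- b..- a}. \<bar>e - d\<bar> < \<delta> \<longrightarrow> Q (- d) (- e)"
    if d: "d \<in> {- b..- a}" and Q: "\<And>d. d \<in> {a..b} \<Longrightarrow> \<exists>\<delta>>0. \<forall>e\<in>{a..b}. \<bar>e - d\<bar> < \<delta> \<longrightarrow> Q d e" for d and Q :: "real \<Rightarrow> real \<Rightarrow> bool"
  proof -
    obtain \<delta> where \<delta>: "\<delta> > 0" "\<And>e. e \<in> {a..b} \<Longrightarrow> \<bar>e - (- d)\<bar> < \<delta> \<Longrightarrow> Q (- d) e"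
      using Q[of "- d"] d by auto
    have "Q (- d) (- e)" if "e \<in> {- b..- a}" "\<bar>e - d\<bar> < \<delta>" for e
      using \<delta>(2)[of "- e"] that by auto
    then show ?thesis using \<delta>(1) by blast
  qed
  obtain D where D: "- b < D" "D \<le> - a" "m (- D) = l - 1" "n (- D) = l"
    "\<And>d. - b \<le> d \<Longrightarrow> d < D \<Longrightarrow> l \<le> m (- d)"
  proof (rule first_drop[of "- b" "- a" l "\<lambda>d. m (- d)" "\<lambda>d. n (- d)"])
    show "\<exists>\<delta>>0. \<forall>e\<in>{- b..- a}. \<bar>e - d\<bar> < \<delta> \<longrightarrow> m (- d) \<le> m (- e)" if "d \<in> {- b..- a}" for d
      by (rule mirror[OF that lower])
    show "\<exists>\<delta>>0. \<forall>e\<in>{- b..- a}. \<bar>e - d\<bar> < \<delta> \<longrightarrow> n (- e) \<le> n (- d)" if "d \<in> {- b..- a}" for d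
      by (rule mirror[OF that, of "\<lambda>d e. n e \<le> n d", OF upper])
  qed (use ab ma mb mn in auto)
  show thesis
    by (rule that[of "- D"]) (use D(1,2,3,4) D(5)[of "- d" for d] in \<open>auto simp: minus_less_iff less_minus_iff\<close>)
qed

text \<open>The amplitudes \<open>L l\<close> are first drops to the right of \<open>d0\<close> and the amplitudes \<open>S l\<close> are last rises
  to its left. They are ordered because \<open>m\<close> stays at least \<open>l'\<close> between \<open>d0\<close> and the amplitude
  of index \<open>l'\<close>, whereas it is smaller than \<open>l'\<close> at the amplitude of any index \<open>l < l'\<close>.\<close>

lemma solution_ladder:
  fixes m n :: "real \<Rightarrow> nat"
  assumes d0: "0 < d0" "d0 < b" and j: "j \<le> m d0" and k: "n 0 \<le> k" and nb: "n b = 0"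
    and lower: "\<And>d. d \<in> {0..b} \<Longrightarrow> \<exists>\<delta>>0. \<forall>e\<in>{0..b}. \<bar>e - d\<bar> < \<delta> \<longrightarrow> m d \<le> m e"
    and upper: "\<And>d. d \<in> {0..b} \<Longrightarrow> \<exists>\<delta>>0. \<forall>e\<in>{0..b}. \<bar>e - d\<bar> < \<delta> \<longrightarrow> n e \<le> n d"
    and mn: "\<And>d. d \<in> {0..b} \<Longrightarrow> m d \<le> n d \<and> n d \<le> m d + 1"
  obtains S L :: "nat \<Rightarrow> real" where
    "\<And>l. l \<in> {k + 1..j} \<Longrightarrow> 0 < S l \<and> S l < d0 \<and> m (S l) = l - 1 \<and> n (S l) = l"
    "\<And>l. l \<in> {1..j} \<Longrightarrow> d0 < L l \<and> L l < b \<and> m (L l) = l - 1 \<and> n (L l) = l"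
    "\<And>l l'. l \<in> {k + 1..j} \<Longrightarrow> l' \<in> {k + 1..j} \<Longrightarrow> l < l' \<Longrightarrow> S l < S l'"
    "\<And>l l'. l \<in> {1..j} \<Longrightarrow> l' \<in> {1..j} \<Longrightarrow> l < l' \<Longrightarrow> L l' < L l"
proof -
  have sub: "\<exists>\<delta>>0. \<forall>e\<in>A. \<bar>e - d\<bar> < \<delta> \<longrightarrow> Q e" if "\<exists>\<delta>>0. \<forall>e\<in>{0..b}. \<bar>e - d\<bar> < \<delta> \<longrightarrow> Q e" "A \<subseteq> {0..b}"
    for A d and Q :: "real \<Rightarrow> bool" using that by blast
  have mb: "m b = 0" using mn[of b] nb d0 by simp
  have m0: "m 0 \<le> k" using mn[of 0] k d0 by simp
  have "\<exists>D. d0 < D \<and> D \<le> b \<and> m D = l - 1 \<and> n D = l \<and> (\<forall>d. d0 \<le> d \<longrightarrow> d < D \<longrightarrow> l \<le> m d)"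
    if "l \<in> {1..j}" for l
    by (rule first_drop[of d0 b l m n]) (use that d0 j mb sub[OF lower] sub[OF upper] mn in auto)
  then obtain L where L: "\<And>l. l \<in> {1..j} \<Longrightarrow> d0 < L l \<and> L l \<le> b \<and> m (L l) = l - 1 \<and> n (L l) = l"
    "\<And>l d. l \<in> {1..j} \<Longrightarrow> d0 \<le> d \<Longrightarrow> d < L l \<Longrightarrow> l \<le> m d"
    by metis
  have "\<exists>D. 0 \<le> D \<and> D < d0 \<and> m D = l - 1 \<and> n D = l \<and> (\<forall>d. D < d \<longrightarrow> d \<le> d0 \<longrightarrow> l \<le> m d)"
    if "l \<in> {k + 1..j}" for l
    by (rule last_rise[of 0 d0 m l n]) (use that d0 j m0 sub[OF lower] sub[OF upper] mn in auto)
  then obtain S where S: "\<And>l. l \<in> {k + 1..j} \<Longrightarrow> 0 \<le> S l \<and> S l < d0 \<and> m (S l) = l - 1 \<and> n (S l) = l"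
    "\<And>l d. l \<in> {k + 1..j} \<Longrightarrow> S l < d \<Longrightarrow> d \<le> d0 \<Longrightarrow> l \<le> m d"
    by metis
  show thesis
  proof (rule that[of S L])
    show "0 < S l \<and> S l < d0 \<and> m (S l) = l - 1 \<and> n (S l) = l" if "l \<in> {k + 1..j}" for l
    proof -
      have "S l \<noteq> 0" using S(1)[OF that] that k by auto
      then show ?thesis using S(1)[OF that] by auto
    qed
    show "d0 < L l \<and> L l < b \<and> m (L l) = l - 1 \<and> n (L l) = l" if "l \<in> {1..j}" for l
    proof -
      have "L l \<noteq> b" using L(1)[OF that] that nb by auto
      then show ?thesis using L(1)[OF that] by auto
    qed
    show "S l < S l'" if l: "l \<in> {k + 1..j}" "l' \<in> {k + 1..j}" "l < l'" for l l'
    proof (rule ccontr)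
      assume c: "\<not> S l < S l'"
      show False
      proof (cases "S l = S l'")
        case True
        then show False using S(1)[OF l(1)] S(1)[OF l(2)] l by auto
      next
        case False
        then have "l' \<le> m (S l)" using S(2)[OF l(2), of "S l"] S(1)[OF l(1)] c by auto
        then show False using S(1)[OF l(1)] l by auto
      qed
    qed
    show "L l' < L l" if l: "l \<in> {1..j}" "l' \<in> {1..j}" "l < l'" for l l'
    proof (rule ccontr)
      assume c: "\<not> L l' < L l"
      show False
      proof (cases "L l = L l'")
        case True
        then show False using L(1)[OF l(1)] L(1)[OF l(2)] l by auto
      next
        case False
        then have "l' \<le> m (L l)" using L(2)[OF l(2), of "L l"] L(1)[OF l(1)] c by auto
        then show False using L(1)[OF l(1)] l by auto
      qed
    qed
  qed
qed

section \<open>Differential operators on radial functions\<close>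

lemma gderiv_radial:
  fixes x :: "'a::euclidean_space"
  assumes "x \<noteq> 0" "(u has_real_derivative D) (at (norm x))"
  shows "GDERIV (\<lambda>x. u (norm x)) x :> (D / norm x) *\<^sub>R x"
proof -
  have "GDERIV (\<lambda>x. u (norm x)) x :> D *\<^sub>R sgn x"
    by (rule GDERIV_DERIV_compose[OF GDERIV_norm[OF assms(1)] assms(2)])
  then show ?thesis by (simp add: sgn_div_norm divide_inverse)
qed

lemma gderiv_radial_origin:
  assumes "(u has_real_derivative 0) (at 0 within {0..})"
  shows "GDERIV (\<lambda>x::'a::euclidean_space. u (norm x)) 0 :> 0"
  unfolding gderiv_def has_derivative_at_alt
proof (intro conjI allI impI)
  fix e :: real assume "e > 0"
  then obtain d where d: "d > 0" "\<And>r. r \<in> {0..} \<Longrightarrow> norm (r - 0) < d \<Longrightarrow> norm (u r - u 0 - 0 * (r - 0)) \<le> e * norm (r - 0)"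
    using assms unfolding has_field_derivative_def has_derivative_within_alt by blast
  show "\<exists>d>0. \<forall>y::'a. norm (y - 0) < d \<longrightarrow> norm (u (norm y) - u (norm (0::'a)) - (y - 0) \<bullet> 0) \<le> e * norm (y - 0)"
    using d(1) d(2)[of "norm y" for y :: 'a] by (intro exI[of _ d]) auto
qed (simp add: inner_zero_right[abs_def])

lemma has_derivative_radial_field:
  fixes x :: "'a::euclidean_space"
  assumes "x \<noteq> 0" "(Q has_real_derivative D) (at (norm x))"
  shows "((\<lambda>x. Q (norm x) *\<^sub>R x) has_derivative
      (\<lambda>h. Q (norm x) *\<^sub>R h + (D / norm x * (h \<bullet> x)) *\<^sub>R x)) (at x)"
  using has_derivative_scaleR[OF gderiv_radial[OF assms, unfolded gderiv_def] has_derivative_ident] by simp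

lemma has_derivative_radial_field_origin:
  assumes "continuous (at 0 within {0..}) Q"
  shows "((\<lambda>x::'a::euclidean_space. Q (norm x) *\<^sub>R x) has_derivative (\<lambda>h. Q 0 *\<^sub>R h)) (at 0)"
  unfolding has_derivative_at_alt
proof (intro conjI allI impI)
  show "bounded_linear ((*\<^sub>R) (Q 0) :: 'a \<Rightarrow> 'a)" by (rule bounded_linear_scaleR_right)
  fix e :: real assume "e > 0"
  then obtain d where d: "d > 0" "\<And>r. r \<in> {0..} \<Longrightarrow> dist r 0 < d \<Longrightarrow> dist (Q r) (Q 0) < e"
    using assms unfolding continuous_within_eps_delta by blast
  show "\<exists>d>0. \<forall>y::'a. norm (y - 0) < d \<longrightarrow>
      norm (Q (norm y) *\<^sub>R y - Q (norm (0::'a)) *\<^sub>R 0 - Q 0 *\<^sub>R (y - 0)) \<le> e * norm (y - 0)"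
  proof (intro exI[of _ d] conjI d(1) allI impI)
    fix y :: 'a assume "norm (y - 0) < d"
    then have "\<bar>Q (norm y) - Q 0\<bar> \<le> e" using d(2)[of "norm y"] by (simp add: dist_real_def)
    then have "\<bar>Q (norm y) - Q 0\<bar> * norm y \<le> e * norm y" by (rule mult_right_mono) simp
    then show "norm (Q (norm y) *\<^sub>R y - Q (norm (0::'a)) *\<^sub>R 0 - Q 0 *\<^sub>R (y - 0)) \<le> e * norm (y - 0)"
      by (simp add: scaleR_diff_left[symmetric])
  qed
qed

lemma divergence_eq:
  assumes "(F has_derivative F') (at x)"
  shows "divergence F x = (\<Sum>b\<in>Basis. F' b \<bullet> b)"
  unfolding divergence_def using frechet_derivative_at[OF assms] by simp

lemma divergence_cong:
  fixes F G :: "'a::euclidean_space \<Rightarrow> 'a"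
  assumes "open S" "x \<in> S" "\<And>y. y \<in> S \<Longrightarrow> F y = G y" "(G has_derivative G') (at x)"
  shows "divergence F x = divergence G x"
proof -
  have "(F has_derivative G') (at x)"
    using has_derivative_transform_within_open[OF assms(4,1,2)] assms(3) by auto
  then show ?thesis using assms(4) by (simp add: divergence_eq)
qed

lemma divergence_radial_field:
  fixes x :: "'a::euclidean_space" and Q :: "real \<Rightarrow> real"
  assumes x: "x \<noteq> 0" and Q: "(Q has_real_derivative D) (at (norm x))"
  shows "divergence (\<lambda>x. Q (norm x) *\<^sub>R x) x = DIM('a) * Q (norm x) + norm x * D"
proof -
  define A where "A = D / norm x"
  have s: "(\<Sum>b\<in>Basis. (b \<bullet> x) * (x \<bullet> b)) = (norm x)\<^sup>2"
    unfolding power2_norm_eq_inner by (subst euclidean_inner[of x x]) (simp add: inner_commute)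
  have "divergence (\<lambda>x. Q (norm x) *\<^sub>R x) x
      = (\<Sum>b\<in>Basis. (Q (norm x) *\<^sub>R b + (A * (b \<bullet> x)) *\<^sub>R x) \<bullet> b)"
    unfolding A_def by (rule divergence_eq[OF has_derivative_radial_field[OF x Q]])
  also have "\<dots> = (\<Sum>b\<in>(Basis::'a set). Q (norm x) + A * ((b \<bullet> x) * (x \<bullet> b)))"
    by (intro sum.cong) (auto simp: inner_add_left)
  also have "\<dots> = DIM('a) * Q (norm x) + A * (norm x)\<^sup>2"
    by (simp only: sum.distrib sum_distrib_left[symmetric] s sum_constant)
  also have "A * (norm x)\<^sup>2 = norm x * D" using x by (simp add: A_def power2_eq_square)
  finally show ?thesis .
qed

text \<open>Here \<open>P r\<close> stands for \<open>r * Q' r\<close>. That it tends to \<open>0\<close> at the origin is what makes the field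
  \<open>Q (norm x) *\<^sub>R x\<close> continuously differentiable there.\<close>

locale radial_field =
  fixes R :: real and Q P :: "real \<Rightarrow> real"
  assumes Q_cont: "continuous_on {0..<R} Q" and P_cont: "continuous_on {0..<R} P" and P0: "P 0 = 0"
    and Q_deriv: "\<And>r. 0 < r \<Longrightarrow> r < R \<Longrightarrow> (Q has_real_derivative P r / r) (at r)"
begin

text \<open>At \<open>x = 0\<close> the division by zero makes the second summand vanish, as the derivative requires.\<close>

definition jacobian :: "'a::euclidean_space \<Rightarrow> 'a \<Rightarrow> 'a" where
  "jacobian x h = Q (norm x) *\<^sub>R h + (P (norm x) / (norm x)\<^sup>2 * (h \<bullet> x)) *\<^sub>R x"

lemma has_derivative_field:
  fixes x :: "'a::euclidean_space"
  assumes x: "x \<in> ball 0 R"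
  shows "((\<lambda>x. Q (norm x) *\<^sub>R x) has_derivative jacobian x) (at x)"
proof (cases "x = 0")
  case True
  have R: "R > 0" using x le_less_trans[OF norm_ge_zero, of x R] by auto
  have "at (0::real) within {0..<R} = at 0 within {0..}"
    by (rule at_within_nhd[of _ "{..<R}"]) (use R in auto)
  moreover have "continuous (at 0 within {0..<R}) Q"
    using Q_cont R by (auto simp: continuous_on_eq_continuous_within)
  ultimately have "continuous (at 0 within {0..}) Q" by simp
  from has_derivative_radial_field_origin[OF this, where 'a = 'a]
  show ?thesis using True by (simp add: jacobian_def[abs_def])
next
  case False
  then have "0 < norm x" "norm x < R" using x by auto
  from has_derivative_radial_field[OF False Q_deriv[OF this]]
  show ?thesis by (simp add: jacobian_def[abs_def] power2_eq_square)
qed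

lemma divergence_field:
  fixes x :: "'a::euclidean_space"
  assumes x: "x \<in> ball 0 R"
  shows "divergence (\<lambda>x. Q (norm x) *\<^sub>R x) x = DIM('a) * Q (norm x) + P (norm x)"
proof (cases "x = 0")
  case True
  have "divergence (\<lambda>x. Q (norm x) *\<^sub>R x) x = (\<Sum>b\<in>Basis. jacobian x b \<bullet> b)"
    by (rule divergence_eq[OF has_derivative_field[OF x]])
  then show ?thesis using True P0 by (simp add: jacobian_def)
next
  case False
  then have "0 < norm x" "norm x < R" using x by auto
  from divergence_radial_field[OF False Q_deriv[OF this]] show ?thesis using False by simp
qed

lemma continuous_field_coefficient:
  assumes "continuous_on {0..<R} q"
  shows "continuous_on (ball 0 R) (\<lambda>x::'a::euclidean_space. q (norm x))"
  by (rule continuous_on_compose2[OF assms]) (auto intro!: continuous_intros)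

text \<open>Near the origin the second summand is bounded by \<open>\<bar>P (norm x)\<bar> * norm i\<close>.\<close>

lemma continuous_jacobian:
  fixes i :: "'a::euclidean_space"
  shows "continuous_on (ball 0 R) (\<lambda>x. jacobian x i)"
proof -
  have "isCont (\<lambda>x. (P (norm x) / (norm x)\<^sup>2 * (i \<bullet> x)) *\<^sub>R x) x" if x: "x \<in> ball 0 R" for x
  proof (cases "x = 0")
    case True
    have "isCont (\<lambda>x::'a. P (norm x)) 0"
      using continuous_field_coefficient[OF P_cont] x True
      by (auto simp: continuous_on_eq_continuous_at)
    then have "((\<lambda>x::'a. \<bar>P (norm x)\<bar> * norm i) \<longlongrightarrow> \<bar>P (norm (0::'a))\<bar> * norm i) (at 0)"
      by (intro tendsto_intros) (simp add: isCont_def)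
    then have lim: "((\<lambda>x::'a. \<bar>P (norm x)\<bar> * norm i) \<longlongrightarrow> 0) (at 0)" using P0 by simp
    have le: "norm ((P (norm x) / (norm x)\<^sup>2 * (i \<bullet> x)) *\<^sub>R x) \<le> \<bar>P (norm x)\<bar> * norm i" for x :: 'a
    proof (cases "x = 0")
      case False
      have "norm ((P (norm x) / (norm x)\<^sup>2 * (i \<bullet> x)) *\<^sub>R x) = \<bar>P (norm x)\<bar> / norm x * \<bar>i \<bullet> x\<bar>"
        by (simp add: abs_mult power2_eq_square)
      also have "\<dots> \<le> \<bar>P (norm x)\<bar> / norm x * (norm i * norm x)"
        by (intro mult_left_mono Cauchy_Schwarz_ineq2) auto
      also have "\<dots> = \<bar>P (norm x)\<bar> * norm i" using False by simp
      finally show ?thesis .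
    qed simp
    have "((\<lambda>x. (P (norm x) / (norm x)\<^sup>2 * (i \<bullet> x)) *\<^sub>R x) \<longlongrightarrow> 0) (at 0)"
      by (rule Lim_null_comparison[OF always_eventually lim]) (use le in auto)
    then show ?thesis using True by (simp add: isCont_def)
  next
    case False
    have "isCont (\<lambda>x. P (norm x)) x"
      using continuous_field_coefficient[OF P_cont, where 'a = 'a] x
      by (auto simp: continuous_on_eq_continuous_at)
    then show ?thesis using False by (intro continuous_intros) auto
  qed
  then have "continuous_on (ball 0 R) (\<lambda>x. (P (norm x) / (norm x)\<^sup>2 * (i \<bullet> x)) *\<^sub>R x)"
    by (intro continuous_at_imp_continuous_on) blast
  moreover have "continuous_on (ball 0 R) (\<lambda>x::'a. Q (norm x) *\<^sub>R i)"
    by (rule continuous_on_scaleR[OF continuous_field_coefficient[OF Q_cont] continuous_on_const])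
  ultimately show ?thesis unfolding jacobian_def by (intro continuous_on_add)
qed

lemma C1_field: "C1_on (\<lambda>x::'a::euclidean_space. Q (norm x) *\<^sub>R x) (ball 0 R)"
proof -
  have bl: "bounded_linear (jacobian x)" for x :: 'a
    unfolding jacobian_def[abs_def]
    by (intro bounded_linear_intros bounded_linear_add bounded_linear_scaleR_right
        bounded_linear_scaleR_const bounded_linear_const_mult bounded_linear_inner_left)
  note app = bounded_linear_Blinfun_apply[OF bl]
  show ?thesis unfolding C1_on_def
  proof (intro exI[of _ "\<lambda>x. Blinfun (jacobian x)"] conjI ballI)
    show "((\<lambda>x::'a. Q (norm x) *\<^sub>R x) has_derivative blinfun_apply (Blinfun (jacobian x))) (at x)"
      if "x \<in> ball 0 R" for x :: 'a
      unfolding app by (rule has_derivative_field[OF that])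
    show "continuous_on (ball 0 R) (\<lambda>x::'a. Blinfun (jacobian x))"
      by (rule continuous_on_blinfun_componentwise) (simp add: app continuous_jacobian)
  qed
qed

end

lemma C1_on_imp_continuous_on:
  assumes "C1_on F S"
  shows "continuous_on S F"
proof -
  obtain F' where "\<And>x. x \<in> S \<Longrightarrow> (F has_derivative blinfun_apply (F' x)) (at x)"
    using assms unfolding C1_on_def by blast
  then show ?thesis
    by (intro continuous_at_imp_continuous_on) (blast intro: has_derivative_continuous)
qed

lemma C2_on_of_gradient:
  fixes u :: "'a::euclidean_space \<Rightarrow> real"
  assumes S: "open S" and grad: "\<And>x. x \<in> S \<Longrightarrow> GDERIV u x :> F x" and F: "C1_on F S"
  shows "C2_on u S"
  unfolding C2_on_def
proof
  show "C1_on u S" unfolding C1_on_def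
  proof (intro exI[of _ "\<lambda>x. blinfun_inner_left (F x)"] conjI ballI)
    show "(u has_derivative blinfun_apply (blinfun_inner_left (F x))) (at x)" if "x \<in> S" for x
      using grad[OF that] by (simp add: gderiv_def)
    show "continuous_on S (\<lambda>x. blinfun_inner_left (F x))"
      by (intro bounded_linear.continuous_on[OF bounded_linear_blinfun_inner_left] C1_on_imp_continuous_on F)
  qed
  have eq: "grad u x = F x" if "x \<in> S" for x using grad_eqI[OF grad[OF that]] .
  obtain F' where F': "\<And>x. x \<in> S \<Longrightarrow> (F has_derivative blinfun_apply (F' x)) (at x)" "continuous_on S F'"
    using F unfolding C1_on_def by blast
  have "(grad u has_derivative blinfun_apply (F' x)) (at x)" if "x \<in> S" for x
    by (rule has_derivative_transform_within_open[OF F'(1)[OF that] S that]) (simp add: eq)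
  then show "C1_on (grad u) S" unfolding C1_on_def using F'(2) by blast
qed

context radial_profile
begin

text \<open>The Lorentz factor \<open>1 / sqrt (1 - u'\<^sup>2)\<close> of \<open>u = d * v\<close>.\<close>

definition gamma :: "real \<Rightarrow> real" where
  "gamma r = sqrt (1 + (d * (r * Y r))\<^sup>2)"

text \<open>The product of \<open>r\<close> and the derivative of \<open>Y\<close>, that is, the function \<open>P\<close> for the field with \<open>Q = Y\<close>.\<close>

definition flux_radial :: "real \<Rightarrow> real" where
  "flux_radial r = - f (v r) - N * Y r"

text \<open>The function \<open>P\<close> for the field with \<open>Q r = Y r / gamma r\<close>, the gradient of \<open>v (norm x)\<close>.\<close>

definition grad_radial :: "real \<Rightarrow> real" where
  "grad_radial r = (flux_radial r + Y r) / gamma r ^ 3 - Y r / gamma r"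

lemma gamma_pos: "gamma r > 0" "gamma r \<noteq> 0"
  using sqrt_pos by (auto simp: gamma_def)

lemma gamma_cont: "continuous_on {0..} gamma"
  unfolding gamma_def by (intro continuous_intros Y_cont)

lemma f_v_cont: "continuous_on UNIV f \<Longrightarrow> continuous_on {0..} (\<lambda>r. f (v r))"
  by (rule continuous_on_compose2[OF _ v_cont]) auto

lemma slope_eq: "slope d (r * Y r) = r * (Y r / gamma r)"
  by (simp add: slope_def gamma_def)

lemma flux_field:
  assumes f: "continuous_on UNIV f"
  shows "radial_field R (\<lambda>r. c * Y r) (\<lambda>r. c * flux_radial r)"
proof
  have fr: "continuous_on {0..} flux_radial"
    unfolding flux_radial_def by (intro continuous_intros f_v_cont[OF f] Y_cont)
  show "continuous_on {0..<R} (\<lambda>r. c * Y r)" "continuous_on {0..<R} (\<lambda>r. c * flux_radial r)"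
    by (intro continuous_intros continuous_on_subset[OF Y_cont] continuous_on_subset[OF fr]; auto)+
  show "c * flux_radial 0 = 0" using N by (simp add: flux_radial_def v0 Y0)
  show "((\<lambda>r. c * Y r) has_real_derivative c * flux_radial r / r) (at r)" if "0 < r" for r
    using DERIV_cmult[OF Y_deriv[OF that], of c] by (simp add: flux_radial_def)
qed

lemma gradient_field:
  assumes f: "continuous_on UNIV f"
  shows "radial_field R (\<lambda>r. c * (Y r / gamma r)) (\<lambda>r. c * grad_radial r)"
proof
  have fr: "continuous_on {0..} grad_radial"
    unfolding grad_radial_def flux_radial_def
    by (intro continuous_intros f_v_cont[OF f] Y_cont gamma_cont) (auto simp: gamma_pos)
  have gr: "continuous_on {0..} (\<lambda>r. Y r / gamma r)"
    by (intro continuous_intros Y_cont gamma_cont) (auto simp: gamma_pos)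
  show "continuous_on {0..<R} (\<lambda>r. c * (Y r / gamma r))" "continuous_on {0..<R} (\<lambda>r. c * grad_radial r)"
    by (intro continuous_on_mult_left continuous_on_subset[OF gr] continuous_on_subset[OF fr]; auto)+
  show "c * grad_radial 0 = 0" using N by (simp add: grad_radial_def flux_radial_def v0 Y0 gamma_def)
  fix r :: real assume r: "0 < r"
  have "((\<lambda>r. slope d (r * Y r)) has_real_derivative 1 / gamma r ^ 3 * (flux_radial r + Y r)) (at r)"
    using DERIV_chain2[OF DERIV_slope y_deriv[OF r]]
    by (simp add: gamma_def flux_radial_def algebra_simps)
  from DERIV_divide[OF this DERIV_ident] r
  have "((\<lambda>r. slope d (r * Y r) / r) has_real_derivative
      (1 / gamma r ^ 3 * (flux_radial r + Y r) * r - slope d (r * Y r) * 1) / (r * r)) (at r)" by simp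
  moreover have "(1 / gamma r ^ 3 * (flux_radial r + Y r) * r - slope d (r * Y r) * 1) / (r * r) = grad_radial r / r"
    using r gamma_pos[of r] unfolding slope_eq grad_radial_def by (simp add: field_simps)
  ultimately have "((\<lambda>r. slope d (r * Y r) / r) has_real_derivative grad_radial r / r) (at r)"
    by (simp only:)
  then have "((\<lambda>r. Y r / gamma r) has_real_derivative grad_radial r / r) (at r)"
    by (rule has_field_derivative_transform_within_open[where S = "{0<..}"]) (use r in \<open>auto simp: slope_eq\<close>)
  from DERIV_cmult[OF this, of c]
  show "((\<lambda>r. c * (Y r / gamma r)) has_real_derivative c * grad_radial r / r) (at r)" by simp
qed

lemma gderiv_profile:
  "GDERIV (\<lambda>x::'a::euclidean_space. c * v (norm x)) x :> (c * (Y (norm x) / gamma (norm x))) *\<^sub>R x"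
proof (cases "x = 0")
  case True
  have "((\<lambda>r. c * v r) has_real_derivative c * slope d (0 * Y 0)) (at 0 within {0..})"
    by (rule DERIV_cmult[OF v_deriv0]) simp
  then have "((\<lambda>r. c * v r) has_real_derivative 0) (at 0 within {0..})" by simp
  from gderiv_radial_origin[OF this] show ?thesis using True by simp
next
  case False
  then have "norm x > 0" by simp
  from gderiv_radial[OF False DERIV_cmult[OF v_deriv[OF this], of c]]
  show ?thesis using False unfolding slope_eq by simp
qed

lemma C2_profile:
  assumes "continuous_on UNIV f"
  shows "C2_on (\<lambda>x::'a::euclidean_space. c * v (norm x)) (ball 0 R)"
  by (rule C2_on_of_gradient[OF open_ball gderiv_profile radial_field.C1_field[OF gradient_field[OF assms]]])

lemma continuous_profile: "continuous_on S (\<lambda>x::'a::euclidean_space. c * v (norm x))"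
  by (intro continuous_on_mult_left continuous_on_compose2[OF v_cont]) (auto intro!: continuous_intros)

end

section \<open>Profiles as solutions of the partial differential equations\<close>

lemma slope_flux: "d * slope d y / sqrt (1 - (d * slope d y)\<^sup>2) = d * y"
  and one_minus_slope_sq: "1 - (d * slope d y)\<^sup>2 = 1 / (1 + (d * y)\<^sup>2)"
proof -
  show eq: "1 - (d * slope d y)\<^sup>2 = 1 / (1 + (d * y)\<^sup>2)"
    using one_plus_sq_pos[of "d * y"] unfolding slope_def
    by (simp add: power_divide power_mult_distrib real_sqrt_pow2[OF less_imp_le] field_simps)
  show "d * slope d y / sqrt (1 - (d * slope d y)\<^sup>2) = d * y"
    unfolding eq using sqrt_pos[of "d * y"] by (simp add: slope_def real_sqrt_divide)
qed

context radial_profile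
begin

lemma solves_radial_ode_profile:
  assumes R: "R > 0" "v R = 0"
    and f: "\<And>r. 0 < r \<Longrightarrow> r < R \<Longrightarrow> d * f (v r) = reaction p lam \<mu> (d * v r)"
  shows "solves_radial_ode N R p lam \<mu> (\<lambda>r. d * v r)"
  unfolding solves_radial_ode_def
proof (intro exI[of _ "\<lambda>r. d * slope d (r * Y r)"] conjI ballI)
  have sc: "continuous_on UNIV (slope d)"
    by (rule DERIV_continuous_on[OF has_field_derivative_at_within[OF DERIV_slope]])
  have "continuous_on {0..R} (\<lambda>r. r * Y r)"
    by (intro continuous_intros continuous_on_subset[OF Y_cont]) auto
  then have "continuous_on {0..R} (\<lambda>r. slope d (r * Y r))"
    by (rule continuous_on_compose2[OF sc]) auto
  then show "continuous_on {0..R} (\<lambda>r. d * slope d (r * Y r))" by (rule continuous_on_mult_left)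
  show "((\<lambda>r. d * v r) has_real_derivative d * slope d (r * Y r)) (at r within {0..R})"
    if "r \<in> {0..R}" for r
    using that by (intro DERIV_cmult has_field_derivative_subset[OF v_deriv0]) auto
  show "\<bar>d * slope d (r * Y r)\<bar> < 1" for r by (rule abs_slope_less)
  show "((\<lambda>s. s ^ (N - 1) * (d * slope d (s * Y s) / sqrt (1 - (d * slope d (s * Y s))\<^sup>2)))
      has_real_derivative - (r ^ (N - 1) * reaction p lam \<mu> (d * v r))) (at r)"
    if r: "r \<in> {0<..<R}" for r
  proof -
    have "s ^ (N - 1) * (d * slope d (s * Y s) / sqrt (1 - (d * slope d (s * Y s))\<^sup>2)) = d * (s ^ N * Y s)" for s
      unfolding slope_flux using N by (cases N) auto
    moreover have "d * - (r ^ (N - 1) * f (v r)) = - (r ^ (N - 1) * reaction p lam \<mu> (d * v r))"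
      using f[of r] r by (simp add: mult.left_commute)
    ultimately show ?thesis using DERIV_cmult[OF w_deriv[of r], of d] r by (simp only: greaterThanLessThan_iff)
  qed
  show "d * slope d (0 * Y 0) = 0" "d * v R = 0" using R by auto
qed

lemma grad_profile:
  "grad (\<lambda>x::'a::euclidean_space. c * v (norm x)) x = (c * (Y (norm x) / gamma (norm x))) *\<^sub>R x"
  by (rule grad_eqI[OF gderiv_profile])

lemma norm_grad_profile: "norm (grad (\<lambda>x::'a::euclidean_space. d * v (norm x)) x) = \<bar>d * slope d (norm x * Y (norm x))\<bar>"
  unfolding grad_profile slope_eq by (simp add: abs_mult)

text \<open>The factor \<open>gamma\<close> cancels, so that the vector field in the equation is \<open>(d * Y (norm x)) *\<^sub>R x\<close>,
  whose divergence is linear in \<open>Y\<close>.\<close>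

lemma solves_P_profile:
  assumes dim: "N = DIM('a::euclidean_space)" and R: "R > 0" "v R = 0" and fc: "continuous_on UNIV f"
    and f: "\<And>r. 0 \<le> r \<Longrightarrow> r < R \<Longrightarrow> d * f (v r) = reaction p lam \<mu> (d * v r)"
  shows "solves_P R p lam \<mu> (\<lambda>x::'a. d * v (norm x))"
  unfolding solves_P_def
proof (intro conjI ballI)
  let ?u = "\<lambda>x::'a. d * v (norm x)"
  show "C2_on ?u (ball 0 R)" by (rule C2_profile[OF fc])
  show "continuous_on (cball 0 R) ?u" by (rule continuous_profile)
  have "continuous_on {0..} (\<lambda>r. d * (Y r / gamma r))"
    by (intro continuous_intros Y_cont gamma_cont) (auto simp: gamma_pos)
  then have "continuous_on (cball 0 R) (\<lambda>x::'a. d * (Y (norm x) / gamma (norm x)))"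
    by (rule continuous_on_compose2) (auto intro: continuous_intros)
  then have "continuous_on (cball 0 R) (grad ?u)"
    unfolding grad_profile[abs_def] by (intro continuous_on_scaleR continuous_on_id)
  moreover have "norm (grad ?u x) < 1" for x unfolding norm_grad_profile by (rule abs_slope_less)
  ultimately show "\<exists>g. continuous_on (cball 0 R) g \<and> (\<forall>x\<in>ball 0 R. g x = grad ?u x) \<and> (\<forall>x\<in>cball 0 R. norm (g x) < 1)"
    by blast
  show "?u x = 0" if "x \<in> sphere 0 R" for x using that R by simp
  fix x :: 'a assume x: "x \<in> ball 0 R"
  interpret flux: radial_field R "\<lambda>r. d * Y r" "\<lambda>r. d * flux_radial r" by (rule flux_field[OF fc])
  have "grad ?u y /\<^sub>R sqrt (1 - (norm (grad ?u y))\<^sup>2) = (d * Y (norm y)) *\<^sub>R y" for y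
  proof -
    have "sqrt (1 - (norm (grad ?u y))\<^sup>2) = 1 / gamma (norm y)"
      unfolding norm_grad_profile power2_abs one_minus_slope_sq by (simp add: gamma_def real_sqrt_divide)
    then show ?thesis unfolding grad_profile using gamma_pos[of "norm y"] by simp
  qed
  then have "divergence (\<lambda>y. grad ?u y /\<^sub>R sqrt (1 - (norm (grad ?u y))\<^sup>2)) x
      = DIM('a) * (d * Y (norm x)) + d * flux_radial (norm x)"
    using flux.divergence_field[OF x] by simp
  also have "\<dots> = - (d * f (v (norm x)))" 
    unfolding dim[symmetric] flux_radial_def by (simp add: algebra_simps)
  also have "\<dots> = - reaction p lam \<mu> (?u x)" using f[of "norm x"] x by simp
  finally show "- divergence (\<lambda>y. grad ?u y /\<^sub>R sqrt (1 - (norm (grad ?u y))\<^sup>2)) x = reaction p lam \<mu> (?u x)"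
    by simp
qed

lemma dirichlet_eigenfunction_profile:
  assumes dim: "N = DIM('a::euclidean_space)" and R: "R > 0" "v R = 0"
    and d0: "d = 0" and f: "f = (\<lambda>s. lam * s)"
  shows "dirichlet_eigenfunction R lam (\<lambda>x::'a. v (norm x))"
  unfolding dirichlet_eigenfunction_def
proof (intro conjI ballI)
  have fc: "continuous_on UNIV f" unfolding f by (intro continuous_intros)
  show "C2_on (\<lambda>x::'a. v (norm x)) (ball 0 R)" using C2_profile[OF fc, of 1 R, where 'a = 'a] by simp
  show "continuous_on (cball 0 R) (\<lambda>x::'a. v (norm x))" using continuous_profile[of _ 1, where 'a = 'a] by simp
  show "\<exists>x\<in>ball (0::'a) R. v (norm x) \<noteq> 0" using R v0 by (intro bexI[of _ 0]) auto
  show "v (norm x) = 0" if "x \<in> sphere 0 R" for x :: 'a using that R by simp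
  fix x :: 'a assume x: "x \<in> ball 0 R"
  interpret flux: radial_field R "\<lambda>r. 1 * Y r" "\<lambda>r. 1 * flux_radial r" by (rule flux_field[OF fc])
  have g1: "gamma r = 1" for r unfolding gamma_def using d0 by simp
  have "grad (\<lambda>x::'a. v (norm x)) = (\<lambda>y. (1 * Y (norm y)) *\<^sub>R y)"
    using grad_profile[of 1, where 'a = 'a] unfolding g1 by auto
  then have "laplacian (\<lambda>x::'a. v (norm x)) x = DIM('a) * (1 * Y (norm x)) + 1 * flux_radial (norm x)"
    unfolding laplacian_def using flux.divergence_field[OF x] by simp
  then show "- laplacian (\<lambda>x::'a. v (norm x)) x = lam * v (norm x)"
    unfolding dim[symmetric] flux_radial_def using f by simp
qed

end

lemma has_derivative_imp_gderiv:
  assumes "(u has_derivative L) (at (x::'a::euclidean_space))"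
  shows "GDERIV u x :> grad u x"
proof -
  interpret bounded_linear L by (rule has_derivative_bounded_linear[OF assms])
  have "L h = h \<bullet> (\<Sum>b\<in>Basis. L b *\<^sub>R b)" for h
  proof -
    have "L h = L (\<Sum>b\<in>Basis. (h \<bullet> b) *\<^sub>R b)" by (simp add: euclidean_representation)
    also have "\<dots> = (\<Sum>b\<in>Basis. (h \<bullet> b) * L b)" by (simp add: sum scaleR)
    also have "\<dots> = h \<bullet> (\<Sum>b\<in>Basis. L b *\<^sub>R b)" by (simp add: inner_sum_right mult.commute)
    finally show ?thesis .
  qed
  then have "GDERIV u x :> (\<Sum>b\<in>Basis. L b *\<^sub>R b)" using assms unfolding gderiv_def by (metis (no_types, lifting) ext)
  then show ?thesis using grad_eqI by metis
qed

text \<open>Restriction to a line through the origin. The restricted function is even, hence its derivative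
  \<open>\<beta>\<close> vanishes at \<open>0\<close>. Away from the origin the gradient is \<open>(\<beta> (norm x) / norm x) *\<^sub>R x\<close>, which
  reduces the Laplacian to an ordinary differential expression.\<close>

lemma radial_eigenfunction_ode:
  fixes v :: "real \<Rightarrow> real"
  assumes ef: "dirichlet_eigenfunction R lam (\<lambda>x::'a::euclidean_space. v (norm x))" and R: "R > 0"
  obtains \<beta> where "continuous_on {0..<R} \<beta>" "\<beta> 0 = 0"
    "\<And>r. 0 < r \<Longrightarrow> r < R \<Longrightarrow> (v has_real_derivative \<beta> r) (at r)"
    "\<And>r. 0 < r \<Longrightarrow> r < R \<Longrightarrow> (\<beta> has_real_derivative - lam * v r - (real DIM('a) - 1) * \<beta> r / r) (at r)"
    "continuous_on {0..R} v" "v R = 0" "\<exists>r\<in>{0..<R}. v r \<noteq> 0"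
proof -
  let ?u = "\<lambda>x::'a. v (norm x)"
  obtain e :: 'a where e: "norm e = 1" using nonempty_Basis norm_Basis by blast
  have C2: "C1_on ?u (ball 0 R)" "C1_on (grad ?u) (ball 0 R)" and uc: "continuous_on (cball 0 R) ?u"
    and nz: "\<exists>x\<in>ball 0 R. ?u x \<noteq> 0" and pde: "\<And>x. x \<in> ball 0 R \<Longrightarrow> - laplacian ?u x = lam * ?u x"
    and bc: "\<And>x. x \<in> sphere 0 R \<Longrightarrow> ?u x = 0"
    using ef unfolding dirichlet_eigenfunction_def C2_on_def by auto
  have gd: "GDERIV ?u x :> grad ?u x" if "x \<in> ball 0 R" for x
    using C2(1) that has_derivative_imp_gderiv unfolding C1_on_def by blast
  define \<beta> where "\<beta> t = e \<bullet> grad ?u (t *\<^sub>R e)" for t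
  have ball: "t *\<^sub>R e \<in> ball 0 R" if "\<bar>t\<bar> < R" for t using that e by simp
  have line: "((\<lambda>t. t *\<^sub>R e) has_derivative (\<lambda>h. h *\<^sub>R e)) (at t)" for t
    by (intro derivative_intros)
  have even: "((\<lambda>t. v \<bar>t\<bar>) has_real_derivative \<beta> t) (at t)" if "\<bar>t\<bar> < R" for t
  proof -
    have "((\<lambda>t. ?u (t *\<^sub>R e)) has_derivative (\<lambda>h. (h *\<^sub>R e) \<bullet> grad ?u (t *\<^sub>R e))) (at t)"
      by (rule has_derivative_compose[OF line gd[OF ball[OF that], unfolded gderiv_def]])
    moreover have "(\<lambda>t. ?u (t *\<^sub>R e)) = (\<lambda>t. v \<bar>t\<bar>)" by (simp add: e)
    moreover have "(\<lambda>h. (h *\<^sub>R e) \<bullet> grad ?u (t *\<^sub>R e)) = (*) (\<beta> t)" by (auto simp: \<beta>_def)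
    ultimately show ?thesis unfolding has_field_derivative_def by (simp only:)
  qed
  have b0: "\<beta> 0 = 0"
  proof -
    have "((\<lambda>t. v \<bar>- t\<bar>) has_real_derivative - \<beta> 0) (at 0)"
      using DERIV_mirror[where f = "\<lambda>t. v \<bar>t\<bar>" and x = 0 and y = "\<beta> 0"] even[of 0] R by simp
    then have "((\<lambda>t. v \<bar>t\<bar>) has_real_derivative - \<beta> 0) (at 0)" by (simp only: abs_minus_cancel)
    moreover have "((\<lambda>t. v \<bar>t\<bar>) has_real_derivative \<beta> 0) (at 0)" using even[of 0] R by simp
    ultimately have "- \<beta> 0 = \<beta> 0" by (rule DERIV_unique)
    then show ?thesis by simp
  qed
  have bc': "continuous_on {0..<R} \<beta>"
    unfolding \<beta>_def
    by (intro continuous_on_inner continuous_on_const continuous_on_compose2[OF C1_on_imp_continuous_on[OF C2(2)]])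
       (auto intro!: continuous_intros simp: e)
  have dv: "(v has_real_derivative \<beta> r) (at r)" if "0 < r" "r < R" for r
    by (rule has_field_derivative_transform_within_open[OF even, where S = "{0<..}"]) (use that in auto)
  have gradr: "grad ?u x = (\<beta> (norm x) / norm x) *\<^sub>R x" if "x \<in> ball 0 R - {0}" for x
    by (rule grad_eqI[OF gderiv_radial[OF _ dv]]) (use that in auto)
  have db: "(\<beta> has_real_derivative - lam * v r - (real DIM('a) - 1) * \<beta> r / r) (at r)"
    if r: "0 < r" "r < R" for r
  proof -
    define x where "x = r *\<^sub>R e"
    have x: "x \<in> ball 0 R" "x \<noteq> 0" "norm x = r" "x \<in> ball 0 R - {0}" using r e ball[of r] by (auto simp: x_def)
    obtain L where L: "(grad ?u has_derivative L) (at x)" using C2(2) x(1) unfolding C1_on_def by blast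
    have "((\<lambda>t. e \<bullet> grad ?u (t *\<^sub>R e)) has_derivative (\<lambda>h. e \<bullet> L (h *\<^sub>R e))) (at r)"
      by (intro has_derivative_inner_right has_derivative_compose[OF line L[unfolded x_def]])
    then have "\<beta> differentiable (at r)" unfolding \<beta>_def[abs_def] differentiable_def by blast
    then obtain B where B: "(\<beta> has_real_derivative B) (at r)" using real_differentiable_def by blast
    have Q: "((\<lambda>r. \<beta> r / r) has_real_derivative (B * r - \<beta> r * 1) / (r * r)) (at (norm x))"
      unfolding x(3) using DERIV_divide[OF B DERIV_ident] r by simp
    have "laplacian ?u x = divergence (\<lambda>x. (\<beta> (norm x) / norm x) *\<^sub>R x) x"
      unfolding laplacian_def
      by (rule divergence_cong[OF _ x(4) gradr has_derivative_radial_field[OF x(2) Q]]) auto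
    also have "\<dots> = DIM('a) * (\<beta> r / r) + r * ((B * r - \<beta> r * 1) / (r * r))"
      using divergence_radial_field[OF x(2) Q] by (simp add: x(3))
    also have "\<dots> = B + (real DIM('a) - 1) * \<beta> r / r" using r by (simp add: field_simps)
    finally have "B = - lam * v r - (real DIM('a) - 1) * \<beta> r / r" using pde[OF x(1)] x(3) by simp
    then show ?thesis using B by simp
  qed
  have vc: "continuous_on {0..R} v"
  proof -
    have "continuous_on {0..R} (\<lambda>r. ?u (r *\<^sub>R e))"
      by (rule continuous_on_compose2[OF uc]) (auto intro!: continuous_intros simp: e)
    then show ?thesis by (rule continuous_on_eq) (auto simp: e)
  qed
  have "v R = 0" using bc[of "R *\<^sub>R e"] e R by simp
  moreover have "\<exists>r\<in>{0..<R}. v r \<noteq> 0" using nz by (metis atLeastLessThan_iff mem_ball_0 norm_ge_zero)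
  ultimately show thesis using that[OF bc' b0 dv db vc] by blast
qed

text \<open>The energy \<open>\<gamma>\<^sup>2 + lam * g\<^sup>2\<close> decreases and starts at \<open>0\<close>.\<close>

lemma linear_radial_ode_unique:
  fixes g \<gamma> :: "real \<Rightarrow> real"
  assumes lam: "lam > 0" and k: "k \<ge> 0"
    and c: "continuous_on {0..<R} g" "continuous_on {0..<R} \<gamma>" and z: "g 0 = 0" "\<gamma> 0 = 0"
    and dg: "\<And>r. 0 < r \<Longrightarrow> r < R \<Longrightarrow> (g has_real_derivative \<gamma> r) (at r)"
    and d\<gamma>: "\<And>r. 0 < r \<Longrightarrow> r < R \<Longrightarrow> (\<gamma> has_real_derivative - lam * g r - k * \<gamma> r / r) (at r)"
    and r: "0 \<le> r" "r < R"
  shows "g r = 0"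
proof -
  have "(\<gamma> r)\<^sup>2 + lam * (g r)\<^sup>2 \<le> (\<gamma> 0)\<^sup>2 + lam * (g 0)\<^sup>2"
  proof (rule nonincreasing_of_deriv_nonpos[OF r(1)])
    show "continuous_on {0..r} (\<lambda>r. (\<gamma> r)\<^sup>2 + lam * (g r)\<^sup>2)"
      using r by (intro continuous_intros continuous_on_subset[OF c(1)] continuous_on_subset[OF c(2)]) auto
    fix x assume x: "0 < x" "x < r"
    have "((\<lambda>r. (\<gamma> r)\<^sup>2 + lam * (g r)\<^sup>2) has_real_derivative
        2 * \<gamma> x * (- lam * g x - k * \<gamma> x / x) + lam * (2 * g x * \<gamma> x)) (at x)"
    proof (rule DERIV_add)
      show "((\<lambda>r. (\<gamma> r)\<^sup>2) has_real_derivative 2 * \<gamma> x * (- lam * g x - k * \<gamma> x / x)) (at x)"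
        using DERIV_power[OF d\<gamma>[of x], of 2] x r by (simp add: mult_ac)
      show "((\<lambda>r. lam * (g r)\<^sup>2) has_real_derivative lam * (2 * g x * \<gamma> x)) (at x)"
        using DERIV_cmult[OF DERIV_power[OF dg[of x], of 2], of lam] x r by (simp add: mult_ac)
    qed
    moreover have "2 * \<gamma> x * (- lam * g x - k * \<gamma> x / x) + lam * (2 * g x * \<gamma> x) = - 2 * k * (\<gamma> x)\<^sup>2 / x"
      by (simp add: algebra_simps power2_eq_square)
    ultimately show "((\<lambda>r. (\<gamma> r)\<^sup>2 + lam * (g r)\<^sup>2) has_real_derivative - 2 * k * (\<gamma> x)\<^sup>2 / x) (at x)" by simp
    show "- 2 * k * (\<gamma> x)\<^sup>2 / x \<le> 0" using k x by simp
  qed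
  then have "(\<gamma> r)\<^sup>2 + lam * (g r)\<^sup>2 \<le> 0" by (simp add: z)
  then have "lam * (g r)\<^sup>2 \<le> 0" using zero_le_power2[of "\<gamma> r"] by linarith
  then show ?thesis using lam by (simp add: mult_le_0_iff)
qed

text \<open>The function \<open>r ^ k * (g * \<gamma>)\<close> starts at \<open>0\<close> and has the derivative
  \<open>r ^ k * (\<gamma>\<^sup>2 - lam * g\<^sup>2) \<ge> 0\<close>. So \<open>g\<^sup>2\<close> increases, but it ends at \<open>0\<close>.\<close>

lemma no_nonpositive_radial_eigenvalue:
  fixes g \<gamma> :: "real \<Rightarrow> real"
  assumes lam: "lam \<le> 0" and c: "continuous_on {0..R} g" "continuous_on {0..<R} \<gamma>" and z: "\<gamma> 0 = 0" "g R = 0"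
    and dg: "\<And>r. 0 < r \<Longrightarrow> r < R \<Longrightarrow> (g has_real_derivative \<gamma> r) (at r)"
    and d\<gamma>: "\<And>r. 0 < r \<Longrightarrow> r < R \<Longrightarrow> (\<gamma> has_real_derivative - lam * g r - real k * \<gamma> r / r) (at r)"
    and r: "0 \<le> r" "r < R"
  shows "g r = 0"
proof -
  have gg: "g x * \<gamma> x \<ge> 0" if x: "0 < x" "x < R" for x
  proof -
    have "0 ^ k * (g 0 * \<gamma> 0) \<le> x ^ k * (g x * \<gamma> x)"
    proof (rule nondecreasing_of_deriv_nonneg[where g = "\<lambda>r. r ^ k * (g r * \<gamma> r)"])
      show "continuous_on {0..x} (\<lambda>r. r ^ k * (g r * \<gamma> r))"
        using x by (intro continuous_intros continuous_on_subset[OF c(1)] continuous_on_subset[OF c(2)]) auto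
      fix t assume t: "0 < t" "t < x"
      have t': "0 < t" "t < R" using t x by auto
      have "((\<lambda>r. r ^ k * (g r * \<gamma> r)) has_real_derivative
          t ^ k * (g t * (- lam * g t - real k * \<gamma> t / t) + \<gamma> t * \<gamma> t) + real k * t ^ (k - Suc 0) * (g t * \<gamma> t)) (at t)"
        using DERIV_mult'[OF DERIV_pow[of k t UNIV] DERIV_mult'[OF dg[OF t'] d\<gamma>[OF t']]] by simp
      moreover have "t ^ k * (g t * (- lam * g t - real k * \<gamma> t / t) + \<gamma> t * \<gamma> t) + real k * t ^ (k - Suc 0) * (g t * \<gamma> t)
          = t ^ k * ((\<gamma> t)\<^sup>2 + (- lam) * (g t)\<^sup>2)"
      proof (cases k)
        case (Suc m)
        have "t ^ k * (real k * \<gamma> t / t) = real k * t ^ m * \<gamma> t" using t Suc by simp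
        then show ?thesis using Suc t by (simp add: field_simps power2_eq_square)
      qed (simp add: power2_eq_square)
      ultimately show "((\<lambda>r. r ^ k * (g r * \<gamma> r)) has_real_derivative t ^ k * ((\<gamma> t)\<^sup>2 + (- lam) * (g t)\<^sup>2)) (at t)" by simp
      show "t ^ k * ((\<gamma> t)\<^sup>2 + (- lam) * (g t)\<^sup>2) \<ge> 0"
        using t lam by (intro mult_nonneg_nonneg add_nonneg_nonneg) auto
    qed (use x in auto)
    then have "0 \<le> x ^ k * (g x * \<gamma> x)" by (simp add: z)
    moreover have "x ^ k > 0" using x by simp
    ultimately show ?thesis by (metis linorder_not_less mult_pos_neg)
  qed
  have "(g r)\<^sup>2 \<le> (g R)\<^sup>2"
  proof (rule nondecreasing_of_deriv_nonneg[where g = "\<lambda>r. (g r)\<^sup>2"])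
    show "continuous_on {r..R} (\<lambda>r. (g r)\<^sup>2)"
      using r by (intro continuous_intros continuous_on_subset[OF c(1)]) auto
    fix x assume "r < x" "x < R"
    then have x: "0 < x" "x < R" using r by auto
    show "((\<lambda>r. (g r)\<^sup>2) has_real_derivative 2 * (g x * \<gamma> x)) (at x)"
      using DERIV_power[OF dg[OF x], of 2] by (simp add: mult_ac)
    show "2 * (g x * \<gamma> x) \<ge> 0" using gg[OF x] by simp
  qed (use r in auto)
  then show ?thesis by (simp add: z)
qed

section \<open>Radial eigenvalues and zeros of the linear profile\<close>

lemma linear_profile_exists:
  assumes N: "N \<ge> 1"
  obtains \<phi> \<Phi> where "radial_profile N 0 (\<lambda>s. s) (\<lambda>s. s\<^sup>2 / 2) \<phi> \<Phi>"
proof -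
  obtain v Y :: "real \<Rightarrow> real \<Rightarrow> real" where "\<And>d. d \<in> {0} \<Longrightarrow> radial_ivp N (slope d) (\<lambda>s. s) (v d) (Y d)"
  proof (rule radial_ivp_family[where P = "{0::real}" and G = slope and f = "\<lambda>d s. s" and L = 1, OF N])
    show "continuous_on ({0::real} \<times> UNIV) (\<lambda>(d, s). s :: real)"
      unfolding case_prod_beta by (intro continuous_intros)
    show "continuous_on ({0} \<times> UNIV) (\<lambda>(d, s). slope d s)" by (rule continuous_slope)
  qed (auto simp: slope_diff_le)
  then have "radial_ivp N (slope 0) (\<lambda>s. s) (v 0) (Y 0)" by simp
  moreover have "((\<lambda>s. s\<^sup>2 / 2) has_real_derivative s) (at s)" for s :: real
    by (auto intro!: derivative_eq_intros)
  ultimately have "radial_profile N 0 (\<lambda>s. s) (\<lambda>s. s\<^sup>2 / 2) (v 0) (Y 0)"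
    using N by unfold_locales auto
  then show thesis using that by blast
qed

lemma linear_profile_rescaled:
  assumes "radial_profile N 0 (\<lambda>s. s) F \<phi> \<Phi>" and lam: "lam > 0"
  shows "radial_profile N 0 (\<lambda>s. lam * s) (\<lambda>s. lam / 2 * s\<^sup>2) (\<lambda>r. \<phi> (sqrt lam * r)) (\<lambda>r. lam * \<Phi> (sqrt lam * r))"
proof -
  interpret radial_profile N 0 "\<lambda>s. s" F \<phi> \<Phi> by fact
  define q where "q = sqrt lam"
  have q: "q > 0" "q * q = lam" using lam by (auto simp: q_def)
  show ?thesis unfolding q_def[symmetric]
  proof
    show "N \<ge> 1" by (rule N)
    show "radial_ivp N (slope 0) (\<lambda>s. lam * s) (\<lambda>r. \<phi> (q * r)) (\<lambda>r. lam * \<Phi> (q * r))"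
      unfolding radial_ivp_def
    proof (intro conjI allI impI)
      show "\<phi> (q * 0) = 1" "lam * \<Phi> (q * 0) = - (lam * 1) / N" by (simp_all add: v0 Y0)
      show "continuous_on {0..} (\<lambda>r. lam * \<Phi> (q * r))"
        using q by (intro continuous_on_mult_left continuous_on_compose2[OF Y_cont]) (auto intro!: continuous_intros)
      show "((\<lambda>r. \<phi> (q * r)) has_real_derivative slope 0 (r * (lam * \<Phi> (q * r)))) (at r within {0..})"
        if "r \<ge> 0" for r
      proof -
        have "((\<lambda>r. \<phi> (q * r)) has_real_derivative slope 0 (q * r * \<Phi> (q * r)) * q) (at r within {0..})"
        proof (rule DERIV_image_chain[where f = \<phi> and g = "(*) q", unfolded o_def])
          have "(\<phi> has_real_derivative slope 0 (q * r * \<Phi> (q * r))) (at (q * r) within {0..})"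
            using that q by (intro v_deriv0) auto
          then show "(\<phi> has_real_derivative slope 0 (q * r * \<Phi> (q * r))) (at (q * r) within (*) q ` {0..})"
            by (rule has_field_derivative_subset) (use q in auto)
          show "((*) q has_real_derivative q) (at r within {0..})"
            using DERIV_cmult_Id[of q r "{0..}"] by simp
        qed
        moreover have "slope 0 (q * r * \<Phi> (q * r)) * q = slope 0 (r * (lam * \<Phi> (q * r)))"
          by (simp add: q(2)[symmetric] mult_ac)
        ultimately show ?thesis by (simp only:)
      qed
      show "((\<lambda>r. lam * \<Phi> (q * r)) has_real_derivative - (lam * \<phi> (q * r) + N * (lam * \<Phi> (q * r))) / r) (at r)"
        if r: "r > 0" for r
      proof -
        have "q * r > 0" using q r by simp
        note D = DERIV_cmult[OF DERIV_chain2[OF Y_deriv[OF this] DERIV_cmult_Id[of q r UNIV]], of lam]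
        have "lam * (- (\<phi> (q * r) + N * \<Phi> (q * r)) / (q * r) * q) = - (lam * \<phi> (q * r) + N * (lam * \<Phi> (q * r))) / r"
          using q r by (simp add: field_simps)
        with D show ?thesis by (simp only:)
      qed
    qed
    show "((\<lambda>s. lam / 2 * s\<^sup>2) has_real_derivative lam * s) (at s)" for s :: real
      by (auto intro!: derivative_eq_intros)
  qed (use lam in auto)
qed

lemma linear_profile_unique:
  assumes lam: "lam > 0"
    and 1: "radial_profile N 0 (\<lambda>s. lam * s) F1 v1 Y1"
    and c: "continuous_on {0..<R} g" "continuous_on {0..<R} \<gamma>" and z: "\<gamma> 0 = 0"
    and dg: "\<And>r. 0 < r \<Longrightarrow> r < R \<Longrightarrow> (g has_real_derivative \<gamma> r) (at r)"
    and d\<gamma>: "\<And>r. 0 < r \<Longrightarrow> r < R \<Longrightarrow> (\<gamma> has_real_derivative - lam * g r - (real N - 1) * \<gamma> r / r) (at r)"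
    and r: "0 \<le> r" "r < R"
  shows "g r = g 0 * v1 r"
proof -
  interpret radial_profile N 0 "\<lambda>s. lam * s" F1 v1 Y1 by fact
  have "g r - g 0 * v1 r = 0"
  proof (rule linear_radial_ode_unique[where \<gamma> = "\<lambda>r. \<gamma> r - g 0 * (r * Y1 r)" and k = "real N - 1" and g = "\<lambda>r. g r - g 0 * v1 r" and R = R, OF lam])
    show "real N - 1 \<ge> 0" using N by simp
    show "continuous_on {0..<R} (\<lambda>r. g r - g 0 * v1 r)" "continuous_on {0..<R} (\<lambda>r. \<gamma> r - g 0 * (r * Y1 r))"
      by (intro continuous_intros c continuous_on_subset[OF v_cont] continuous_on_subset[OF Y_cont]; auto)+
    fix r assume r: "0 < r" "r < R"
    show "((\<lambda>r. g r - g 0 * v1 r) has_real_derivative \<gamma> r - g 0 * (r * Y1 r)) (at r)"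
      using DERIV_diff[OF dg[OF r] DERIV_cmult[OF v_deriv[OF r(1)], of "g 0"]] by simp
    have "- lam * g r - (real N - 1) * \<gamma> r / r - g 0 * (- (lam * v1 r) - (real N - 1) * Y1 r)
       = - lam * (g r - g 0 * v1 r) - (real N - 1) * (\<gamma> r - g 0 * (r * Y1 r)) / r"
      using r by (simp add: field_simps)
    then show "((\<lambda>r. \<gamma> r - g 0 * (r * Y1 r)) has_real_derivative
        - lam * (g r - g 0 * v1 r) - (real N - 1) * (\<gamma> r - g 0 * (r * Y1 r)) / r) (at r)"
      using DERIV_diff[OF d\<gamma>[OF r] DERIV_cmult[OF y_deriv[OF r(1)], of "g 0"]] by (simp only:)
  qed (use v0 z r in auto)
  then show ?thesis by simp
qed

text \<open>Every radial eigenfunction is a multiple of the linear profile, rescaled by \<open>sqrt lam\<close>.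
  For \<open>N = 2\<close> this profile is the Bessel function of order zero.\<close>

lemma radial_eigenvalues_eq:
  assumes prof: "radial_profile DIM('a::euclidean_space) 0 (\<lambda>s. s) F \<phi> \<Phi>" and R: "R > 0"
  shows "radial_eigenvalues TYPE('a) R = {lam. lam > 0 \<and> \<phi> (sqrt lam * R) = 0}"
proof (intro set_eqI iffI)
  fix lam assume "lam \<in> radial_eigenvalues TYPE('a) R"
  then obtain v :: "real \<Rightarrow> real" where v: "dirichlet_eigenfunction R lam (\<lambda>x::'a. v (norm x))"
    unfolding radial_eigenvalues_def by blast
  obtain \<beta> where b: "continuous_on {0..<R} \<beta>" "\<beta> 0 = 0"
    and dv: "\<And>r. 0 < r \<Longrightarrow> r < R \<Longrightarrow> (v has_real_derivative \<beta> r) (at r)"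
    and db: "\<And>r. 0 < r \<Longrightarrow> r < R \<Longrightarrow> (\<beta> has_real_derivative - lam * v r - (real DIM('a) - 1) * \<beta> r / r) (at r)"
    and vc: "continuous_on {0..R} v" "v R = 0" and nz: "\<exists>r\<in>{0..<R}. v r \<noteq> 0"
    by (rule radial_eigenfunction_ode[OF v R]) (rule that; (assumption | blast))
  have pos: "lam > 0"
  proof (rule ccontr)
    assume "\<not> lam > 0"
    then have "v r = 0" if "r \<in> {0..<R}" for r
      using no_nonpositive_radial_eigenvalue[of lam R v \<beta> "DIM('a) - 1" r] b vc dv db that DIM_positive[where 'a = 'a]
      by (auto simp: of_nat_diff)
    then show False using nz by blast
  qed
  interpret L: radial_profile "DIM('a)" 0 "\<lambda>s. lam * s" "\<lambda>s. lam / 2 * s\<^sup>2"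
      "\<lambda>r. \<phi> (sqrt lam * r)" "\<lambda>r. lam * \<Phi> (sqrt lam * r)"
    by (rule linear_profile_rescaled[OF prof pos])
  have vc': "continuous_on {0..<R} v" by (rule continuous_on_subset[OF vc(1)]) auto
  have eq: "v r = v 0 * \<phi> (sqrt lam * r)" if "r \<in> {0..<R}" for r
    by (rule linear_profile_unique[OF pos L.radial_profile_axioms vc' b dv db]) (use that in auto)
  have "v R - v 0 * \<phi> (sqrt lam * R) = 0"
  proof (rule continuous_constant_on_closure[of "{0..<R}" "\<lambda>r. v r - v 0 * \<phi> (sqrt lam * r)"])
    have "closure {0..<R} = {0..R}" using R by (intro closure_atLeastLessThan)
    moreover have "continuous_on {0..R} (\<lambda>r. v r - v 0 * \<phi> (sqrt lam * r))"
      by (intro continuous_intros vc continuous_on_subset[OF L.v_cont]) auto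
    ultimately show "continuous_on (closure {0..<R}) (\<lambda>r. v r - v 0 * \<phi> (sqrt lam * r))" by simp
    show "R \<in> closure {0..<R}" using R by simp
    show "v r - v 0 * \<phi> (sqrt lam * r) = 0" if "r \<in> {0..<R}" for r using eq[OF that] by linarith
  qed
  moreover have "v 0 \<noteq> 0"
  proof
    assume "v 0 = 0"
    moreover obtain r where "r \<in> {0..<R}" "v r \<noteq> 0" using nz by blast
    ultimately show False using eq[of r] by simp
  qed
  ultimately show "lam \<in> {lam. lam > 0 \<and> \<phi> (sqrt lam * R) = 0}" using pos vc by simp
next
  fix lam assume "lam \<in> {lam. lam > 0 \<and> \<phi> (sqrt lam * R) = 0}"
  then have lam: "lam > 0" "\<phi> (sqrt lam * R) = 0" by auto
  interpret L: radial_profile "DIM('a)" 0 "\<lambda>s. lam * s" "\<lambda>s. lam / 2 * s\<^sup>2"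
      "\<lambda>r. \<phi> (sqrt lam * r)" "\<lambda>r. lam * \<Phi> (sqrt lam * r)"
    by (rule linear_profile_rescaled[OF prof lam(1)])
  have "dirichlet_eigenfunction R lam (\<lambda>x::'a. \<phi> (sqrt lam * norm x))"
    using L.dirichlet_eigenfunction_profile[where 'a = 'a and R = R and lam = lam] R lam by simp
  then show "lam \<in> radial_eigenvalues TYPE('a) R" unfolding radial_eigenvalues_def
    by (intro CollectI exI[of _ "\<lambda>r. \<phi> (sqrt lam * r)"])
qed

text \<open>This justifies the definite description in the definition of the radial eigenvalues.\<close>

lemma ex1_nth_element:
  fixes S :: "real set"
  assumes fin: "\<And>x. finite {s \<in> S. s \<le> x}" and unb: "\<And>x. \<exists>s\<in>S. x < s"
  shows "\<exists>!s. s \<in> S \<and> finite {t \<in> S. t < s} \<and> card {t \<in> S. t < s} = n"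
proof -
  have fin': "finite {t \<in> S. t < s}" for s by (rule finite_subset[OF _ fin[of s]]) auto
  have next_elt: "\<exists>t\<in>S. x < t \<and> (\<forall>u\<in>S. x < u \<longrightarrow> t \<le> u)" for x
  proof -
    obtain s where s: "s \<in> S" "x < s" using unb by blast
    let ?A = "{t \<in> S. x < t \<and> t \<le> s}"
    have A: "finite ?A" "?A \<noteq> {}" using s by (auto intro: finite_subset[OF _ fin[of s]])
    have m: "Min ?A \<in> ?A" by (rule Min_in[OF A])
    have "Min ?A \<le> u" if "u \<in> S" "x < u" for u
    proof (cases "u \<le> s")
      case True then show ?thesis using A that by (intro Min_le) auto
    next
      case False then show ?thesis using m by auto
    qed
    then show ?thesis using m by blast
  qed
  have "\<exists>s\<in>S. card {t \<in> S. t < s} = n"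
  proof (induction n)
    case 0
    show ?case
    proof (cases "S = {}")
      case False
      then obtain s where s: "s \<in> S" by blast
      have A: "finite {t \<in> S. t \<le> s}" "{t \<in> S. t \<le> s} \<noteq> {}" using fin s by auto
      have m: "Min {t \<in> S. t \<le> s} \<in> {t \<in> S. t \<le> s}" by (rule Min_in[OF A])
      have "{t \<in> S. t < Min {t \<in> S. t \<le> s}} = {}"
        using Min_le[OF A(1)] m by fastforce
      then have "card {t \<in> S. t < Min {t \<in> S. t \<le> s}} = 0" by (simp only: card.empty)
      then show ?thesis using m by blast
    qed (use unb in auto)
  next
    case (Suc n)
    then obtain s where s: "s \<in> S" "card {t \<in> S. t < s} = n" by blast
    obtain u where u: "u \<in> S" "s < u" "\<And>w. w \<in> S \<Longrightarrow> s < w \<Longrightarrow> u \<le> w" using next_elt[of s] by blast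
    have "{t \<in> S. t < u} = insert s {t \<in> S. t < s}" using s u by force
    then have "card {t \<in> S. t < u} = Suc n" using fin'[of s] s by simp
    then show ?case using u by blast
  qed
  then obtain s where s: "s \<in> S" "card {t \<in> S. t < s} = n" by blast
  have mono: "card {t \<in> S. t < a} < card {t \<in> S. t < b}" if "a \<in> S" "a < b" for a b
    by (rule psubset_card_mono[OF fin']) (use that in auto)
  show ?thesis
  proof (rule ex1I[of _ s])
    fix t assume t: "t \<in> S \<and> finite {u \<in> S. u < t} \<and> card {u \<in> S. u < t} = n"
    then show "t = s" using mono[of s t] mono[of t s] s by (cases s t rule: linorder_cases) auto
  qed (use s fin' in auto)
qed

locale eigenvalue_list =
  fixes S :: "real set" and \<Lambda> :: "nat \<Rightarrow> real"
  assumes fin: "\<And>x. finite {s \<in> S. s \<le> x}" and unb: "\<And>x. \<exists>s\<in>S. x < s" and pos: "\<And>s. s \<in> S \<Longrightarrow> s > 0"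
    and \<Lambda>0: "\<Lambda> 0 = 0"
    and \<Lambda>: "\<And>k. k \<ge> 1 \<Longrightarrow> \<Lambda> k = (THE lam. lam \<in> S \<and> finite {\<nu> \<in> S. \<nu> < lam} \<and> card {\<nu> \<in> S. \<nu> < lam} = k - 1)"
begin

lemma fin_less: "finite {t \<in> S. t < s}"
  by (rule finite_subset[OF _ fin[of s]]) auto

lemma \<Lambda>_props: "k \<ge> 1 \<Longrightarrow> \<Lambda> k \<in> S \<and> card {\<nu> \<in> S. \<nu> < \<Lambda> k} = k - 1"
  using theI'[OF ex1_nth_element[OF fin unb, of "k - 1"]] \<Lambda> by auto

lemma \<Lambda>_nonneg: "\<Lambda> k \<ge> 0"
  using \<Lambda>0 \<Lambda>_props[of k] pos by (cases "k = 0") (auto intro: less_imp_le)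

lemma card_above:
  assumes "\<Lambda> k < lam" shows "k \<le> card {\<nu> \<in> S. \<nu> < lam}"
proof (cases "k = 0")
  case False
  then have k: "k \<ge> 1" by simp
  have "card (insert (\<Lambda> k) {\<nu> \<in> S. \<nu> < \<Lambda> k}) \<le> card {\<nu> \<in> S. \<nu> < lam}"
    using \<Lambda>_props[OF k] assms by (intro card_mono fin_less) auto
  then show ?thesis using \<Lambda>_props[OF k] k fin_less by simp
qed simp

lemma card_below:
  assumes "lam < \<Lambda> (k + 1)" shows "card {\<nu> \<in> S. \<nu> \<le> lam} \<le> k"
proof -
  have "card {\<nu> \<in> S. \<nu> \<le> lam} \<le> card {\<nu> \<in> S. \<nu> < \<Lambda> (k + 1)}"
    using assms by (intro card_mono fin_less) auto
  then show ?thesis using \<Lambda>_props[of "k + 1"] by simp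
qed

lemma \<Lambda>_less_Suc:
  assumes "j \<ge> 1" shows "\<Lambda> j < \<Lambda> (j + 1)"
proof (rule ccontr)
  assume c: "\<not> \<Lambda> j < \<Lambda> (j + 1)"
  have "card {\<nu> \<in> S. \<nu> < \<Lambda> (j + 1)} \<le> card {\<nu> \<in> S. \<nu> < \<Lambda> j}"
    using c by (intro card_mono fin_less) auto
  then show False using \<Lambda>_props[of j] \<Lambda>_props[of "j + 1"] assms by simp
qed

end

lemma eigenvalue_list_radial:
  assumes prof: "radial_profile DIM('a::euclidean_space) 0 (\<lambda>s. s) F \<phi> \<Phi>" and R: "R > 0"
  shows "eigenvalue_list (radial_eigenvalues TYPE('a) R) (lambda_rad TYPE('a) R)"
proof
  interpret radial_profile "DIM('a)" 0 "\<lambda>s. s" F \<phi> \<Phi> by fact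
  note S = radial_eigenvalues_eq[OF prof R]
  show "finite {s \<in> radial_eigenvalues TYPE('a) R. s \<le> x}" for x
  proof (rule inj_on_finite[OF _ _ finite_zeros[of "sqrt x * R"]])
    show "inj_on (\<lambda>s. sqrt s * R) {s \<in> radial_eigenvalues TYPE('a) R. s \<le> x}"
      using R by (auto simp: inj_on_def)
    show "(\<lambda>s. sqrt s * R) ` {s \<in> radial_eigenvalues TYPE('a) R. s \<le> x} \<subseteq> {r \<in> {0..sqrt x * R}. \<phi> r = 0}"
      using R unfolding S by auto
  qed
  show "\<exists>s\<in>radial_eigenvalues TYPE('a) R. x < s" for x
  proof -
    define a where "a = max (real DIM('a)) (sqrt \<bar>x\<bar> * R + 1)"
    have a: "a > 0" "a \<ge> real DIM('a) - 1" using DIM_positive[where 'a = 'a] by (auto simp: a_def less_max_iff_disj)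
    obtain z where z: "z \<ge> a" "\<phi> z = 0" using linear_profile_zero_in_window[OF prof a] by auto
    have zR: "z / R > sqrt \<bar>x\<bar>" using z R by (simp add: a_def field_simps)
    then have "(z / R)\<^sup>2 > (sqrt \<bar>x\<bar>)\<^sup>2" by (intro power_strict_mono) auto
    then have "(z / R)\<^sup>2 > x" by simp
    moreover have "(z / R)\<^sup>2 \<in> radial_eigenvalues TYPE('a) R"
      using z a R unfolding S by (auto simp: real_sqrt_abs)
    ultimately show ?thesis by blast
  qed
  show "s > 0" if "s \<in> radial_eigenvalues TYPE('a) R" for s using that unfolding S by simp
qed (simp_all add: lambda_rad_def)

text \<open>A zero \<open>r\<close> of \<open>\<phi> (sqrt lam * r)\<close> corresponds to the eigenvalue \<open>lam * (r / R)\<^sup>2\<close>.\<close>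

lemma linear_zero_counts:
  assumes prof: "radial_profile DIM('a::euclidean_space) 0 (\<lambda>s. s) F \<phi> \<Phi>" and R: "R > 0" and lam: "lam \<ge> 0"
  shows "card {r \<in> {0<..<R}. \<phi> (sqrt lam * r) = 0} = card {\<nu> \<in> radial_eigenvalues TYPE('a) R. \<nu> < lam}"
    and "card {r \<in> {0..R}. \<phi> (sqrt lam * r) = 0} = card {\<nu> \<in> radial_eigenvalues TYPE('a) R. \<nu> \<le> lam}"
proof -
  interpret radial_profile "DIM('a)" 0 "\<lambda>s. s" F \<phi> \<Phi> by fact
  note S = radial_eigenvalues_eq[OF prof R]
  define g where "g r = lam * (r / R)\<^sup>2" for r
  define h where "h \<nu> = R * sqrt (\<nu> / lam)" for \<nu>
  have goal: "bij_betw g {r \<in> {0<..<R}. \<phi> (sqrt lam * r) = 0} {\<nu> \<in> radial_eigenvalues TYPE('a) R. \<nu> < lam} \<and>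
     bij_betw g {r \<in> {0..R}. \<phi> (sqrt lam * r) = 0} {\<nu> \<in> radial_eigenvalues TYPE('a) R. \<nu> \<le> lam}"
  proof (cases "lam = 0")
    case True
    then show ?thesis unfolding S by (auto simp: v0 bij_betw_def)
  next
    case False
    then have lam: "lam > 0" using lam by simp
    have gh: "g (h \<nu>) = \<nu>" if "\<nu> > 0" for \<nu> using that lam R by (simp add: g_def h_def)
    have hg: "h (g r) = r" if "r \<ge> 0" for r using that lam R by (simp add: g_def h_def)
    have z: "sqrt (g r) * R = sqrt lam * r" if "r \<ge> 0" for r
      using that R by (simp add: g_def real_sqrt_mult)
    have z': "sqrt lam * h \<nu> = sqrt \<nu> * R" for \<nu> using lam by (simp add: h_def real_sqrt_divide)
    have hpos: "h \<nu> > 0" if "\<nu> > 0" for \<nu> using that lam R by (simp add: h_def)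
    have gless: "g r < lam \<longleftrightarrow> r < R" "g r \<le> lam \<longleftrightarrow> r \<le> R" if "r \<ge> 0" for r
    proof -
      have "(r / R)\<^sup>2 < 1 \<longleftrightarrow> r < R" "(r / R)\<^sup>2 \<le> 1 \<longleftrightarrow> r \<le> R"
        using that R by (simp_all add: power_less_one_iff power_le_one_iff)
      then show "g r < lam \<longleftrightarrow> r < R" "g r \<le> lam \<longleftrightarrow> r \<le> R" using lam by (simp_all add: g_def)
    qed
    have hless: "h \<nu> < R \<longleftrightarrow> \<nu> < lam" "h \<nu> \<le> R \<longleftrightarrow> \<nu> \<le> lam" if "\<nu> > 0" for \<nu>
      using gless[of "h \<nu>"] gh[OF that] hpos[OF that] by auto
    have gpos: "g r > 0" if "r > 0" for r using that lam R by (simp add: g_def)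
    have r0: "r > 0" if "\<phi> (sqrt lam * r) = 0" "r \<ge> 0" for r using v0 that by (cases "r = 0") auto
    show ?thesis
    proof
      show "bij_betw g {r \<in> {0<..<R}. \<phi> (sqrt lam * r) = 0} {\<nu> \<in> radial_eigenvalues TYPE('a) R. \<nu> < lam}"
        by (rule bij_betw_byWitness[where f' = h])
           (use gh hg z z' gless hless gpos hpos in \<open>auto simp: S\<close>)
      show "bij_betw g {r \<in> {0..R}. \<phi> (sqrt lam * r) = 0} {\<nu> \<in> radial_eigenvalues TYPE('a) R. \<nu> \<le> lam}"
        by (rule bij_betw_byWitness[where f' = h])
           (use gh hg z z' gless hless gpos r0 less_imp_le[OF hpos] in \<open>auto simp: S\<close>)
    qed
  qed
  show "card {r \<in> {0<..<R}. \<phi> (sqrt lam * r) = 0} = card {\<nu> \<in> radial_eigenvalues TYPE('a) R. \<nu> < lam}"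
    and "card {r \<in> {0..R}. \<phi> (sqrt lam * r) = 0} = card {\<nu> \<in> radial_eigenvalues TYPE('a) R. \<nu> \<le> lam}"
    using goal bij_betw_same_card by blast+
qed

section \<open>The rescaled shooting family\<close>

definition has_nodal_solutions ::
  "'a::euclidean_space itself \<Rightarrow> real \<Rightarrow> real \<Rightarrow> real \<Rightarrow> real \<Rightarrow> nat \<Rightarrow> nat \<Rightarrow> bool" where
  "has_nodal_solutions T R p lam \<mu> k j \<longleftrightarrow> (\<exists>us ul :: nat \<Rightarrow> real \<Rightarrow> real.
    (\<forall>l\<in>{k+1..j}. radial_solution T R p lam \<mu> (us l)) \<and>
    (\<forall>l\<in>{1..j}. radial_solution T R p lam \<mu> (ul l)) \<and>
    card (us ` {k+1..j} \<union> ul ` {1..j}) = 2 * j - k \<and>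
    sorted_wrt (<) (0 # map (\<lambda>l. us l 0) [k+1..<j+1] @ map (\<lambda>l. ul l 0) (rev [1..<j+1])) \<and>
    (\<forall>l\<in>{k+1..j}. nodal_profile R (l - 1) (us l)) \<and>
    (\<forall>l\<in>{1..j}. nodal_profile R (l - 1) (ul l)))"

text \<open>The signed power is frozen outside the interval from \<open>-1\<close> to \<open>1\<close>, which makes it globally
  Lipschitz. Profiles never leave this interval, by \<open>v_bounded\<close>.\<close>

definition clamped_power :: "real \<Rightarrow> real \<Rightarrow> real" where
  "clamped_power q s = \<bar>max (-1) (min 1 s)\<bar> powr q * max (-1) (min 1 s)"

lemma clamped_power_eq:
  assumes "\<bar>s\<bar> \<le> 1"
  shows "clamped_power q s = \<bar>s\<bar> powr q * s"
proof -
  have "max (-1) (min 1 s) = s" using assms by (auto simp: max_def min_def)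
  then show ?thesis by (simp only: clamped_power_def)
qed

lemma clamped_power_diff_le:
  assumes q: "q > 0"
  shows "\<bar>clamped_power q x - clamped_power q y\<bar> \<le> (q + 1) * \<bar>x - y\<bar>"
proof -
  define m where "m s = max (-1) (min 1 s)" for s :: real
  have m: "m s \<in> {-1..1}" for s by (auto simp: m_def)
  have "norm (\<bar>m x\<bar> powr q * m x - \<bar>m y\<bar> powr q * m y) \<le> (q + 1) * norm (m x - m y)"
  proof (rule field_differentiable_bound[where S = "{-1..1}" and f = "\<lambda>s. \<bar>s\<bar> powr q * s"])
    fix z :: real assume z: "z \<in> {-1..1}"
    show "((\<lambda>s. \<bar>s\<bar> powr q * s) has_field_derivative (q + 1) * \<bar>z\<bar> powr q) (at z within {-1..1})"
      by (rule has_field_derivative_at_within[OF DERIV_signed_powr[OF q]])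
    have "\<bar>z\<bar> powr q \<le> 1" using z q by (intro powr_le1) auto
    then show "norm ((q + 1) * \<bar>z\<bar> powr q) \<le> q + 1" using q by (simp add: abs_mult mult_left_le)
  qed (use m in auto)
  also have "\<dots> \<le> (q + 1) * \<bar>x - y\<bar>" using q unfolding m_def by (intro mult_left_mono) auto
  finally show ?thesis by (simp add: clamped_power_def m_def)
qed

lemma continuous_signed_powr: "q > 0 \<Longrightarrow> continuous_on S (\<lambda>s::real. \<bar>s\<bar> powr q * s)"
  by (rule DERIV_continuous_on[OF has_field_derivative_at_within[OF DERIV_signed_powr]])

lemma continuous_clamped_power: "q > 0 \<Longrightarrow> continuous_on S (clamped_power q)"
  unfolding clamped_power_def[abs_def]
  by (rule continuous_on_compose2[OF continuous_signed_powr[of q UNIV]]) (auto intro!: continuous_intros)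

lemma reaction_alt: "reaction p lam c s = lam * s + c * (\<bar>s\<bar> powr (p - 2) * s)"
  by (simp add: reaction_def)

lemma reaction_pos:
  assumes "lam \<ge> 0" "c \<ge> 0" "lam > 0 \<or> c > 0" "s > 0"
  shows "reaction p lam c s > 0"
  using assms unfolding reaction_alt by (auto intro: add_pos_nonneg add_nonneg_pos)

text \<open>The rescaled nonlinearity is of the same form, with \<open>\<mu>\<close> replaced by a coefficient that tends
  to \<open>0\<close> with the amplitude \<open>D\<close> if \<open>p > 2\<close>.\<close>

lemma reaction_scaled:
  assumes "D > 0"
  shows "D * reaction p lam (\<mu> * D powr (p - 2)) s = reaction p lam \<mu> (D * s)"
  using assms by (simp add: reaction_def abs_mult powr_mult algebra_simps)

lemma continuous_reaction: "p > 2 \<Longrightarrow> continuous_on S (reaction p lam c)"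
  unfolding reaction_alt[abs_def]
  by (intro continuous_on_add continuous_on_mult_left continuous_on_id continuous_signed_powr) simp

lemma radial_ivp_cong:
  assumes "radial_ivp N G f v Y" "\<And>r. r \<ge> 0 \<Longrightarrow> f (v r) = g (v r)"
  shows "radial_ivp N G g v Y"
proof -
  have "f 1 = g 1" using assms(2)[of 0] assms(1) by (simp add: radial_ivp_def)
  then show ?thesis using assms unfolding radial_ivp_def by simp
qed

text \<open>The member \<open>d = 0\<close> of the family for \<open>lam = 0\<close> has no restoring force.\<close>

lemma radial_ivp_trivial:
  assumes ivp: "radial_ivp N G (\<lambda>_. 0) v Y" and N: "N \<ge> 1" and G: "G 0 = 0" and r: "r \<ge> 0"
  shows "v r = 1"
proof -
  have v0: "v 0 = 1" and Yc: "continuous_on {0..} Y"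
    and dv: "\<And>r. r \<ge> 0 \<Longrightarrow> (v has_real_derivative G (r * Y r)) (at r within {0..})"
    and dY: "\<And>r. r > 0 \<Longrightarrow> (Y has_real_derivative - (N * Y r) / r) (at r)"
    using ivp unfolding radial_ivp_def by simp_all
  have Y: "Y s = 0" if s: "s > 0" for s
  proof -
    have "s ^ N * Y s = 0 ^ N * Y 0"
    proof (rule DERIV_isconst_end[OF s])
      show "continuous_on {0..s} (\<lambda>s. s ^ N * Y s)"
        by (intro continuous_intros continuous_on_subset[OF Yc]) auto
      fix x :: real assume x: "0 < x"
      have "x ^ N * (- (N * Y x) / x) + real N * x ^ (N - 1) * Y x = 0"
        using x N by (cases N) (auto simp: field_simps)
      then show "((\<lambda>s. s ^ N * Y s) has_real_derivative 0) (at x)"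
        using DERIV_mult'[OF DERIV_pow[of N x UNIV] dY[OF x]] by simp
    qed
    then show ?thesis using s N by (simp add: zero_power)
  qed
  show ?thesis
  proof (cases "r = 0")
    case False
    then have r: "r > 0" using r by simp
    have "v r = v 0"
    proof (rule DERIV_isconst_end[OF r])
      show "continuous_on {0..r} v"
        by (rule continuous_on_subset[OF DERIV_continuous_on[OF dv]]) auto
      fix x :: real assume x: "0 < x"
      have "(v has_real_derivative 0) (at x within {0..})" using dv[of x] x Y G by simp
      moreover have "at x within {0..} = at x" by (rule at_within_interior) (use x in auto)
      ultimately show "(v has_real_derivative 0) (at x)" by simp
    qed
    then show ?thesis using v0 by simp
  qed (use v0 in simp)
qed

lemma antiderivative_exists:
  fixes f :: "real \<Rightarrow> real"
  assumes "continuous_on UNIV f"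
  obtains F where "\<And>s. (F has_real_derivative f s) (at s)" "F 0 = 0"
proof -
  obtain F where F: "\<And>x. (F has_vector_derivative f x) (at x)"
    using einterval_antiderivative[of "- \<infinity>" "\<infinity>" f] assms
    by (auto simp: continuous_on_eq_continuous_at)
  have "((\<lambda>x. F x - F 0) has_real_derivative f s) (at s)" for s
    using DERIV_diff[OF F[of s, folded has_real_derivative_iff_has_vector_derivative] DERIV_const] by simp
  then show thesis using that[of "\<lambda>x. F x - F 0"] by simp
qed

locale shooting_family =
  fixes N :: nat and R p lam \<mu> :: real and v Y :: "real \<Rightarrow> real \<Rightarrow> real"
  assumes N: "N \<ge> 1" and R: "R > 0" and p: "p > 2" and lam: "lam \<ge> 0" and \<mu>: "\<mu> > 0"
    and v_cont2: "continuous_on ({0..R} \<times> {0..R}) (\<lambda>(d, r). v d r)"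
    and Y_cont2: "continuous_on ({0..R} \<times> {0..R}) (\<lambda>(d, r). Y d r)"
    and ivp: "\<And>d. d \<in> {0..R} \<Longrightarrow> radial_ivp N (slope d) (reaction p lam (\<mu> * d powr (p - 2))) (v d) (Y d)"

text \<open>\<open>radial_ivp_family\<close> applies to the clamped nonlinearity. Its energy bounds the
  profiles by \<open>1\<close>, where the clamped nonlinearity agrees with the original one.\<close>

lemma shooting_family_exists:
  assumes N: "N \<ge> 1" and R: "R > 0" and p: "p > 2" and lam: "lam \<ge> 0" and \<mu>: "\<mu> > 0"
  obtains v Y where "shooting_family N R p lam \<mu> v Y"
proof -
  define q where "q = p - 2"
  have q: "q > 0" using p by (simp add: q_def)
  define f where "f d s = lam * s + \<mu> * d powr q * clamped_power q s" for d s
  define L where "L = lam + \<mu> * R powr q * (q + 1)"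
  have powr_cont: "continuous_on ({0..R} \<times> UNIV) (\<lambda>x :: real \<times> real. fst x powr q)"
    using q by (intro continuous_on_powr' continuous_intros) auto
  have f_lip: "\<bar>f d x - f d y\<bar> \<le> L * \<bar>x - y\<bar>" if d: "d \<in> {0..R}" for d x y
  proof -
    have dq: "d powr q \<le> R powr q" using d q by (intro powr_mono2) auto
    have "\<bar>f d x - f d y\<bar> = \<bar>lam * (x - y) + \<mu> * d powr q * (clamped_power q x - clamped_power q y)\<bar>"
      by (simp add: f_def algebra_simps)
    also have "\<dots> \<le> lam * \<bar>x - y\<bar> + \<mu> * d powr q * \<bar>clamped_power q x - clamped_power q y\<bar>"
      using lam \<mu> by (intro order_trans[OF abs_triangle_ineq]) (simp add: abs_mult)
    also have "\<dots> \<le> lam * \<bar>x - y\<bar> + \<mu> * R powr q * ((q + 1) * \<bar>x - y\<bar>)"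
      using \<mu> dq clamped_power_diff_le[OF q] by (intro add_left_mono mult_mono) auto
    also have "\<dots> = L * \<bar>x - y\<bar>" by (simp add: L_def algebra_simps)
    finally show ?thesis .
  qed
  have L: "L \<ge> 0" using lam \<mu> q by (simp add: L_def)
  have f_cont: "continuous_on ({0..R} \<times> UNIV) (\<lambda>(d, s). f d s)"
    unfolding f_def case_prod_beta
    by (intro continuous_intros powr_cont continuous_on_compose2[OF continuous_clamped_power[OF q, of UNIV]]) auto
  obtain v Y :: "real \<Rightarrow> real \<Rightarrow> real" where
    vc: "\<And>T. continuous_on ({0..R} \<times> {0..T}) (\<lambda>(d, r). v d r)" and
    Yc: "\<And>T. continuous_on ({0..R} \<times> {0..T}) (\<lambda>(d, r). Y d r)" and
    ivp: "\<And>d. d \<in> {0..R} \<Longrightarrow> radial_ivp N (slope d) (f d) (v d) (Y d)"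
  proof (rule radial_ivp_family[where P = "{0..R}" and G = slope and f = f and L = L, OF N L f_cont continuous_slope f_lip])
    show "f d 0 = 0" for d by (simp add: f_def clamped_power_def)
  qed (auto simp: slope_diff_le)
  have ivp': "radial_ivp N (slope d) (reaction p lam (\<mu> * d powr (p - 2))) (v d) (Y d)" if d: "d \<in> {0..R}" for d
  proof -
    have bound: "\<bar>v d r\<bar> \<le> 1" if "r \<ge> 0" for r
    proof (cases "lam = 0 \<and> d = 0")
      case True
      then have "f d = (\<lambda>_. 0)" by (auto simp: f_def)
      then show ?thesis using radial_ivp_trivial[of N "slope d" "v d" "Y d" r] ivp[OF d] N that by simp
    next
      case False
      then have pos: "lam > 0 \<or> \<mu> * d powr q > 0" using lam \<mu> d by auto
      have "continuous_on UNIV (f d)" unfolding f_def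
        by (intro continuous_intros continuous_clamped_power q)
      then obtain F where F: "\<And>s. (F has_real_derivative f d s) (at s)" "F 0 = 0"
        by (rule antiderivative_exists) blast
      have fp: "f d s > 0" if "s > 0" for s
      proof -
        have "clamped_power q s > 0" using that by (auto simp: clamped_power_def max_def min_def)
        then show ?thesis using that pos lam \<mu> unfolding f_def
          by (auto intro: add_pos_nonneg add_nonneg_pos)
      qed
      have fo: "f d (- s) = - f d s" for s
      proof -
        have "max (-1) (min 1 (- s)) = - max (-1) (min 1 s)" by (simp add: max_def min_def)
        then show ?thesis by (simp add: f_def clamped_power_def)
      qed
      interpret radial_profile N d "f d" F "v d" "Y d"
        using N d ivp[OF d] F fp fo by unfold_locales auto
      show ?thesis by (rule v_bounded[OF that])
    qed
    show ?thesis
      by (rule radial_ivp_cong[OF ivp[OF d]])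
         (simp add: f_def reaction_alt clamped_power_eq bound q_def)
  qed
  show thesis
    by (rule that[of v Y]) (use assms vc Yc ivp' in \<open>unfold_locales; auto\<close>)
qed

context shooting_family
begin

abbreviation coeff :: "real \<Rightarrow> real" where
  "coeff d \<equiv> \<mu> * d powr (p - 2)"

lemma profile:
  assumes d: "d \<in> {0..R}" and nt: "lam > 0 \<or> d > 0"
  shows "radial_profile N d (reaction p lam (coeff d)) (potential p lam (coeff d)) (v d) (Y d)"
proof
  have c: "coeff d \<ge> 0" "lam > 0 \<or> coeff d > 0" using \<mu> nt by auto
  show "reaction p lam (coeff d) s > 0" if "s > 0" for s by (rule reaction_pos[OF lam c that])
  show "(potential p lam (coeff d) has_real_derivative reaction p lam (coeff d) s) (at s)" for s
    by (rule DERIV_potential[OF p])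
  show "potential p lam (coeff d) 0 = 0" by (simp add: potential_def)
  show "reaction p lam (coeff d) (- s) = - reaction p lam (coeff d) s" for s by (simp add: reaction_def)
qed (use N d ivp[OF d] in auto)

lemma constant_profile:
  assumes "lam = 0" "r \<ge> 0"
  shows "v 0 r = 1"
proof -
  have "reaction p lam (coeff 0) = (\<lambda>_. 0)" using assms(1) by (auto simp: reaction_def)
  then show ?thesis using radial_ivp_trivial[of N "slope 0" "v 0" "Y 0" r] ivp[of 0] N R assms by simp
qed

lemma v_at_0: "d \<in> {0..R} \<Longrightarrow> v d 0 = 1"
  using ivp[of d] by (simp add: radial_ivp_def)

sublocale zero_family "{0..R}" R v "\<lambda>d r. slope d (r * Y d r)"
proof
  show "continuous_on ({0..R} \<times> {0..R}) (\<lambda>(d, r). slope d (r * Y d r))"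
  proof -
    have "continuous_on ({0..R} \<times> {0..R}) (\<lambda>x. (fst x, snd x * Y (fst x) (snd x)))"
      using Y_cont2 unfolding case_prod_beta by (intro continuous_intros)
    from continuous_on_compose2[OF continuous_slope[of UNIV] this]
    show ?thesis by (simp add: case_prod_beta)
  qed
next
  fix d r assume d: "d \<in> {0..R}" and r: "0 < r" "r \<le> R"
  show "(v d has_real_derivative slope d (r * Y d r)) (at r)"
  proof -
    have "(v d has_real_derivative slope d (r * Y d r)) (at r within {0..})"
      using ivp[OF d] r unfolding radial_ivp_def by simp
    moreover have "at r within {0..} = at r" by (rule at_within_interior) (use r in auto)
    ultimately show ?thesis by simp
  qed
  assume z: "v d r = 0"
  show "slope d (r * Y d r) \<noteq> 0"
  proof (cases "lam > 0 \<or> d > 0")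
    case True
    then show ?thesis using radial_profile.zero_simple[OF profile[OF d True] r(1) z] r by simp
  next
    case False
    then have "lam = 0" "d = 0" using lam d by auto
    then show ?thesis using z constant_profile[of r] r by simp
  qed
next
  fix d assume d: "d \<in> {0..R}"
  show "finite {r \<in> {0..R}. v d r = 0}"
  proof (cases "lam > 0 \<or> d > 0")
    case True
    then show ?thesis using radial_profile.finite_zeros[OF profile[OF d True]] by simp
  next
    case False
    then have "lam = 0" "d = 0" using lam d by auto
    then have "{r \<in> {0..R}. v d r = 0} = {}" using constant_profile by auto
    then show ?thesis by (simp only: finite.emptyI)
  qed
qed (use R v_cont2 v_at_0 in auto)

text \<open>With slope less than one in absolute value, \<open>u\<close> cannot fall from \<open>R\<close> to \<open>0\<close> within
  the distance \<open>R\<close>.\<close>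

lemma no_zeros_at_R: "all_zeros R = {}"
proof (rule ccontr)
  assume "all_zeros R \<noteq> {}"
  then obtain r where r: "0 \<le> r" "r \<le> R" "v R r = 0" by (auto simp: all_zeros_def)
  interpret radial_profile N R "reaction p lam (coeff R)" "potential p lam (coeff R)" "v R" "Y R"
    by (rule profile) (use R in auto)
  have "r > 0" using r v0 by (cases "r = 0") auto
  obtain z where z: "0 < z" "v R r - v R 0 = (r - 0) * slope R (z * Y R z)"
    using mean_value[of 0 r "v R" "\<lambda>r. slope R (r * Y R r)"] v_deriv
      continuous_on_subset[OF v_cont, of "{0..r}"] \<open>r > 0\<close> by auto
  have s: "R * \<bar>slope R (z * Y R z)\<bar> < 1" using abs_slope_less[of R "z * Y R z"] R by (simp add: abs_mult)
  have "r * \<bar>slope R (z * Y R z)\<bar> \<le> R * \<bar>slope R (z * Y R z)\<bar>" using r by (intro mult_right_mono) auto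
  moreover have "r * slope R (z * Y R z) = - 1" using z r v0 by simp
  then have "r * \<bar>slope R (z * Y R z)\<bar> = 1" using \<open>r > 0\<close> by (metis abs_minus_cancel abs_mult abs_of_pos abs_one)
  ultimately show False using s by simp
qed

lemma limit_profile:
  assumes prof: "radial_profile N 0 (\<lambda>s. s) F \<phi> \<Phi>" and r: "r \<ge> 0"
  shows "v 0 r = \<phi> (sqrt lam * r)"
proof (cases "lam = 0")
  case True
  then show ?thesis using constant_profile[OF True r] radial_profile.v0[OF prof] by simp
next
  case False
  then have lam0: "lam > 0" using lam by simp
  interpret A: radial_profile N 0 "reaction p lam (coeff 0)" "potential p lam (coeff 0)" "v 0" "Y 0"
    by (rule profile) (use R lam0 in auto)
  have "v 0 r = v 0 0 * \<phi> (sqrt lam * r)"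
  proof (rule linear_profile_unique[OF lam0 linear_profile_rescaled[OF prof lam0], where \<gamma> = "\<lambda>r. r * Y 0 r" and R = "r + 1"])
    show "continuous_on {0..<r + 1} (v 0)" "continuous_on {0..<r + 1} (\<lambda>r. r * Y 0 r)"
      by (intro continuous_intros continuous_on_subset[OF A.v_cont] continuous_on_subset[OF A.Y_cont]; auto)+
    fix x :: real assume x: "0 < x"
    show "(v 0 has_real_derivative x * Y 0 x) (at x)" using A.v_deriv[OF x] by simp
    have "- lam * v 0 x - (real N - 1) * (x * Y 0 x) / x = - reaction p lam (coeff 0) (v 0 x) - (real N - 1) * Y 0 x"
      using x by (simp add: reaction_def)
    then show "((\<lambda>r. r * Y 0 r) has_real_derivative - lam * v 0 x - (real N - 1) * (x * Y 0 x) / x) (at x)"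
      using A.y_deriv[OF x] by (simp only:)
  qed (use r in auto)
  then show ?thesis using v_at_0[of 0] R by simp
qed

lemma eventually_within_interval:
  fixes d :: real
  assumes "\<forall>\<^sub>F e in at d within A. Q e" "Q d"
  shows "\<exists>\<delta>>0. \<forall>e\<in>A. \<bar>e - d\<bar> < \<delta> \<longrightarrow> Q e"
proof -
  obtain \<delta> where "\<delta> > 0" "\<And>e. e \<in> A \<Longrightarrow> e \<noteq> d \<Longrightarrow> dist e d < \<delta> \<Longrightarrow> Q e"
    using assms(1) unfolding eventually_at by blast
  then show ?thesis using assms(2) by (intro exI[of _ \<delta>]) (auto simp: dist_real_def)
qed

lemma radial_solution_of_zero:
  assumes dim: "N = DIM('a::euclidean_space)" and D: "0 < D" "D < R" and z: "v D R = 0"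
  shows "radial_solution TYPE('a) R p lam \<mu> (\<lambda>r. D * v D r)"
    and "nodal_profile R (card (inner_zeros D)) (\<lambda>r. D * v D r)"
proof -
  interpret A: radial_profile N D "reaction p lam (coeff D)" "potential p lam (coeff D)" "v D" "Y D"
    by (rule profile) (use D in auto)
  show "radial_solution TYPE('a) R p lam \<mu> (\<lambda>r. D * v D r)"
    unfolding radial_solution_def
    using A.solves_P_profile[OF dim R z continuous_reaction[OF p] reaction_scaled[OF D(1)]]
      A.solves_radial_ode_profile[OF R z reaction_scaled[OF D(1)]] dim by simp
  show "nodal_profile R (card (inner_zeros D)) (\<lambda>r. D * v D r)"
    using A.nodal_profile_scaled[OF D(1) R z] by (simp add: inner_zeros_def)
qed

text \<open>At the amplitudes of the ladder the two numbers of zeros differ, so the profile vanishes at \<open>R\<close>.\<close>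

lemma solutions_of_ladder:
  assumes dim: "N = DIM('a::euclidean_space)"
    and d0: "0 < d0" "d0 < R" "j \<le> card (inner_zeros d0)"
    and k: "card (all_zeros 0) \<le> k" "k \<le> j" and j: "j \<ge> 1"
  shows "has_nodal_solutions TYPE('a) R p lam \<mu> k j"
proof -
  obtain S L :: "nat \<Rightarrow> real" where
    S: "\<And>l. l \<in> {k + 1..j} \<Longrightarrow> 0 < S l \<and> S l < d0 \<and> card (inner_zeros (S l)) = l - 1 \<and> card (all_zeros (S l)) = l" and
    L: "\<And>l. l \<in> {1..j} \<Longrightarrow> d0 < L l \<and> L l < R \<and> card (inner_zeros (L l)) = l - 1 \<and> card (all_zeros (L l)) = l" and
    S_mono: "\<And>l l'. l \<in> {k + 1..j} \<Longrightarrow> l' \<in> {k + 1..j} \<Longrightarrow> l < l' \<Longrightarrow> S l < S l'" and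
    L_mono: "\<And>l l'. l \<in> {1..j} \<Longrightarrow> l' \<in> {1..j} \<Longrightarrow> l < l' \<Longrightarrow> L l' < L l"
  proof (rule solution_ladder[of d0 R j "\<lambda>d. card (inner_zeros d)" "\<lambda>d. card (all_zeros d)" k])
    fix d assume d: "d \<in> {0..R}"
    show "\<exists>\<delta>>0. \<forall>e\<in>{0..R}. \<bar>e - d\<bar> < \<delta> \<longrightarrow> card (inner_zeros d) \<le> card (inner_zeros e)"
      by (rule eventually_within_interval[OF inner_zeros_count_lower[OF d]]) simp
    show "\<exists>\<delta>>0. \<forall>e\<in>{0..R}. \<bar>e - d\<bar> < \<delta> \<longrightarrow> card (all_zeros e) \<le> card (all_zeros d)"
      by (rule eventually_within_interval[OF all_zeros_count_upper[OF d]]) simp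
    show "card (inner_zeros d) \<le> card (all_zeros d) \<and> card (all_zeros d) \<le> card (inner_zeros d) + 1"
      by (simp add: card_all_zeros[OF d])
  qed (use d0 k no_zeros_at_R in auto)
  have sol: "radial_solution TYPE('a) R p lam \<mu> (\<lambda>r. D * v D r) \<and> nodal_profile R (l - 1) (\<lambda>r. D * v D r) \<and> D * v D 0 = D"
    if D: "0 < D" "D < R" "card (inner_zeros D) = l - 1" "card (all_zeros D) = l" "l \<ge> 1" for D l
  proof -
    have DR: "D \<in> {0..R}" using D by simp
    have "v D R = 0" using card_all_zeros[OF DR] D by (auto split: if_splits)
    then show ?thesis using radial_solution_of_zero[OF dim D(1,2)] D(3) v_at_0[OF DR] by simp
  qed
  define us where "us l = (\<lambda>r. S l * v (S l) r)" for l
  define ul where "ul l = (\<lambda>r. L l * v (L l) r)" for l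
  have us: "radial_solution TYPE('a) R p lam \<mu> (us l) \<and> nodal_profile R (l - 1) (us l) \<and> us l 0 = S l"
    if "l \<in> {k + 1..j}" for l
    unfolding us_def by (rule sol) (use S[OF that] d0 that in auto)
  have ul: "radial_solution TYPE('a) R p lam \<mu> (ul l) \<and> nodal_profile R (l - 1) (ul l) \<and> ul l 0 = L l"
    if "l \<in> {1..j}" for l
    unfolding ul_def by (rule sol) (use L[OF that] d0 that in auto)
  have less: "us l 0 < ul l' 0" if "l \<in> {k + 1..j}" "l' \<in> {1..j}" for l l'
    using S[OF that(1)] L[OF that(2)] us[OF that(1)] ul[OF that(2)] by auto
  have us_less: "us l 0 < us l' 0" if "l \<in> {k + 1..j}" "l' \<in> {k + 1..j}" "l < l'" for l l'
    using S_mono[OF that] us[OF that(1)] us[OF that(2)] by simp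
  have ul_less: "ul l' 0 < ul l 0" if "l \<in> {1..j}" "l' \<in> {1..j}" "l < l'" for l l'
    using L_mono[OF that] ul[OF that(1)] ul[OF that(2)] by simp
  have "inj_on us {k + 1..j}"
  proof (rule inj_onI)
    fix x y assume "x \<in> {k + 1..j}" "y \<in> {k + 1..j}" "us x = us y"
    then show "x = y" using us_less[of x y] us_less[of y x] by (cases x y rule: linorder_cases) auto
  qed
  moreover have "inj_on ul {1..j}"
  proof (rule inj_onI)
    fix x y assume "x \<in> {1..j}" "y \<in> {1..j}" "ul x = ul y"
    then show "x = y" using ul_less[of x y] ul_less[of y x] by (cases x y rule: linorder_cases) auto
  qed
  moreover have "us ` {k + 1..j} \<inter> ul ` {1..j} = {}" using less by fastforce
  ultimately have "card (us ` {k + 1..j} \<union> ul ` {1..j}) = (j - k) + j"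
    by (subst card_Un_disjoint) (auto simp: card_image)
  then have card: "card (us ` {k + 1..j} \<union> ul ` {1..j}) = 2 * j - k" using k by simp
  have up: "sorted_wrt (<) (map (\<lambda>l. us l 0) [k + 1..<j + 1])"
    unfolding sorted_wrt_map by (rule sorted_wrt_mono_rel[OF _ sorted_wrt_upt]) (use us_less in auto)
  have down: "sorted_wrt (<) (map (\<lambda>l. ul l 0) (rev [1..<j + 1]))"
    unfolding sorted_wrt_map sorted_wrt_rev
    by (rule sorted_wrt_mono_rel[OF _ sorted_wrt_upt]) (use ul_less in auto)
  have "0 < us l 0" if "l \<in> {k + 1..j}" for l using us[OF that] S[OF that] by simp
  moreover have "0 < ul l 0" if "l \<in> {1..j}" for l using ul[OF that] L[OF that] d0 by simp
  ultimately have sorted: "sorted_wrt (<) (0 # map (\<lambda>l. us l 0) [k+1..<j+1] @ map (\<lambda>l. ul l 0) (rev [1..<j+1]))"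
    using up down less by (auto simp: sorted_wrt_append)
  show ?thesis unfolding has_nodal_solutions_def
    by (rule exI[of _ us], rule exI[of _ ul]) (use us ul card sorted in blast)
qed

end

section \<open>Existence and multiplicity of nodal solutions\<close>

definition many_zeros_above :: "nat \<Rightarrow> real \<Rightarrow> real \<Rightarrow> real \<Rightarrow> nat \<Rightarrow> real \<Rightarrow> bool" where
  "many_zeros_above N R p lam j m \<longleftrightarrow> m \<ge> 0 \<and> (\<forall>\<mu> v Y. \<mu> > m \<longrightarrow>
     radial_profile N (R / (6 * j)) (reaction p lam (\<mu> * (R / (6 * j)) powr (p - 2)))
       (potential p lam (\<mu> * (R / (6 * j)) powr (p - 2))) v Y \<longrightarrow>
     j \<le> card {r \<in> {0<..<R}. v r = 0})"

text \<open>For \<open>d = R / (6 * j)\<close> the interval from \<open>d / 2\<close> to \<open>R\<close> has room for \<open>j\<close> windows of length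
  \<open>5 * d\<close> whose starting points are \<open>6 * d\<close> apart.\<close>

lemma many_zeros_for_large_coefficient:
  fixes R p lam :: real and j :: nat
  assumes R: "R > 0" and p: "p > 2" and lam: "lam \<ge> 0" and j: "j \<ge> 1"
  shows "\<exists>m. many_zeros_above N R p lam j m"
proof -
  define d where "d = R / (6 * j)"
  have d: "0 < d" "d < R" using R j by (auto simp: d_def field_simps)
  have Rd: "R = 6 * d * j" using j by (simp add: d_def)
  obtain C where C: "\<And>c v Y a. \<lbrakk>c \<ge> C; radial_profile N d (reaction p lam c) (potential p lam c) v Y;
      d / 2 \<le> a; a + 5 * d \<le> R\<rbrakk> \<Longrightarrow> \<exists>z\<in>{a..a + 5 * d}. v z = 0"
    using large_coefficient_zero_in_window[OF d p lam, of N] by metis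
  show ?thesis unfolding many_zeros_above_def
  proof (intro exI[of _ "max 0 (C / d powr (p - 2))"] conjI allI impI)
    show "max 0 (C / d powr (p - 2)) \<ge> 0" by simp
    fix \<mu> v Y
    assume \<mu>: "\<mu> > max 0 (C / d powr (p - 2))"
      and prof: "radial_profile N (R / (6 * j)) (reaction p lam (\<mu> * (R / (6 * j)) powr (p - 2)))
        (potential p lam (\<mu> * (R / (6 * j)) powr (p - 2))) v Y"
    have c: "\<mu> * d powr (p - 2) \<ge> C" using \<mu> d by (simp add: divide_less_eq)
    define a where "a i = d / 2 + 6 * d * real i" for i
    have end_le: "a i + 5 * d < R" if "i < j" for i
    proof -
      have "6 * d * (real i + 1) \<le> 6 * d * real j" using that d by (intro mult_left_mono) auto
      then show ?thesis using d unfolding a_def Rd by (simp add: algebra_simps)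
    qed
    have "\<exists>z. z \<in> {a i..a i + 5 * d} \<and> v z = 0" if "i < j" for i
      using C[OF c, of v Y "a i"] prof end_le[OF that] d unfolding d_def[symmetric] by (auto simp: a_def)
    then obtain z where z: "\<And>i. i < j \<Longrightarrow> z i \<in> {a i..a i + 5 * d} \<and> v (z i) = 0" by metis
    have z_less: "z i < z i'" if "i < i'" "i' < j" for i i'
    proof -
      have "6 * d * (real i + 1) \<le> 6 * d * real i'" using that d by (intro mult_left_mono) auto
      then have "a i + 5 * d < a i'" using d unfolding a_def by (simp add: algebra_simps)
      then show ?thesis using z[of i] z[of i'] that by auto
    qed
    have inj: "inj_on z {..<j}"
    proof (rule inj_onI)
      fix x y assume "x \<in> {..<j}" "y \<in> {..<j}" "z x = z y"
      then show "x = y" using z_less[of x y] z_less[of y x] by (cases x y rule: linorder_cases) auto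
    qed
    have fin: "finite {r \<in> {0<..<R}. v r = 0}" by (rule radial_profile.finite_interior_zeros[OF prof])
    have "z ` {..<j} \<subseteq> {r \<in> {0<..<R}. v r = 0}"
    proof
      fix y assume "y \<in> z ` {..<j}"
      then obtain i where i: "i < j" "y = z i" by auto
      have "a i > 0" using d by (simp add: a_def add_pos_nonneg)
      then show "y \<in> {r \<in> {0<..<R}. v r = 0}" using z[OF i(1)] end_le[OF i(1)] i by auto
    qed
    from card_mono[OF fin this] show "j \<le> card {r \<in> {0<..<R}. v r = 0}"
      by (simp add: card_image[OF inj])
  qed
qed

theorem theorem1p2:
  fixes R p :: real
  assumes "CARD('n::finite) \<ge> 2" and "R > 0" and "p > 2"
  shows "\<exists>\<mu>star :: nat \<Rightarrow> real \<Rightarrow> real.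
    (\<forall>j\<ge>1. \<forall>lam\<ge>0.
       \<mu>star j lam \<ge> 0 \<and>
       (lam > lambda_rad TYPE(real^'n) R j \<longrightarrow> \<mu>star j lam = 0) \<and>
       \<mu>star j lam \<le> \<mu>star (j + 1) lam) \<and>
    (\<forall>(lam::real) (\<mu>::real) (k::nat) (j::nat).
       lambda_rad TYPE(real^'n) R k \<le> lam \<and> lam < lambda_rad TYPE(real^'n) R (k + 1) \<and>
       j \<ge> max 1 k \<and> \<mu> > \<mu>star j lam \<longrightarrow>
       (\<exists>us ul :: nat \<Rightarrow> real \<Rightarrow> real.
          (\<forall>l\<in>{k+1..j}. radial_solution TYPE(real^'n) R p lam \<mu> (us l)) \<and>
          (\<forall>l\<in>{1..j}. radial_solution TYPE(real^'n) R p lam \<mu> (ul l)) \<and>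
          card (us ` {k+1..j} \<union> ul ` {1..j}) = 2 * j - k \<and>
          sorted_wrt (<) (0 # map (\<lambda>l. us l 0) [k+1..<j+1] @ map (\<lambda>l. ul l 0) (rev [1..<j+1])) \<and>
          (\<forall>l\<in>{k+1..j}. nodal_profile R (l - 1) (us l)) \<and>
          (\<forall>l\<in>{1..j}. nodal_profile R (l - 1) (ul l))))"
proof -
  note R = assms(2) and p = assms(3)
  define N where "N = DIM(real^'n)"
  have N1: "N \<ge> 1" using DIM_positive[where 'a = "real^'n"] unfolding N_def by linarith
  obtain \<phi> \<Phi> where \<phi>: "radial_profile N 0 (\<lambda>s. s) (\<lambda>s. s\<^sup>2 / 2) \<phi> \<Phi>"
    by (rule linear_profile_exists[OF N1])
  define \<Lambda> where "\<Lambda> = lambda_rad TYPE(real^'n) R"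
  have \<phi>': "radial_profile DIM(real^'n) 0 (\<lambda>s. s) (\<lambda>s. s\<^sup>2 / 2) \<phi> \<Phi>"
    using \<phi> by (simp only: N_def)
  have "eigenvalue_list (radial_eigenvalues TYPE(real^'n) R) \<Lambda>"
    unfolding \<Lambda>_def by (rule eigenvalue_list_radial[where 'a = "real^'n", OF \<phi>' R])
  then interpret E: eigenvalue_list "radial_eigenvalues TYPE(real^'n) R" \<Lambda> .
  define M where "M lam j = (SOME m. many_zeros_above N R p lam j m)" for lam :: real and j :: nat
  have M: "many_zeros_above N R p lam j (M lam j)" if "lam \<ge> 0" "j \<ge> 1" for lam j
    unfolding M_def by (rule someI_ex[OF many_zeros_for_large_coefficient[OF R p that]])
  have M_nonneg: "M lam j \<ge> 0" if "lam \<ge> 0" "j \<ge> 1" for lam j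
    using M[OF that] by (simp add: many_zeros_above_def)
  \<comment> \<open>Summing the thresholds makes them increase with \<open>j\<close>.\<close>
  define \<mu>star where "\<mu>star j lam = (if lam > \<Lambda> j then 0 else \<Sum>i\<in>{1..j}. M lam i)" for j lam
  have nonneg: "\<mu>star j lam \<ge> 0" if "lam \<ge> 0" for j lam
    unfolding \<mu>star_def using M_nonneg[OF that] by (auto intro!: sum_nonneg)
  have ladder: "\<mu>star j lam \<le> \<mu>star (j + 1) lam" if "j \<ge> 1" "lam \<ge> 0" for j lam
  proof (cases "lam > \<Lambda> j")
    case True
    then show ?thesis using nonneg[OF that(2), of "j + 1"] by (simp add: \<mu>star_def)
  next
    case False
    then have "\<not> lam > \<Lambda> (j + 1)" using E.\<Lambda>_less_Suc[OF that(1)] by simp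
    then show ?thesis using False M_nonneg[OF that(2), of "j + 1"] by (simp add: \<mu>star_def)
  qed
  have main: "has_nodal_solutions TYPE(real^'n) R p lam \<mu> k j"
    if hyp: "\<Lambda> k \<le> lam" "lam < \<Lambda> (k + 1)" "j \<ge> max 1 k" "\<mu> > \<mu>star j lam" for lam \<mu> :: real and k j :: nat
  proof -
    have lam: "lam \<ge> 0" using E.\<Lambda>_nonneg[of k] hyp(1) by simp
    have \<mu>: "\<mu> > 0" using nonneg[OF lam, of j] hyp(4) by simp
    have j: "j \<ge> 1" "k \<le> j" using hyp(3) by auto
    obtain v Y where "shooting_family N R p lam \<mu> v Y"
      by (rule shooting_family_exists[OF N1 R p lam \<mu>])
    then interpret F: shooting_family N R p lam \<mu> v Y .
    have v0: "F.inner_zeros 0 = {r \<in> {0<..<R}. \<phi> (sqrt lam * r) = 0}"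
      "F.all_zeros 0 = {r \<in> {0..R}. \<phi> (sqrt lam * r) = 0}"
      unfolding F.inner_zeros_def F.all_zeros_def using F.limit_profile[OF \<phi>] by auto
    note counts = linear_zero_counts[OF \<phi>' R lam]
    have k: "card (F.all_zeros 0) \<le> k"
      unfolding v0 counts(2) by (rule E.card_below[OF hyp(2)])
    obtain d0 where d0: "0 < d0" "d0 < R" "j \<le> card (F.inner_zeros d0)"
    proof (cases "lam > \<Lambda> j")
      case True
      have "j \<le> card (F.inner_zeros 0)" unfolding v0 counts(1) by (rule E.card_above[OF True])
      moreover obtain \<delta> where \<delta>: "\<delta> > 0" "\<And>e. e \<in> {0..R} \<Longrightarrow> \<bar>e - 0\<bar> < \<delta> \<Longrightarrow>
          card (F.inner_zeros 0) \<le> card (F.inner_zeros e)"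
        using F.eventually_within_interval[OF F.inner_zeros_count_lower[of 0]] R by auto
      moreover define e where "e = min \<delta> R / 2"
      have e: "0 < e" "e < R" "e < \<delta>" using \<delta>(1) R by (auto simp: e_def min_def)
      then have "card (F.inner_zeros 0) \<le> card (F.inner_zeros e)" by (intro \<delta>(2)) auto
      ultimately show thesis using that[of e] e by linarith
    next
      case False
      have "M lam j \<le> (\<Sum>i\<in>{1..j}. M lam i)"
        using j M_nonneg[OF lam] by (intro member_le_sum) auto
      then have "\<mu> > M lam j" using hyp(4) False by (simp add: \<mu>star_def)
      moreover have d: "0 < R / (6 * j)" "R / (6 * j) < R" using R j by (auto simp: field_simps)
      ultimately have "j \<le> card (F.inner_zeros (R / (6 * j)))"
        using M[OF lam j(1)] F.profile[of "R / (6 * j)"]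
        unfolding many_zeros_above_def F.inner_zeros_def by auto
      then show thesis using that d by blast
    qed
    show ?thesis by (rule F.solutions_of_ladder[OF N_def d0 k j(2,1)])
  qed
  show ?thesis
  proof (rule exI[of _ \<mu>star], intro conjI allI impI)
    fix j :: nat and lam :: real assume jl: "1 \<le> j" "0 \<le> lam"
    show "\<mu>star j lam \<ge> 0" by (rule nonneg[OF jl(2)])
    show "\<mu>star j lam = 0" if "lam > lambda_rad TYPE(real^'n) R j"
      using that by (simp add: \<mu>star_def \<Lambda>_def)
    show "\<mu>star j lam \<le> \<mu>star (j + 1) lam" by (rule ladder[OF jl])
  qed (rule main[unfolded \<Lambda>_def has_nodal_solutions_def]; simp)
qed

end
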